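(* Let $\alpha\in(0,1)$, $p\in[1,\infty]$, and assume (Mass regularity), (Known covariate shift) and (Endpoint accuracy at $p$), all stated in the context. Fix $\delta\in(0,1)$ and $n,m\ge1$ such that $$2\mu_{\rm up}w_{\max}^{1/p}\epsilon_p(n,\delta/4)+(2-\alpha)\eta^w_m(\delta)<2\mu_{\rm low}r_-,$$ $$2\mu_{\rm up}w_{\max}^{1/p}\epsilon_p(n,\delta/4)+(2-\alpha)\eta^w_m(\delta)+\frac{(1-\alpha)w_{\max}}{m}\le2\mu_{\rm low}r_+ .$$ On the event $\mathcal A^w_{n,m}(\delta)=\mathcal E_{\rm tr}\cap\mathcal E^w_{\rm unif}$ defined in the context, which has probability at least $1-\delta$, $$\bigl\|\mathrm{Cov}_{\hat{\mathcal C}^w_\alpha}(\cdot)-(1-\alpha)\bigr\|_{L^p(Q_X)}\le2\mu_{\rm up}\Bigl(1+\frac{\mu_{\rm up}}{\mu_{\rm low}}\Bigr)w_{\max}^{1/p}\epsilon_p(n,\delta/4)+\frac{\mu_{\rm up}}{\mu_{\rm low}}\Bigl((2-\alpha)\eta^w_m(\delta)+\frac{1-\alpha}{m}\|w\|_{L^p(Q_X)}\Bigr).$$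
   Context: Convention: $w_{\max}^{1/\infty}=1$. Setup. $\mathcal X$ is a measurable space, $P_X$ a probability measure on $\mathcal X$, $x\mapsto P_{Y\mid X=x}$ a probability kernel from $\mathcal X$ to $\mathbb R$, and $P_{XY}=P_X\otimes P_{Y\mid X}$ (source law). For $\tau\in(0,1)$, $f^\star_\tau(x)=\inf\{t\in\mathbb R: P_{Y\mid X=x}((-\infty,t])\ge\tau\}$. (Mass regularity) There are constants $0<\mu_{\rm low}\le\mu_{\rm up}<\infty$, $r_0>0$ and a measurable set $\mathcal X_0$ with $P_X(\mathcal X_0)=1$ such that for every $x\in\mathcal X_0$: $P_{Y\mid X=x}([u,v])\le\mu_{\rm up}(v-u)$ for all finite $u\le v$; and for $\tau\in\{\alpha/2,1-\alpha/2\}$ and $0\le h\le r_0$, $P_{Y\mid X=x}([f^\star_\tau(x)-h,f^\star_\tau(x)])\ge\mu_{\rm low}h$ and $P_{Y\mid X=x}([f^\star_\tau(x),f^\star_\tau(x)+h])\ge\mu_{\rm low}h$. (Known covariate shift) $Q_X$ is a probability measure on $\mathcal X$ with $Q_X\ll P_X$; the likelihood ratio $w=dQ_X/dP_X$ and a deterministic constant $w_{\max}<\infty$ with $0\le w\le w_{\max}$ are known. $\chi^2(Q_X\Vert P_X)=\int(w-1)^2\,dP_X$. Samples. $\mathcal D^{\rm tr}_n\sim P_{XY}^{\otimes n}$ and $\mathcal D^{\rm cal}_m=\{(X_j,Y_j)\}_{j=1}^m\sim P_{XY}^{\otimes m}$ are independent. The training sample produces finite real-valued raw maps $(\mathcal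 D^{\rm tr}_n,x)\mapsto\widetilde f_{n,\tau}(x)$, jointly measurable, for $\tau\in\{\alpha/2,1-\alpha/2\}$. (Endpoint accuracy at $p$) There is $\epsilon_p:\mathbb N\times(0,1)\to[0,\infty)$ such that for every $n\in\mathbb N$, $\delta\in(0,1)$, $\tau\in\{\alpha/2,1-\alpha/2\}$: $\mathbb P_{\mathcal D^{\rm tr}_n}(\|\widetilde f_{n,\tau}-f^\star_\tau\|_{L^p(P_X)}\le\epsilon_p(n,\delta))\ge1-\delta$. Weighted CQR. Sorted endpoints $\hat f_{n,\alpha/2}=\widetilde f_{n,\alpha/2}\wedge\widetilde f_{n,1-\alpha/2}$, $\hat f_{n,1-\alpha/2}=\widetilde f_{n,\alpha/2}\vee\widetilde f_{n,1-\alpha/2}$; score $\widehat S(x,y)=\max\{\hat f_{n,\alpha/2}(x)-y,\;y-\hat f_{n,1-\alpha/2}(x)\}$; $\widehat S_j=\widehat S(X_j,Y_j)$. For $x$ with $w(x)>0$ (a set of full $Q_X$-measure), $\widehat Q^w_m(x)\in(-\infty,+\infty]$ is the $(1-\alpha)$-quantile (smallest $t$ such that $(-\infty,t]$ has mass at least $1-\alpha$, and $+\infty$ if no such real $t$ exists) of the probability measure $$\sum_{j=1}^m\frac{w(X_j)}{\sum_{i=1}^mw(X_i)+w(x)}\,\delta_{\widehat S_j}+\frac{w(x)}{\sum_{i=1}^mw(X_i)+w(x)}\,\delta_{+\infty}.$$ The weighted CQR set is $\hat{\mathcal C}^w_\alpha(x)=\{y\in\mathbb R:\widehat S(x,y)\le\widehat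 Q^w_m(x)\}$. For fixed data, $\mathrm{Cov}_C(x)=P_{Y\mid X=x}(C(x))$ is the conditional coverage profile of a set-valued rule $C$. Scales: $\eta^w_m(\delta)=9\sqrt{\frac{(1+\chi^2(Q_X\Vert P_X))\log(4/\delta)}{m}}+\frac{4w_{\max}\log(4/\delta)}{3m}$, $r_-=r_0\wedge\frac{1-\alpha}{2\mu_{\rm up}}$, $r_+=r_0$. Events: $\mathcal E_{\rm tr}=\bigcap_{\tau\in\{\alpha/2,1-\alpha/2\}}\{\|\widetilde f_{n,\tau}-f^\star_\tau\|_{L^p(P_X)}\le\epsilon_p(n,\delta/4)\}$; $\mathcal E^w_{\rm unif}=\{\sup_{t\in\mathbb R}|\widehat F^w_m(t)-F^Q_{\widehat S}(t)|\le\eta^w_m(\delta)\}$, where $\widehat F^w_m(t)=\frac1m\sum_{j=1}^mw(X_j)\mathbf 1\{\widehat S_j\le t\}$ and $F^Q_{\widehat S}(t)=(Q_X\otimes P_{Y\mid X})\{(x,y):\widehat S(x,y)\le t\}$ (training sample held fixed). *)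

theory Defs
  imports "HOL-Probability.Probability"
begin

section \<open>Extended-valued \<open>L\<^sup>p\<close> norms, \<open>1 \<le> p \<le> \<infinity>\<close>\<close>

definition Lp_norm :: "ennreal \<Rightarrow> 'a measure \<Rightarrow> ('a \<Rightarrow> real) \<Rightarrow> ennreal" where
  "Lp_norm p M f =
     (if p = top then esssup M (\<lambda>x. ennreal \<bar>f x\<bar>)
      else let I = (\<integral>\<^sup>+ x. ennreal (\<bar>f x\<bar> powr enn2real p) \<partial>M)
           in if I = top then top else ennreal (enn2real I powr (1 / enn2real p)))"

(* c^(1/p), with the convention c^(1/infinity) = 1 *)
definition exponent_root :: "ennreal \<Rightarrow> real \<Rightarrow> real" where
  "exponent_root p c = (if p = top then 1 else c powr (1 / enn2real p))"


section \<open>Source law and standing assumptions\<close>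

(* The measurable space of covariates is (space PX, sets PX).  For a probability measure PX and a
   kernel K this is the law of (X,Y) when X is distributed as PX and Y given X = x as K x. *)
definition kernel_prod :: "'a measure \<Rightarrow> ('a \<Rightarrow> real measure) \<Rightarrow> ('a \<times> real) measure" where
  "kernel_prod PX K = PX \<bind> (\<lambda>x. distr (K x) (PX \<Otimes>\<^sub>M borel) (Pair x))"

definition sample_law ::
  "'a measure \<Rightarrow> ('a \<Rightarrow> real measure) \<Rightarrow> nat \<Rightarrow> (nat \<Rightarrow> 'a \<times> real) measure" where
  "sample_law PX K k = (\<Pi>\<^sub>M i\<in>{..<k}. kernel_prod PX K)"

definition fstar :: "('a \<Rightarrow> real measure) \<Rightarrow> real \<Rightarrow> 'a \<Rightarrow> real" where
  "fstar K \<tau> x = Inf {t. measure (K x) {..t} \<ge> \<tau>}"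

definition mass_regularity ::
  "'a measure \<Rightarrow> ('a \<Rightarrow> real measure) \<Rightarrow> real \<Rightarrow> real \<Rightarrow> real \<Rightarrow> real \<Rightarrow> bool" where
  "mass_regularity PX K \<alpha> \<mu>low \<mu>up r0 \<longleftrightarrow>
     0 < \<mu>low \<and> \<mu>low \<le> \<mu>up \<and> 0 < r0 \<and>
     (\<exists>X0\<in>sets PX. measure PX X0 = 1 \<and>
        (\<forall>x\<in>X0.
           (\<forall>u v. u \<le> v \<longrightarrow> measure (K x) {u..v} \<le> \<mu>up * (v - u)) \<and>
           (\<forall>\<tau>\<in>{\<alpha>/2, 1 - \<alpha>/2}. \<forall>h. 0 \<le> h \<and> h \<le> r0 \<longrightarrow>
              measure (K x) {fstar K \<tau> x - h .. fstar K \<tau> x} \<ge> \<mu>low * h \<and>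
              measure (K x) {fstar K \<tau> x .. fstar K \<tau> x + h} \<ge> \<mu>low * h)))"

definition known_covariate_shift ::
  "'a measure \<Rightarrow> 'a measure \<Rightarrow> ('a \<Rightarrow> real) \<Rightarrow> real \<Rightarrow> bool" where
  "known_covariate_shift PX QX w wmax \<longleftrightarrow>
     prob_space QX \<and> sets QX = sets PX \<and> absolutely_continuous PX QX \<and>
     w \<in> borel_measurable PX \<and> QX = density PX (\<lambda>x. ennreal (w x)) \<and>
     (\<forall>x\<in>space PX. 0 \<le> w x \<and> w x \<le> wmax)"

definition chi_square :: "'a measure \<Rightarrow> ('a \<Rightarrow> real) \<Rightarrow> real" where
  "chi_square PX w = (\<integral>x. (w x - 1)\<^sup>2 \<partial>PX)"

(* A learner ft maps a sample size n and a training sample d (of which only the entries with index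
   below n matter) to the raw endpoint maps \<tau> \<mapsto> x \<mapsto> ft n d \<tau> x. *)
definition measurable_raw_maps ::
  "'a measure \<Rightarrow> ('a \<Rightarrow> real measure) \<Rightarrow> real \<Rightarrow>
   (nat \<Rightarrow> (nat \<Rightarrow> 'a \<times> real) \<Rightarrow> real \<Rightarrow> 'a \<Rightarrow> real) \<Rightarrow> bool" where
  "measurable_raw_maps PX K \<alpha> ft \<longleftrightarrow>
     (\<forall>n\<ge>1. \<forall>\<tau>\<in>{\<alpha>/2, 1 - \<alpha>/2}.
        (\<lambda>(d, x). ft n d \<tau> x) \<in> borel_measurable (sample_law PX K n \<Otimes>\<^sub>M PX))"

definition endpoint_accuracy ::
  "'a measure \<Rightarrow> ('a \<Rightarrow> real measure) \<Rightarrow> real \<Rightarrow> ennreal \<Rightarrow>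
   (nat \<Rightarrow> (nat \<Rightarrow> 'a \<times> real) \<Rightarrow> real \<Rightarrow> 'a \<Rightarrow> real) \<Rightarrow> (nat \<Rightarrow> real \<Rightarrow> real) \<Rightarrow> bool" where
  "endpoint_accuracy PX K \<alpha> p ft \<epsilon> \<longleftrightarrow>
     (\<forall>n\<ge>1. \<forall>\<delta>. 0 < \<delta> \<and> \<delta> < 1 \<longrightarrow> 0 \<le> \<epsilon> n \<delta> \<and>
        (\<forall>\<tau>\<in>{\<alpha>/2, 1 - \<alpha>/2}.
           measure (sample_law PX K n)
             {d \<in> space (sample_law PX K n).
                Lp_norm p PX (\<lambda>x. ft n d \<tau> x - fstar K \<tau> x) \<le> ennreal (\<epsilon> n \<delta>)} \<ge> 1 - \<delta>))"


section \<open>Weighted conformalized quantile regression\<close>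

(* Below, g = ft n d is the fitted pair of raw maps and c the calibration sample, with
   entries indexed by 0, ..., m - 1. *)

definition sorted_lo :: "real \<Rightarrow> (real \<Rightarrow> 'a \<Rightarrow> real) \<Rightarrow> 'a \<Rightarrow> real" where
  "sorted_lo \<alpha> g x = min (g (\<alpha>/2) x) (g (1 - \<alpha>/2) x)"

definition sorted_hi :: "real \<Rightarrow> (real \<Rightarrow> 'a \<Rightarrow> real) \<Rightarrow> 'a \<Rightarrow> real" where
  "sorted_hi \<alpha> g x = max (g (\<alpha>/2) x) (g (1 - \<alpha>/2) x)"

definition cqr_score :: "real \<Rightarrow> (real \<Rightarrow> 'a \<Rightarrow> real) \<Rightarrow> 'a \<Rightarrow> real \<Rightarrow> real" where
  "cqr_score \<alpha> g x y = max (sorted_lo \<alpha> g x - y) (y - sorted_hi \<alpha> g x)"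

(* The atom with index m is the point mass at +infinity.  If w x > 0 the weights sum to 1; when
   w x = 0 and all calibration weights vanish this is the zero measure (division by 0 is 0), a
   case of QX-measure 0 in x. *)
definition weighted_score_law ::
  "real \<Rightarrow> ('a \<Rightarrow> real) \<Rightarrow> (real \<Rightarrow> 'a \<Rightarrow> real) \<Rightarrow> nat \<Rightarrow> (nat \<Rightarrow> 'a \<times> real) \<Rightarrow> 'a \<Rightarrow> ereal measure" where
  "weighted_score_law \<alpha> w g m c x =
     distr
       (point_measure {..m}
          (\<lambda>j. ennreal ((if j < m then w (fst (c j)) else w x) / ((\<Sum>i<m. w (fst (c i))) + w x))))
       borel
       (\<lambda>j. if j < m then ereal (cqr_score \<alpha> g (fst (c j)) (snd (c j))) else \<infinity>)"

(* Only real thresholds t compete, so the value is +infinity (infimum of the empty set) when no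
   real t reaches the level. *)
definition ereal_quantile :: "real \<Rightarrow> ereal measure \<Rightarrow> ereal" where
  "ereal_quantile \<beta> N = Inf {ereal t | t. measure N {..ereal t} \<ge> \<beta>}"

definition weighted_quantile ::
  "real \<Rightarrow> ('a \<Rightarrow> real) \<Rightarrow> (real \<Rightarrow> 'a \<Rightarrow> real) \<Rightarrow> nat \<Rightarrow> (nat \<Rightarrow> 'a \<times> real) \<Rightarrow> 'a \<Rightarrow> ereal" where
  "weighted_quantile \<alpha> w g m c x = ereal_quantile (1 - \<alpha>) (weighted_score_law \<alpha> w g m c x)"

definition weighted_cqr_set ::
  "real \<Rightarrow> ('a \<Rightarrow> real) \<Rightarrow> (real \<Rightarrow> 'a \<Rightarrow> real) \<Rightarrow> nat \<Rightarrow> (nat \<Rightarrow> 'a \<times> real) \<Rightarrow> 'a \<Rightarrow> real set" where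
  "weighted_cqr_set \<alpha> w g m c x = {y. ereal (cqr_score \<alpha> g x y) \<le> weighted_quantile \<alpha> w g m c x}"

definition cov_profile :: "('a \<Rightarrow> real measure) \<Rightarrow> ('a \<Rightarrow> real set) \<Rightarrow> 'a \<Rightarrow> real" where
  "cov_profile K C x = measure (K x) (C x)"


section \<open>Scales and events\<close>

definition eta_w :: "'a measure \<Rightarrow> ('a \<Rightarrow> real) \<Rightarrow> real \<Rightarrow> nat \<Rightarrow> real \<Rightarrow> real" where
  "eta_w PX w wmax m \<delta> =
     9 * sqrt ((1 + chi_square PX w) * ln (4 / \<delta>) / real m) + 4 * wmax * ln (4 / \<delta>) / (3 * real m)"

definition r_minus :: "real \<Rightarrow> real \<Rightarrow> real \<Rightarrow> real" where
  "r_minus \<alpha> \<mu>up r0 = min r0 ((1 - \<alpha>) / (2 * \<mu>up))"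

definition r_plus :: "real \<Rightarrow> real" where
  "r_plus r0 = r0"

definition weighted_ecdf ::
  "real \<Rightarrow> ('a \<Rightarrow> real) \<Rightarrow> (real \<Rightarrow> 'a \<Rightarrow> real) \<Rightarrow> nat \<Rightarrow> (nat \<Rightarrow> 'a \<times> real) \<Rightarrow> real \<Rightarrow> real" where
  "weighted_ecdf \<alpha> w g m c t =
     (1 / real m) *
     (\<Sum>j<m. w (fst (c j)) * of_bool (cqr_score \<alpha> g (fst (c j)) (snd (c j)) \<le> t))"

definition target_cdf ::
  "'a measure \<Rightarrow> ('a \<Rightarrow> real measure) \<Rightarrow> real \<Rightarrow> (real \<Rightarrow> 'a \<Rightarrow> real) \<Rightarrow> real \<Rightarrow> real" where
  "target_cdf QX K \<alpha> g t =
     measure (kernel_prod QX K)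
       {z \<in> space (kernel_prod QX K). cqr_score \<alpha> g (fst z) (snd z) \<le> t}"

(* Data are pairs (d, c) of a training and a calibration sample on the canonical product space. *)
definition data_law ::
  "'a measure \<Rightarrow> ('a \<Rightarrow> real measure) \<Rightarrow> nat \<Rightarrow> nat \<Rightarrow>
   ((nat \<Rightarrow> 'a \<times> real) \<times> (nat \<Rightarrow> 'a \<times> real)) measure" where
  "data_law PX K n m = sample_law PX K n \<Otimes>\<^sub>M sample_law PX K m"

definition event_tr ::
  "'a measure \<Rightarrow> ('a \<Rightarrow> real measure) \<Rightarrow> real \<Rightarrow> ennreal \<Rightarrow>
   (nat \<Rightarrow> (nat \<Rightarrow> 'a \<times> real) \<Rightarrow> real \<Rightarrow> 'a \<Rightarrow> real) \<Rightarrow> (nat \<Rightarrow> real \<Rightarrow> real) \<Rightarrow>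
   nat \<Rightarrow> nat \<Rightarrow> real \<Rightarrow> ((nat \<Rightarrow> 'a \<times> real) \<times> (nat \<Rightarrow> 'a \<times> real)) set" where
  "event_tr PX K \<alpha> p ft \<epsilon> n m \<delta> =
     (\<Inter>\<tau>\<in>{\<alpha>/2, 1 - \<alpha>/2}.
        {(d, c) \<in> space (data_law PX K n m).
           Lp_norm p PX (\<lambda>x. ft n d \<tau> x - fstar K \<tau> x) \<le> ennreal (\<epsilon> n (\<delta> / 4))})"

definition event_unif ::
  "'a measure \<Rightarrow> ('a \<Rightarrow> real measure) \<Rightarrow> 'a measure \<Rightarrow> ('a \<Rightarrow> real) \<Rightarrow> real \<Rightarrow> real \<Rightarrow>
   (nat \<Rightarrow> (nat \<Rightarrow> 'a \<times> real) \<Rightarrow> real \<Rightarrow> 'a \<Rightarrow> real) \<Rightarrow>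
   nat \<Rightarrow> nat \<Rightarrow> real \<Rightarrow> ((nat \<Rightarrow> 'a \<times> real) \<times> (nat \<Rightarrow> 'a \<times> real)) set" where
  "event_unif PX K QX w wmax \<alpha> ft n m \<delta> =
     {(d, c) \<in> space (data_law PX K n m).
        (SUP t::real. ereal \<bar>weighted_ecdf \<alpha> w (ft n d) m c t - target_cdf QX K \<alpha> (ft n d) t\<bar>)
          \<le> ereal (eta_w PX w wmax m \<delta>)}"

definition good_event ::
  "'a measure \<Rightarrow> ('a \<Rightarrow> real measure) \<Rightarrow> 'a measure \<Rightarrow> ('a \<Rightarrow> real) \<Rightarrow> real \<Rightarrow> real \<Rightarrow> ennreal \<Rightarrow>
   (nat \<Rightarrow> (nat \<Rightarrow> 'a \<times> real) \<Rightarrow> real \<Rightarrow> 'a \<Rightarrow> real) \<Rightarrow> (nat \<Rightarrow> real \<Rightarrow> real) \<Rightarrow>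
   nat \<Rightarrow> nat \<Rightarrow> real \<Rightarrow> ((nat \<Rightarrow> 'a \<times> real) \<times> (nat \<Rightarrow> 'a \<times> real)) set" where
  "good_event PX K QX w wmax \<alpha> p ft \<epsilon> n m \<delta> =
     event_tr PX K \<alpha> p ft \<epsilon> n m \<delta> \<inter> event_unif PX K QX w wmax \<alpha> ft n m \<delta>"

end

theory Submission
  imports Defs
begin

text \<open>
  For fixed data, the weighted CQR set at \<open>x\<close> is the interval obtained from the sorted fitted
  endpoints by moving both of them outwards by the weighted quantile \<open>q(x)\<close>.  The coverage of such
  an interval differs from \<open>1 - \<alpha>\<close>, the coverage of the interval between the two true conditional
  quantiles, by at most \<open>\<mu>up\<close> times the total displacement of the endpoints (lemma
  \<open>fitted_vs_oracle_coverage\<close>): the endpoint error \<open>\<Delta>(x)\<close> of the two raw maps, which sorting does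
  not increase, plus \<open>2 \<bar>q(x)\<bar>\<close>.  So everything rests on a bound for \<open>\<bar>q(x)\<bar>\<close>.

  This bound comes from the target distribution function \<open>F\<close> of the score.  By mass regularity the
  interval between the true quantiles, enlarged by a small \<open>t\<close>, has coverage at least \<open>1 - \<alpha> + 2 \<mu>low t\<close>, and
  shrunk by \<open>t\<close> at most \<open>1 - \<alpha> - 2 \<mu>low t\<close>.  Averaging over the target covariates transfers this
  linear growth to \<open>F\<close>, up to \<open>\<mu>up\<close> times the mean of \<open>\<Delta>\<close> (lemmas \<open>target_cdf_lower\<close>,
  \<open>target_cdf_upper\<close>); that mean is at most twice \<open>wmax\<^sup>1\<^sup>/\<^sup>p \<epsilon>\<close>, by comparison of the \<open>L\<^sup>1\<close> and the
  \<open>L\<^sup>p\<close> norm and change of measure.  Now \<open>q(x)\<close> is the least \<open>t\<close> at which the weighted empirical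
  distribution function reaches \<open>1 - \<alpha>\<close> times (its total mass plus \<open>w x / m\<close>).  On the good event the
  function is within \<open>\<eta>\<close> of \<open>F\<close> and its total mass within \<open>\<eta>\<close> of 1, so \<open>F\<close> at \<open>q(x)\<close> lies between
  \<open>1 - \<alpha> - (2 - \<alpha>) \<eta>\<close> and \<open>1 - \<alpha> + (2 - \<alpha>) \<eta> + (1 - \<alpha>) w x / m\<close>, and the linear growth turns this
  into a bound on \<open>\<bar>q(x)\<bar>\<close> (\<open>weighted_quantile_upper\<close>, \<open>weighted_quantile_lower\<close>).  The two smallness
  conditions keep the thresholds in the range where the growth is known.  Minkowski's inequality
  \<open>Lp_norm_add\<close> then gives the claim.

  The probability of the good event needs a uniform deviation bound for the weighted empirical
  distribution function with explicit constants.  It is obtained from exponential moments: the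
  centred process is compared with a process of random signs (\<open>symmetrization\<close>); for fixed data
  the supremum over thresholds is a maximum of partial sums of the signed weights, listed in the
  order of the scores, so Doob's \<open>L\<^sup>2\<close> inequality removes it at the price of a factor 4
  (\<open>maximal_rademacher_exp\<close>); what remains is a product of hyperbolic cosines, for which Bernstein's
  argument applies (\<open>weighted_empirical_process_tail\<close>).  The resulting tail \<open>8 (\<delta> / 4)\<^sup>2\<close> is at most
  \<open>\<delta> / 2\<close>.
\<close>

section \<open>Calculus of the extended \<open>L\<^sup>p\<close> norm\<close>

lemma one_le_enn2real: "1 \<le> p \<Longrightarrow> p \<noteq> top \<Longrightarrow> 1 \<le> enn2real p" for p :: ennreal
  by (metis enn2real_1 enn2real_mono ennreal_1 infinity_ennreal_def top.not_eq_extremum)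

text \<open>
  Convexity of \<open>x \<mapsto> x\<^sup>q\<close> up to and including the boundary point 0; the function being 0 there,
  it only remains to see that \<open>c\<^sup>q \<le> c\<close> for \<open>c\<close> in the unit interval.
\<close>

lemma powr_convex_combination:
  fixes y z q t :: real
  assumes q: "1 \<le> q" and yz: "0 \<le> y" "0 \<le> z" and t: "0 \<le> t" "t \<le> 1"
  shows "(t * y + (1 - t) * z) powr q \<le> t * y powr q + (1 - t) * z powr q"
proof -
  have scale: "(c * x) powr q \<le> c * x powr q" if "0 \<le> c" "c \<le> 1" "0 \<le> x" for c x :: real
  proof -
    have "c powr q \<le> c powr 1" using that q by (intro powr_mono') auto
    then show ?thesis using that by (simp add: powr_mult mult_right_mono)
  qed
  consider "y = 0" | "z = 0" | "0 < y" "0 < z" using yz by linarith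
  then show ?thesis
  proof cases
    case 3
    then show ?thesis using convex_onD[OF powr_convex[OF q], of "1 - t" y z] t by simp
  qed (use scale[of t y] scale[of "1 - t" z] t yz q in auto)
qed

text \<open>
  All later statements about the norm are inequalities \<open>Lp_norm p M f \<le> a\<close> with a real bound \<open>a\<close>.
  This lemma and the next one express them without suprema or roots.
\<close>

lemma Lp_norm_top_le_iff:
  assumes "f \<in> borel_measurable M" "0 \<le> a"
  shows "Lp_norm top M f \<le> ennreal a \<longleftrightarrow> (AE x in M. \<bar>f x\<bar> \<le> a)"
proof
  assume "Lp_norm top M f \<le> ennreal a"
  then show "AE x in M. \<bar>f x\<bar> \<le> a"
    using esssup_AE[where M = M and f = "\<lambda>x. ennreal \<bar>f x\<bar>"] assms
    by (auto simp: Lp_norm_def dest: order_trans elim!: eventually_mono)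
next
  assume "AE x in M. \<bar>f x\<bar> \<le> a"
  then show "Lp_norm top M f \<le> ennreal a"
    using assms unfolding Lp_norm_def by (auto intro!: esssup_I elim!: eventually_mono)
qed

lemma Lp_norm_le_iff:
  assumes "1 \<le> p" "p \<noteq> top" "0 \<le> a"
  shows "Lp_norm p M f \<le> ennreal a
    \<longleftrightarrow> (\<integral>\<^sup>+x. ennreal (\<bar>f x\<bar> powr enn2real p) \<partial>M) \<le> ennreal (a powr enn2real p)"
proof (cases "(\<integral>\<^sup>+x. ennreal (\<bar>f x\<bar> powr enn2real p) \<partial>M)")
  case top
  then show ?thesis using assms by (simp add: Lp_norm_def top_unique)
next
  case (real r)
  have q: "1 \<le> enn2real p" using assms by (intro one_le_enn2real)
  have "r powr (1 / enn2real p) \<le> a \<longleftrightarrow> r \<le> a powr enn2real p"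
  proof
    assume "r powr (1 / enn2real p) \<le> a"
    then have "(r powr (1 / enn2real p)) powr enn2real p \<le> a powr enn2real p"
      using q by (intro powr_mono2) auto
    then show "r \<le> a powr enn2real p" using q real by (simp add: powr_powr)
  next
    assume "r \<le> a powr enn2real p"
    then have "r powr (1 / enn2real p) \<le> (a powr enn2real p) powr (1 / enn2real p)"
      using q real by (intro powr_mono2) auto
    then show "r powr (1 / enn2real p) \<le> a" using q assms by (simp add: powr_powr)
  qed
  then show ?thesis using real assms by (simp add: Lp_norm_def)
qed

lemma Lp_norm_mono_AE:
  assumes "1 \<le> p" "f \<in> borel_measurable M" "AE x in M. \<bar>f x\<bar> \<le> \<bar>g x\<bar>" "g \<in> borel_measurable M"
    and g: "Lp_norm p M g \<le> ennreal a" and a: "0 \<le> a"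
  shows "Lp_norm p M f \<le> ennreal a"
proof (cases "p = top")
  case True
  then show ?thesis using assms by (auto simp: Lp_norm_top_le_iff elim!: eventually_elim2)
next
  case False
  have q: "1 \<le> enn2real p" using assms False by (intro one_le_enn2real)
  have "(\<integral>\<^sup>+x. ennreal (\<bar>f x\<bar> powr enn2real p) \<partial>M) \<le> (\<integral>\<^sup>+x. ennreal (\<bar>g x\<bar> powr enn2real p) \<partial>M)"
    using assms(3) q by (intro nn_integral_mono_AE) (auto elim!: eventually_mono intro!: ennreal_leI powr_mono2)
  then show ?thesis using g a assms(1) False by (auto simp: Lp_norm_le_iff)
qed

lemma Lp_norm_cmult:
  assumes p: "1 \<le> p" and [measurable]: "f \<in> borel_measurable M"
    and f: "Lp_norm p M f \<le> ennreal a" and "0 \<le> a" "0 \<le> c"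
  shows "Lp_norm p M (\<lambda>x. c * f x) \<le> ennreal (c * a)"
proof (cases "p = top")
  case True
  then show ?thesis
    using assms by (auto simp: Lp_norm_top_le_iff abs_mult intro: mult_left_mono elim!: eventually_mono)
next
  case False
  have "(\<integral>\<^sup>+x. ennreal (\<bar>c * f x\<bar> powr enn2real p) \<partial>M)
      = ennreal (c powr enn2real p) * (\<integral>\<^sup>+x. ennreal (\<bar>f x\<bar> powr enn2real p) \<partial>M)"
    using assms by (simp add: abs_mult powr_mult ennreal_mult' nn_integral_cmult)
  also have "\<dots> \<le> ennreal (c powr enn2real p) * ennreal (a powr enn2real p)"
    using assms False by (intro mult_left_mono) (auto simp: Lp_norm_le_iff)
  also have "\<dots> = ennreal ((c * a) powr enn2real p)"
    using assms by (simp add: powr_mult ennreal_mult')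
  finally show ?thesis using assms False by (simp add: Lp_norm_le_iff)
qed

lemma (in prob_space) Lp_norm_const_le:
  assumes "1 \<le> p" "0 \<le> c"
  shows "Lp_norm p M (\<lambda>_. c) \<le> ennreal c"
  using assms by (cases "p = top") (auto simp: Lp_norm_top_le_iff Lp_norm_le_iff emeasure_space_1)

text \<open>
  Minkowski's inequality.  Up to the factor \<open>a + b\<close>, the number \<open>\<bar>f x\<bar> + \<bar>g x\<bar>\<close> is a convex combination
  of \<open>\<bar>f x\<bar> / a\<close> and \<open>\<bar>g x\<bar> / b\<close>; convexity of the power and integration give the bound, since both
  normalized functions have \<open>L\<^sup>p\<close> norm at most 1.  This needs positive \<open>a\<close> and \<open>b\<close>; the degenerate
  bounds follow in \<open>Lp_norm_add\<close> by approximation.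
\<close>

lemma Lp_norm_add_pos:
  assumes p: "1 \<le> p" and [measurable]: "f \<in> borel_measurable M" "g \<in> borel_measurable M"
    and f: "Lp_norm p M f \<le> ennreal a" and g: "Lp_norm p M g \<le> ennreal b" and ab: "0 < a" "0 < b"
  shows "Lp_norm p M (\<lambda>x. f x + g x) \<le> ennreal (a + b)"
proof (cases "p = top")
  case True
  then have "AE x in M. \<bar>f x\<bar> \<le> a" "AE x in M. \<bar>g x\<bar> \<le> b"
    using f g ab by (auto simp: Lp_norm_top_le_iff)
  then have "AE x in M. \<bar>f x + g x\<bar> \<le> a + b" by eventually_elim linarith
  then show ?thesis using ab unfolding True by (subst Lp_norm_top_le_iff) auto
next
  case False
  define q where "q = enn2real p"
  have q: "1 \<le> q" unfolding q_def using p False by (rule one_le_enn2real)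
  define t where "t = a / (a + b)"
  define k where "k = (a + b) powr q"
  have t: "0 \<le> t" "t \<le> 1" "(a + b) * t = a" "(a + b) * (1 - t) = b"
    using ab by (auto simp: t_def field_simps)
  have k: "0 \<le> k" unfolding k_def by simp
  have pt: "\<bar>f x + g x\<bar> powr q \<le> k * (t / a powr q) * \<bar>f x\<bar> powr q + k * ((1 - t) / b powr q) * \<bar>g x\<bar> powr q" for x
  proof -
    have "\<bar>f x + g x\<bar> \<le> (a + b) * (t * (\<bar>f x\<bar> / a) + (1 - t) * (\<bar>g x\<bar> / b))"
      using abs_triangle_ineq[of "f x" "g x"] ab unfolding distrib_left mult.assoc[symmetric] t by simp
    then have "\<bar>f x + g x\<bar> powr q \<le> ((a + b) * (t * (\<bar>f x\<bar> / a) + (1 - t) * (\<bar>g x\<bar> / b))) powr q"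
      using q by (intro powr_mono2) auto
    also have "\<dots> = k * (t * (\<bar>f x\<bar> / a) + (1 - t) * (\<bar>g x\<bar> / b)) powr q"
      unfolding k_def by (rule powr_mult)
    also have "\<dots> \<le> k * (t * (\<bar>f x\<bar> / a) powr q + (1 - t) * (\<bar>g x\<bar> / b) powr q)"
      using q t ab k by (intro mult_left_mono powr_convex_combination) auto
    finally show ?thesis using ab by (simp add: powr_divide algebra_simps)
  qed
  have "(\<integral>\<^sup>+x. ennreal (\<bar>f x + g x\<bar> powr q) \<partial>M)
      \<le> (\<integral>\<^sup>+x. ennreal (k * (t / a powr q)) * ennreal (\<bar>f x\<bar> powr q)
          + ennreal (k * ((1 - t) / b powr q)) * ennreal (\<bar>g x\<bar> powr q) \<partial>M)"
    using pt t k by (intro nn_integral_mono) (simp flip: ennreal_mult' ennreal_plus)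
  also have "\<dots> = ennreal (k * (t / a powr q)) * (\<integral>\<^sup>+x. ennreal (\<bar>f x\<bar> powr q) \<partial>M)
      + ennreal (k * ((1 - t) / b powr q)) * (\<integral>\<^sup>+x. ennreal (\<bar>g x\<bar> powr q) \<partial>M)"
    by (subst nn_integral_add) (auto simp: nn_integral_cmult)
  also have "\<dots> \<le> ennreal (k * (t / a powr q)) * ennreal (a powr q)
      + ennreal (k * ((1 - t) / b powr q)) * ennreal (b powr q)"
    using f g ab p False unfolding q_def by (intro add_mono mult_left_mono) (auto simp: Lp_norm_le_iff)
  also have "\<dots> = ennreal (k * t + k * (1 - t))"
    using ab k t by (simp flip: ennreal_mult' ennreal_plus)
  also have "k * t + k * (1 - t) = k" by (simp add: algebra_simps)
  finally show ?thesis using ab p False by (subst Lp_norm_le_iff) (auto simp: k_def q_def)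
qed

lemma Lp_norm_add:
  assumes p: "1 \<le> p" and [measurable]: "f \<in> borel_measurable M" "g \<in> borel_measurable M"
    and f: "Lp_norm p M f \<le> ennreal a" and g: "Lp_norm p M g \<le> ennreal b" and ab: "0 \<le> a" "0 \<le> b"
  shows "Lp_norm p M (\<lambda>x. f x + g x) \<le> ennreal (a + b)"
proof (rule ennreal_le_epsilon)
  fix e :: real assume e: "0 < e"
  have "Lp_norm p M (\<lambda>x. f x + g x) \<le> ennreal ((a + e / 2) + (b + e / 2))"
    using ab e by (intro Lp_norm_add_pos p order_trans[OF f] order_trans[OF g] ennreal_leI) auto
  also have "\<dots> = ennreal (a + b) + ennreal e"
    using ab e by (simp flip: ennreal_plus)
  finally show "Lp_norm p M (\<lambda>x. f x + g x) \<le> ennreal (a + b) + ennreal e" .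
qed

text \<open>
  The \<open>L\<^sup>1\<close> norm is at most the \<open>L\<^sup>p\<close> norm on a probability space.  Integrate Young's inequality
  \<open>u \<le> u\<^sup>q / q + (1 - 1 / q)\<close> at \<open>u = \<bar>f x\<bar> / c\<close>, for \<open>c\<close> slightly above the norm bound.
\<close>

lemma (in prob_space) nn_integral_le_Lp_norm:
  assumes p: "1 \<le> p" and [measurable]: "f \<in> borel_measurable M"
    and f: "Lp_norm p M f \<le> ennreal a" and a: "0 \<le> a"
  shows "(\<integral>\<^sup>+x. ennreal \<bar>f x\<bar> \<partial>M) \<le> ennreal a"
proof (rule ennreal_le_epsilon)
  fix e :: real assume e: "0 < e"
  define c where "c = a + e"
  have c: "0 < c" "Lp_norm p M f \<le> ennreal c"
    using a e by (auto simp: c_def intro: order_trans[OF f] ennreal_leI)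
  have "(\<integral>\<^sup>+x. ennreal \<bar>f x\<bar> \<partial>M) \<le> ennreal c"
  proof (cases "p = top")
    case True
    then have "AE x in M. \<bar>f x\<bar> \<le> c" using c by (simp add: Lp_norm_top_le_iff)
    then have "(\<integral>\<^sup>+x. ennreal \<bar>f x\<bar> \<partial>M) \<le> (\<integral>\<^sup>+x. ennreal c \<partial>M)"
      by (intro nn_integral_mono_AE) (auto elim!: eventually_mono intro: ennreal_leI)
    then show ?thesis by (simp add: emeasure_space_1)
  next
    case False
    define q where "q = enn2real p"
    have q: "1 \<le> q" unfolding q_def using p False by (rule one_le_enn2real)
    have pt: "\<bar>f x\<bar> \<le> c / (q * c powr q) * \<bar>f x\<bar> powr q + c * (1 - 1 / q)" for x
    proof (cases "f x = 0")
      case False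
      then have "\<bar>f x\<bar> / c \<le> 1 / q * (\<bar>f x\<bar> / c) powr q + (1 - 1 / q)"
        using Youngs_inequality_0[of "1 / q" "1 - 1 / q" "(\<bar>f x\<bar> / c) powr q" 1] q c
        by (simp add: powr_powr)
      then have "c * (\<bar>f x\<bar> / c) \<le> c * (1 / q * (\<bar>f x\<bar> / c) powr q + (1 - 1 / q))"
        using c by (intro mult_left_mono) auto
      then show ?thesis using c by (simp add: powr_divide distrib_left)
    qed (use c q in auto)
    have "(\<integral>\<^sup>+x. ennreal \<bar>f x\<bar> \<partial>M)
        \<le> (\<integral>\<^sup>+x. ennreal (c / (q * c powr q)) * ennreal (\<bar>f x\<bar> powr q) + ennreal (c * (1 - 1 / q)) \<partial>M)"
      using pt c q by (intro nn_integral_mono) (simp flip: ennreal_mult' ennreal_plus)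
    also have "\<dots> = ennreal (c / (q * c powr q)) * (\<integral>\<^sup>+x. ennreal (\<bar>f x\<bar> powr q) \<partial>M) + ennreal (c * (1 - 1 / q))"
      by (subst nn_integral_add) (auto simp: nn_integral_cmult emeasure_space_1)
    also have "\<dots> \<le> ennreal (c / (q * c powr q)) * ennreal (c powr q) + ennreal (c * (1 - 1 / q))"
      using c p False unfolding q_def by (intro add_mono mult_left_mono) (auto simp: Lp_norm_le_iff)
    also have "\<dots> = ennreal (c / q + c * (1 - 1 / q))"
      using c q by (simp flip: ennreal_mult' ennreal_plus)
    also have "c / q + c * (1 - 1 / q) = c" by (simp add: algebra_simps)
    finally show ?thesis .
  qed
  then show "(\<integral>\<^sup>+x. ennreal \<bar>f x\<bar> \<partial>M) \<le> ennreal a + ennreal e"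
    using a e by (simp add: c_def)
qed

text \<open>
  Change of measure: a density bounded by \<open>b\<close> multiplies \<open>\<integral> \<bar>f\<bar>\<^sup>p\<close> by at most \<open>b\<close>, and does not enlarge
  an essential supremum.
\<close>

lemma Lp_norm_density_le:
  assumes p: "1 \<le> p" and [measurable]: "f \<in> borel_measurable M" "w \<in> borel_measurable M"
    and w: "\<And>x. x \<in> space M \<Longrightarrow> 0 \<le> w x \<and> w x \<le> b" and b: "0 \<le> b"
    and f: "Lp_norm p M f \<le> ennreal a" and a: "0 \<le> a"
  shows "Lp_norm p (density M (\<lambda>x. ennreal (w x))) f \<le> ennreal (exponent_root p b * a)"
proof (cases "p = top")
  case True
  then have "AE x in M. \<bar>f x\<bar> \<le> a" using f a by (simp add: Lp_norm_top_le_iff)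
  then show ?thesis
    using True a by (auto simp: Lp_norm_top_le_iff exponent_root_def AE_density elim!: eventually_mono)
next
  case False
  define q where "q = enn2real p"
  have q: "1 \<le> q" unfolding q_def using p False by (rule one_le_enn2real)
  have "(\<integral>\<^sup>+x. ennreal (\<bar>f x\<bar> powr q) \<partial>density M (\<lambda>x. ennreal (w x)))
      = (\<integral>\<^sup>+x. ennreal (w x) * ennreal (\<bar>f x\<bar> powr q) \<partial>M)"
    by (rule nn_integral_density) measurable
  also have "\<dots> \<le> (\<integral>\<^sup>+x. ennreal b * ennreal (\<bar>f x\<bar> powr q) \<partial>M)"
    using w by (intro nn_integral_mono mult_right_mono ennreal_leI) auto
  also have "\<dots> = ennreal b * (\<integral>\<^sup>+x. ennreal (\<bar>f x\<bar> powr q) \<partial>M)"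
    by (rule nn_integral_cmult) measurable
  also have "\<dots> \<le> ennreal b * ennreal (a powr q)"
    using f a p False unfolding q_def by (intro mult_left_mono) (auto simp: Lp_norm_le_iff)
  also have "\<dots> = ennreal ((exponent_root p b * a) powr q)"
    using False q b a by (simp add: exponent_root_def q_def[symmetric] powr_mult powr_powr ennreal_mult')
  finally show ?thesis
    using p False a unfolding q_def by (subst Lp_norm_le_iff) (auto simp: exponent_root_def)
qed

lemma ennreal_combine:
  assumes "0 \<le> a" "0 \<le> b" "0 \<le> c" "0 \<le> d" "0 \<le> e"
  shows "ennreal a + ennreal b * (ennreal c + ennreal d * ennreal e) = ennreal (a + b * (c + d * e))"
  using assms by (simp add: ennreal_mult' ennreal_plus)


section \<open>A maximal inequality for signed sums\<close>

lemma sum_Pow_insert: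
  fixes f :: "'i set \<Rightarrow> 'b::comm_monoid_add"
  assumes "finite I" "j \<notin> I"
  shows "(\<Sum>A\<in>Pow (insert j I). f A) = (\<Sum>A\<in>Pow I. f A + f (insert j A))"
proof -
  have "(\<Sum>A\<in>Pow (insert j I). f A) = (\<Sum>A\<in>Pow I. f A) + (\<Sum>A\<in>insert j ` Pow I. f A)"
    unfolding Pow_insert using assms by (intro sum.union_disjoint) auto
  also have "(\<Sum>A\<in>insert j ` Pow I. f A) = (\<Sum>A\<in>Pow I. f (insert j A))"
    using assms by (subst sum.reindex) (auto simp: inj_on_def)
  finally show ?thesis by (simp add: sum.distrib)
qed

text \<open>
  A vector of signs is represented by the set of its positive coordinates, so that an average over
  independent fair signs indexed by \<open>I\<close> is an average over \<open>Pow I\<close>.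
\<close>

definition rademacher :: "'i set \<Rightarrow> 'i \<Rightarrow> real" where
  "rademacher A i = (if i \<in> A then 1 else - 1)"

lemma rademacher_insert: "j \<notin> I \<Longrightarrow> i \<in> I \<Longrightarrow> rademacher (insert j A) i = rademacher A i"
  by (auto simp: rademacher_def)

text \<open>
  One step of Doob's \<open>L\<^sup>2\<close> maximal inequality, in potential form.  For a current value \<open>x\<close> with running
  maximum \<open>m\<close> the potential is \<open>4 x\<^sup>2 P - 4 m x + 2 m\<^sup>2\<close>, where \<open>P\<close> is the factor by which the mean
  square still grows.  Multiplying \<open>x\<close> by \<open>exp (\<plusminus> a / 2)\<close> with equal probability yields a
  mean potential of at most the old one with \<open>cosh a * P\<close> in place of \<open>P\<close>.
\<close>

lemma doob_potential:
  fixes x x' m P a :: real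
  assumes x: "0 < x" "x \<le> m"
  defines "u \<equiv> x * exp (- a / 2)" and "v \<equiv> x * exp (a / 2)"
  shows "(4 * u\<^sup>2 * P - 4 * max m u * u + 2 * (max m u)\<^sup>2)
       + (4 * v\<^sup>2 * P - 4 * max m v * v + 2 * (max m v)\<^sup>2)
       \<le> 2 * (4 * x\<^sup>2 * (cosh a * P) - 4 * m * x + 2 * m\<^sup>2)"
proof -
  \<comment> \<open>raising the maximum to a new record only lowers the potential\<close>
  have drop: "2 * (max m y)\<^sup>2 - 4 * max m y * y \<le> 2 * m\<^sup>2 - 4 * m * y" for y :: real
  proof (cases "y \<le> m")
    case False
    have "0 \<le> (y - m)\<^sup>2" by simp
    then show ?thesis using False by (simp add: max_def power2_eq_square algebra_simps)
  qed (simp add: max_def)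
  have sq: "u\<^sup>2 + v\<^sup>2 = 2 * x\<^sup>2 * cosh a"
    by (simp add: u_def v_def power_mult_distrib cosh_def power2_eq_square algebra_simps
        flip: exp_add)
  have "u + v = 2 * x * cosh (a / 2)"
    by (simp add: u_def v_def cosh_def algebra_simps)
  moreover have "1 \<le> cosh (a / 2)" by (rule cosh_real_ge_1)
  ultimately have "2 * x \<le> u + v" using x by simp
  then have "4 * m * (2 * x) \<le> 4 * m * (u + v)"
    using x by (intro mult_left_mono) auto
  moreover have "4 * (u\<^sup>2 + v\<^sup>2) * P = 8 * x\<^sup>2 * (cosh a * P)" by (simp add: sq)
  ultimately show ?thesis using drop[of u] drop[of v] by (simp add: algebra_simps)
qed

text \<open>
  For given signs, the sums over \<open>{i. s i \<le> t}\<close> are the partial sums obtained by adding the indices in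
  increasing order of \<open>s\<close>, and \<open>exp\<close> of half of them is a submartingale.  The induction removes the
  index with the smallest \<open>s\<close>, that is, the first step of the walk; the potential of the remaining
  walk is then averaged with \<open>doob_potential\<close>.  The supremum over thresholds is expressed by an
  arbitrary threshold \<open>\<tau> A\<close> chosen with knowledge of the signs, so that ties in \<open>s\<close> do no harm.
\<close>

lemma maximal_rademacher_square:
  fixes s a :: "'i \<Rightarrow> real"
  assumes "finite I"
  shows "0 < x \<Longrightarrow> x \<le> m \<Longrightarrow>
    (\<Sum>A\<in>Pow I. (max m (x * exp ((\<Sum>i\<in>{i\<in>I. s i \<le> \<tau> A}. rademacher A i * a i) / 2)))\<^sup>2)
      \<le> 2 ^ card I * (4 * x\<^sup>2 * (\<Prod>i\<in>I. cosh (a i)) - 4 * m * x + 2 * m\<^sup>2)"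
  using assms
proof (induction I arbitrary: x m \<tau> rule: finite_ranking_induct[where f = "\<lambda>i. - s i"])
  case empty
  then show ?case
    using zero_le_power2[of "m - 2 * x"] by (simp add: max_absorb1 power2_eq_square algebra_simps)
next
  case (insert j I)
  show ?case
  proof (cases "j \<in> I")
    case True
    then show ?thesis using insert by (simp add: insert_absorb)
  next
    case False
    note jI = False
    define S where "S A t = (\<Sum>i\<in>{i\<in>I. s i \<le> t}. rademacher A i * a i)" for A t
    define u v where "u = x * exp (- a j / 2)" and "v = x * exp (a j / 2)"
    have uv: "0 < u" "0 < v" using insert.prems by (auto simp: u_def v_def)
    have first: "(max m (x * exp ((\<Sum>i\<in>{i\<in>insert j I. s i \<le> t}. rademacher B i * a i) / 2)))\<^sup>2
        \<le> (max (max m y) (y * exp (S A t / 2)))\<^sup>2"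
      if AB: "A \<subseteq> I" "B = A \<or> B = insert j A" and y: "y = x * exp (rademacher B j * a j / 2)"
      for A B t y
    proof (rule power_mono)
      show "0 \<le> max m (x * exp ((\<Sum>i\<in>{i\<in>insert j I. s i \<le> t}. rademacher B i * a i) / 2))"
        using insert.prems by auto
      have same: "(\<Sum>i\<in>{i\<in>I. s i \<le> t}. rademacher B i * a i) = S A t"
        unfolding S_def using AB jI by (intro sum.cong) (auto simp: rademacher_insert)
      show "max m (x * exp ((\<Sum>i\<in>{i\<in>insert j I. s i \<le> t}. rademacher B i * a i) / 2))
        \<le> max (max m y) (y * exp (S A t / 2))"
      proof (cases "s j \<le> t")
        case True
        then have "{i\<in>insert j I. s i \<le> t} = insert j {i\<in>I. s i \<le> t}" by auto
        then have "(\<Sum>i\<in>{i\<in>insert j I. s i \<le> t}. rademacher B i * a i)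
            = rademacher B j * a j + S A t"
          using same jI insert.hyps by simp
        then have "x * exp ((\<Sum>i\<in>{i\<in>insert j I. s i \<le> t}. rademacher B i * a i) / 2) = y * exp (S A t / 2)"
          by (simp only: y add_divide_distrib exp_add mult.assoc)
        then show ?thesis by (simp only: le_max_iff_disj max.bounded_iff) auto
      next
        case False
        then have empty: "{i\<in>insert j I. s i \<le> t} = {}" using insert.hyps by force
        show ?thesis unfolding empty using insert.prems by (simp add: le_max_iff_disj)
      qed
    qed
    have "(\<Sum>A\<in>Pow (insert j I). (max m (x * exp ((\<Sum>i\<in>{i\<in>insert j I. s i \<le> \<tau> A}.
              rademacher A i * a i) / 2)))\<^sup>2)
        \<le> (\<Sum>A\<in>Pow I. (max (max m u) (u * exp (S A (\<tau> A) / 2)))\<^sup>2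
              + (max (max m v) (v * exp (S A (\<tau> (insert j A)) / 2)))\<^sup>2)"
      unfolding sum_Pow_insert[OF insert.hyps(1) jI]
      using jI by (intro sum_mono add_mono first) (auto simp: rademacher_def u_def v_def)
    also have "\<dots> \<le> 2 ^ card I * (4 * u\<^sup>2 * (\<Prod>i\<in>I. cosh (a i)) - 4 * max m u * u + 2 * (max m u)\<^sup>2)
        + 2 ^ card I * (4 * v\<^sup>2 * (\<Prod>i\<in>I. cosh (a i)) - 4 * max m v * v + 2 * (max m v)\<^sup>2)"
      unfolding sum.distrib S_def using uv
      by (intro add_mono insert.IH[where \<tau> = "\<tau>"] insert.IH[where \<tau> = "\<lambda>A. \<tau> (insert j A)"]) auto
    also have "\<dots> = 2 ^ card I * ((4 * u\<^sup>2 * (\<Prod>i\<in>I. cosh (a i)) - 4 * max m u * u + 2 * (max m u)\<^sup>2)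
        + (4 * v\<^sup>2 * (\<Prod>i\<in>I. cosh (a i)) - 4 * max m v * v + 2 * (max m v)\<^sup>2))"
      by (simp add: algebra_simps)
    also have "\<dots> \<le> 2 ^ card I * (2 * (4 * x\<^sup>2 * (cosh (a j) * (\<Prod>i\<in>I. cosh (a i))) - 4 * m * x + 2 * m\<^sup>2))"
      unfolding u_def v_def using insert.prems by (intro mult_left_mono doob_potential) auto
    also have "\<dots> = 2 ^ card (insert j I) * (4 * x\<^sup>2 * (\<Prod>i\<in>insert j I. cosh (a i)) - 4 * m * x + 2 * m\<^sup>2)"
      using insert.hyps jI by simp
    finally show ?thesis .
  qed
qed

text \<open>
  The supremum over \<open>t\<close> is attained, as only finitely many index sets \<open>{i \<in> I. s i \<le> t}\<close> occur; so
  the previous lemma applies with a maximizing threshold for each sign vector.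
\<close>

lemma maximal_rademacher_exp:
  fixes s a :: "'i \<Rightarrow> real"
  assumes I: "finite I" and T: "T \<noteq> {}"
  shows "(\<Sum>A\<in>Pow I. SUP t\<in>T. ennreal (exp (\<Sum>i\<in>I. rademacher A i * (a i * of_bool (s i \<le> t)))))
      \<le> 2 ^ card I * ennreal (4 * (\<Prod>i\<in>I. cosh (a i)))"
proof -
  define S where "S A t = (\<Sum>i\<in>{i\<in>I. s i \<le> t}. rademacher A i * a i)" for A t
  have S: "(\<Sum>i\<in>I. rademacher A i * (a i * of_bool (s i \<le> t))) = S A t" for A t
    unfolding S_def using I by (simp add: sum.inter_filter of_bool_def if_distrib cong: if_cong)
  have "\<exists>t\<in>T. (SUP t\<in>T. ennreal (exp (S A t))) = ennreal (exp (S A t))" for A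
  proof -
    have "(\<lambda>t. ennreal (exp (S A t))) ` T
        \<subseteq> (\<lambda>J. ennreal (exp (\<Sum>i\<in>J. rademacher A i * a i))) ` Pow I"
      unfolding S_def by auto
    then have "finite ((\<lambda>t. ennreal (exp (S A t))) ` T)"
      by (rule finite_subset) (use I in auto)
    then have "(SUP t\<in>T. ennreal (exp (S A t))) \<in> (\<lambda>t. ennreal (exp (S A t))) ` T"
      using T by (metis Max_Sup Max_in image_is_empty)
    then show ?thesis by auto
  qed
  then obtain \<tau> where \<tau>: "\<And>A. (SUP t\<in>T. ennreal (exp (S A t))) = ennreal (exp (S A (\<tau> A)))"
    by metis
  have "(\<Sum>A\<in>Pow I. SUP t\<in>T. ennreal (exp (S A t))) = ennreal (\<Sum>A\<in>Pow I. exp (S A (\<tau> A)))"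
    by (simp add: \<tau> sum_ennreal)
  also have "\<dots> \<le> ennreal (2 ^ card I * (4 * (\<Prod>i\<in>I. cosh (a i))))"
  proof (rule ennreal_leI)
    have "(\<Sum>A\<in>Pow I. exp (S A (\<tau> A))) \<le> (\<Sum>A\<in>Pow I. (max 1 (1 * exp (S A (\<tau> A) / 2)))\<^sup>2)"
    proof (rule sum_mono)
      fix A
      have "exp (S A (\<tau> A)) = (exp (S A (\<tau> A) / 2))\<^sup>2" by (simp flip: exp_double)
      also have "\<dots> \<le> (max 1 (1 * exp (S A (\<tau> A) / 2)))\<^sup>2" by (intro power_mono) auto
      finally show "exp (S A (\<tau> A)) \<le> (max 1 (1 * exp (S A (\<tau> A) / 2)))\<^sup>2" .
    qed
    also have "\<dots> \<le> 2 ^ card I * (4 * 1\<^sup>2 * (\<Prod>i\<in>I. cosh (a i)) - 4 * 1 * 1 + 2 * 1\<^sup>2)"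
      unfolding S_def by (rule maximal_rademacher_square) (use I in auto)
    also have "\<dots> \<le> 2 ^ card I * (4 * (\<Prod>i\<in>I. cosh (a i)))"
      by (intro mult_left_mono) auto
    finally show "(\<Sum>A\<in>Pow I. exp (S A (\<tau> A))) \<le> 2 ^ card I * (4 * (\<Prod>i\<in>I. cosh (a i)))" .
  qed
  also have "\<dots> = 2 ^ card I * ennreal (4 * (\<Prod>i\<in>I. cosh (a i)))"
    by (subst ennreal_mult') (auto simp: ennreal_power[symmetric] prod_nonneg)
  finally show ?thesis by (simp only: S)
qed


section \<open>Uniform concentration of weighted empirical processes\<close>

lemma (in prob_space) exp_minus_expectation_le:
  assumes "X \<in> borel_measurable M" "\<And>y. y \<in> space M \<Longrightarrow> \<bar>X y\<bar> \<le> B"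
  shows "ennreal (exp (c - expectation X)) \<le> (\<integral>\<^sup>+y. ennreal (exp (c - X y)) \<partial>M)"
proof -
  let ?m = "expectation X"
  have X: "integrable M X"
    using assms by (intro integrable_const_bound[where B = B]) auto
  have int: "integrable M (\<lambda>y. exp (c - X y))"
    using assms by (intro integrable_const_bound[where B = "exp (c + B)"])
      (auto intro!: AE_I2, force)
  have "exp (c - ?m) = expectation (\<lambda>y. exp (c - ?m) * (1 + (?m - X y)))"
    using X by (simp add: prob_space)
  also have "\<dots> \<le> expectation (\<lambda>y. exp (c - X y))"
  proof (rule integral_mono[OF _ int])
    show "integrable M (\<lambda>y. exp (c - ?m) * (1 + (?m - X y)))" using X by simp
    fix y
    have "exp (c - ?m) * (1 + (?m - X y)) \<le> exp (c - ?m) * exp (?m - X y)"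
      by (intro mult_left_mono exp_ge_add_one_self) auto
    then show "exp (c - ?m) * (1 + (?m - X y)) \<le> exp (c - X y)" by (simp flip: exp_add)
  qed
  finally have "ennreal (exp (c - ?m)) \<le> ennreal (expectation (\<lambda>y. exp (c - X y)))"
    by (rule ennreal_leI)
  also have "\<dots> = (\<integral>\<^sup>+y. ennreal (exp (c - X y)) \<partial>M)"
    by (rule nn_integral_eq_integral[OF int, symmetric]) auto
  finally show ?thesis .
qed

text \<open>
  Symmetrization of one observation, by convexity of \<open>exp\<close>.  The exponent \<open>v + h - \<mu>\<close> is the midpoint of \<open>v + 2 h\<close> and
  \<open>v - 2 \<mu>\<close>, and by Jensen's inequality the mean \<open>\<mu>\<close> in the second exponent may be replaced by an average
  over \<open>h\<close>.  The function \<open>v\<close> stands for the contribution of all other observations.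
\<close>

lemma (in prob_space) symmetrization_step:
  fixes h :: "'t \<Rightarrow> 'a \<Rightarrow> real"
  assumes T: "countable T"
    and h [measurable]: "\<And>t. h t \<in> borel_measurable M"
    and bd: "\<And>t y. y \<in> space M \<Longrightarrow> \<bar>h t y\<bar> \<le> B"
  shows "2 * (\<integral>\<^sup>+y. (SUP t\<in>T. ennreal (exp (v t + (h t y - expectation (h t))))) \<partial>M)
    \<le> (\<integral>\<^sup>+y. (SUP t\<in>T. ennreal (exp (v t + (- 2) * h t y))) \<partial>M)
      + (\<integral>\<^sup>+y. (SUP t\<in>T. ennreal (exp (v t + 2 * h t y))) \<partial>M)"
proof -
  define F where "F y = (SUP t\<in>T. ennreal (exp (v t + 2 * h t y)))" for y
  define G where "G y = (SUP t\<in>T. ennreal (exp (v t + (- 2) * h t y)))" for y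
  have [measurable]: "F \<in> borel_measurable M" "G \<in> borel_measurable M"
    unfolding F_def G_def using T by (auto intro!: borel_measurable_SUP)
  have "2 * (SUP t\<in>T. ennreal (exp (v t + (h t y - expectation (h t))))) \<le> F y + (\<integral>\<^sup>+z. G z \<partial>M)" for y
    unfolding SUP_mult_left_ennreal
  proof (rule SUP_least)
    fix t assume t: "t \<in> T"
    \<comment> \<open>the arithmetic-geometric mean inequality for the two exponentials\<close>
    let ?p = "exp (v t / 2 + h t y)" and ?q = "exp (v t / 2 - expectation (h t))"
    have "0 \<le> (?p - ?q)\<^sup>2" by simp
    also have "\<dots> = exp (v t + 2 * h t y) + exp (v t - 2 * expectation (h t))
        - 2 * exp (v t + (h t y - expectation (h t)))"
      by (simp add: power2_diff mult.assoc algebra_simps flip: exp_add exp_double)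
    finally have "2 * ennreal (exp (v t + (h t y - expectation (h t))))
        \<le> ennreal (exp (v t + 2 * h t y)) + ennreal (exp (v t - expectation (\<lambda>z. 2 * h t z)))"
      by (simp add: ennreal_plus[symmetric] ennreal_mult''[symmetric] ennreal_numeral[symmetric]
          del: ennreal_plus ennreal_numeral)
    also have "ennreal (exp (v t + 2 * h t y)) \<le> F y"
      unfolding F_def using t by (rule SUP_upper)
    also have "ennreal (exp (v t - expectation (\<lambda>z. 2 * h t z)))
        \<le> (\<integral>\<^sup>+z. ennreal (exp (v t - 2 * h t z)) \<partial>M)"
      using bd by (intro exp_minus_expectation_le[where B = "2 * B"]) (auto simp: abs_mult)
    also have "\<dots> \<le> (\<integral>\<^sup>+z. G z \<partial>M)"
      unfolding G_def using t by (intro nn_integral_mono SUP_upper2[of t]) auto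
    finally show "2 * ennreal (exp (v t + (h t y - expectation (h t)))) \<le> F y + (\<integral>\<^sup>+z. G z \<partial>M)"
      by (simp add: add_mono)
  qed
  then have "(\<integral>\<^sup>+y. 2 * (SUP t\<in>T. ennreal (exp (v t + (h t y - expectation (h t))))) \<partial>M)
      \<le> (\<integral>\<^sup>+y. F y + (\<integral>\<^sup>+z. G z \<partial>M) \<partial>M)"
    by (intro nn_integral_mono)
  also have "\<dots> = (\<integral>\<^sup>+y. F y \<partial>M) + (\<integral>\<^sup>+z. G z \<partial>M)"
    by (simp add: nn_integral_add emeasure_space_1)
  also have "(\<integral>\<^sup>+y. 2 * (SUP t\<in>T. ennreal (exp (v t + (h t y - expectation (h t))))) \<partial>M)
      = 2 * (\<integral>\<^sup>+y. (SUP t\<in>T. ennreal (exp (v t + (h t y - expectation (h t))))) \<partial>M)"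
    using T by (intro nn_integral_cmult borel_measurable_SUP) auto
  finally show ?thesis unfolding F_def G_def by (simp add: add.commute)
qed

text \<open>
  Replacing the observations one at a time: the contribution of the observation that is treated
  enters \<open>v\<close>, which is why the statement is proved for all \<open>v\<close> at once.  The factor 2 in the exponent
  is the price of symmetrization.
\<close>

lemma (in prob_space) symmetrization:
  fixes h :: "'t \<Rightarrow> 'a \<Rightarrow> real"
  assumes T: "countable T"
    and h [measurable]: "\<And>t. h t \<in> borel_measurable M"
    and bd: "\<And>t y. y \<in> space M \<Longrightarrow> \<bar>h t y\<bar> \<le> B"
    and I: "finite I"
  shows "2 ^ card I * (\<integral>\<^sup>+z. (SUP t\<in>T. ennreal (exp (v t + (\<Sum>i\<in>I. h t (z i) - expectation (h t)))))
          \<partial>(\<Pi>\<^sub>M i\<in>I. M))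
    \<le> (\<integral>\<^sup>+z. (\<Sum>A\<in>Pow I. SUP t\<in>T. ennreal (exp (v t + 2 * (\<Sum>i\<in>I. rademacher A i * h t (z i)))))
          \<partial>(\<Pi>\<^sub>M i\<in>I. M))"
  using I
proof (induction I arbitrary: v rule: finite_induct)
  case empty
  show ?case by simp
next
  case (insert j I)
  interpret P: product_prob_space "\<lambda>_. M" by standard
  interpret PI: prob_space "\<Pi>\<^sub>M i\<in>I. M" by (rule prob_space_PiM) unfold_locales
  note [measurable] = borel_measurable_SUP[OF T]
  define R where "R v A z = (SUP t\<in>T. ennreal (exp (v t + 2 * (\<Sum>i\<in>I. rademacher A i * h t (z i)))))"
    for v A z
  have R_meas [measurable]: "(\<lambda>z. R v A z) \<in> borel_measurable (\<Pi>\<^sub>M i\<in>I. M)" for v A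
    unfolding R_def by measurable
  have upd: "(\<Sum>i\<in>insert j I. f i ((z(j := y)) i)) = f j y + (\<Sum>i\<in>I. f i (z i))"
    for f :: "'b \<Rightarrow> 'a \<Rightarrow> real" and z y
    using insert.hyps by (simp cong: sum.cong_simp) (intro sum.cong refl, auto)
  define G where "G v z = (SUP t\<in>T. ennreal (exp (v t + (\<Sum>i\<in>I. h t (z i) - expectation (h t)))))"
    for v z
  have G_eq: "(SUP t\<in>T. ennreal (exp ((v t + (\<Sum>i\<in>I. h t (z i) - expectation (h t))) + k t))) = G (\<lambda>t. v t + k t) z"
    for k z
    unfolding G_def by (simp only: add.assoc add.commute[of "sum _ _" "k _"])
  have G_meas [measurable]: "(\<lambda>(z, y). G (\<lambda>t. v t + c * h t y) z) \<in> borel_measurable ((\<Pi>\<^sub>M i\<in>I. M) \<Otimes>\<^sub>M M)" for c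
    unfolding G_def by measurable
  have swap: "(\<integral>\<^sup>+z. \<integral>\<^sup>+y. G (\<lambda>t. v t + c * h t y) z \<partial>M \<partial>(\<Pi>\<^sub>M i\<in>I. M))
      = (\<integral>\<^sup>+y. \<integral>\<^sup>+z. G (\<lambda>t. v t + c * h t y) z \<partial>(\<Pi>\<^sub>M i\<in>I. M) \<partial>M)" for c
  proof -
    interpret PS: pair_sigma_finite "\<Pi>\<^sub>M i\<in>I. M" M ..
    show ?thesis by (rule PS.Fubini'[symmetric]) (rule G_meas)
  qed
  have peel: "(\<integral>\<^sup>+z. (SUP t\<in>T. ennreal (exp (v t
          + (\<Sum>i\<in>insert j I. h t (z i) - expectation (h t))))) \<partial>(\<Pi>\<^sub>M i\<in>insert j I. M))
    = (\<integral>\<^sup>+z. \<integral>\<^sup>+y. G (\<lambda>t. v t + (h t y - expectation (h t))) z \<partial>M \<partial>(\<Pi>\<^sub>M i\<in>I. M))"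
    by (subst P.product_nn_integral_insert[OF insert.hyps], measurable)
       (simp only: upd[of "\<lambda>i x. h _ x - expectation (h _)"] G_def add.assoc)
  have "2 * (\<integral>\<^sup>+z. \<integral>\<^sup>+y. G (\<lambda>t. v t + (h t y - expectation (h t))) z \<partial>M \<partial>(\<Pi>\<^sub>M i\<in>I. M))
      = (\<integral>\<^sup>+z. 2 * (\<integral>\<^sup>+y. G (\<lambda>t. v t + (h t y - expectation (h t))) z \<partial>M) \<partial>(\<Pi>\<^sub>M i\<in>I. M))"
    unfolding G_def by (intro nn_integral_cmult[symmetric]) measurable
  also have "\<dots> \<le> (\<integral>\<^sup>+z. (\<integral>\<^sup>+y. G (\<lambda>t. v t + (- 2) * h t y) z \<partial>M)
        + (\<integral>\<^sup>+y. G (\<lambda>t. v t + 2 * h t y) z \<partial>M) \<partial>(\<Pi>\<^sub>M i\<in>I. M))"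
  proof (rule nn_integral_mono)
    fix z
    show "2 * (\<integral>\<^sup>+y. G (\<lambda>t. v t + (h t y - expectation (h t))) z \<partial>M)
        \<le> (\<integral>\<^sup>+y. G (\<lambda>t. v t + (- 2) * h t y) z \<partial>M) + (\<integral>\<^sup>+y. G (\<lambda>t. v t + 2 * h t y) z \<partial>M)"
      using symmetrization_step[OF T h bd, where v = "\<lambda>t. v t + (\<Sum>i\<in>I. h t (z i) - expectation (h t))"]
      unfolding G_eq .
  qed
  also have "\<dots> = (\<integral>\<^sup>+y. \<integral>\<^sup>+z. G (\<lambda>t. v t + (- 2) * h t y) z \<partial>(\<Pi>\<^sub>M i\<in>I. M) \<partial>M)
      + (\<integral>\<^sup>+y. \<integral>\<^sup>+z. G (\<lambda>t. v t + 2 * h t y) z \<partial>(\<Pi>\<^sub>M i\<in>I. M) \<partial>M)"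
    unfolding swap[symmetric] by (rule nn_integral_add) (unfold G_def, measurable)
  finally have "2 * (\<integral>\<^sup>+z. \<integral>\<^sup>+y. G (\<lambda>t. v t + (h t y - expectation (h t))) z \<partial>M \<partial>(\<Pi>\<^sub>M i\<in>I. M))
     \<le> (\<integral>\<^sup>+y. \<integral>\<^sup>+z. G (\<lambda>t. v t + (- 2) * h t y) z \<partial>(\<Pi>\<^sub>M i\<in>I. M) \<partial>M)
      + (\<integral>\<^sup>+y. \<integral>\<^sup>+z. G (\<lambda>t. v t + 2 * h t y) z \<partial>(\<Pi>\<^sub>M i\<in>I. M) \<partial>M)" .
  then have "2 ^ card I * (2 * (\<integral>\<^sup>+z. \<integral>\<^sup>+y. G (\<lambda>t. v t + (h t y - expectation (h t))) z \<partial>M \<partial>(\<Pi>\<^sub>M i\<in>I. M)))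
     \<le> 2 ^ card I * ((\<integral>\<^sup>+y. \<integral>\<^sup>+z. G (\<lambda>t. v t + (- 2) * h t y) z \<partial>(\<Pi>\<^sub>M i\<in>I. M) \<partial>M)
      + (\<integral>\<^sup>+y. \<integral>\<^sup>+z. G (\<lambda>t. v t + 2 * h t y) z \<partial>(\<Pi>\<^sub>M i\<in>I. M) \<partial>M))"
    by (rule mult_left_mono) simp
  also have "\<dots> \<le> (\<integral>\<^sup>+y. (\<integral>\<^sup>+z. (\<Sum>A\<in>Pow I. R (\<lambda>t. v t + (- 2) * h t y) A z) \<partial>(\<Pi>\<^sub>M i\<in>I. M)) \<partial>M)
      + (\<integral>\<^sup>+y. (\<integral>\<^sup>+z. (\<Sum>A\<in>Pow I. R (\<lambda>t. v t + 2 * h t y) A z) \<partial>(\<Pi>\<^sub>M i\<in>I. M)) \<partial>M)"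
    proof -
    have "2 ^ card I * (\<integral>\<^sup>+y. \<integral>\<^sup>+z. G (\<lambda>t. v t + c * h t y) z \<partial>(\<Pi>\<^sub>M i\<in>I. M) \<partial>M)
      \<le> (\<integral>\<^sup>+y. (\<integral>\<^sup>+z. (\<Sum>A\<in>Pow I. R (\<lambda>t. v t + c * h t y) A z) \<partial>(\<Pi>\<^sub>M i\<in>I. M)) \<partial>M)" for c
    proof -
      have "2 ^ card I * (\<integral>\<^sup>+y. \<integral>\<^sup>+z. G (\<lambda>t. v t + c * h t y) z \<partial>(\<Pi>\<^sub>M i\<in>I. M) \<partial>M)
        = (\<integral>\<^sup>+y. 2 ^ card I * (\<integral>\<^sup>+z. G (\<lambda>t. v t + c * h t y) z \<partial>(\<Pi>\<^sub>M i\<in>I. M)) \<partial>M)"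
        by (rule nn_integral_cmult[symmetric]) (unfold G_def, measurable)
      also have "\<dots> \<le> (\<integral>\<^sup>+y. (\<integral>\<^sup>+z. (\<Sum>A\<in>Pow I. R (\<lambda>t. v t + c * h t y) A z) \<partial>(\<Pi>\<^sub>M i\<in>I. M)) \<partial>M)"
        unfolding G_def R_def by (intro nn_integral_mono insert.IH)
      finally show ?thesis .
    qed
    then show ?thesis unfolding distrib_left by (intro add_mono)
  qed
  also have "\<dots> = (\<integral>\<^sup>+y. (\<integral>\<^sup>+z. (\<Sum>A\<in>Pow I. R (\<lambda>t. v t + (- 2) * h t y) A z + R (\<lambda>t. v t + 2 * h t y) A z)
        \<partial>(\<Pi>\<^sub>M i\<in>I. M)) \<partial>M)"
  proof -
    have [measurable]: "(\<lambda>(y, z). R (\<lambda>t. v t + c * h t y) A z) \<in> borel_measurable (M \<Otimes>\<^sub>M (\<Pi>\<^sub>M i\<in>I. M))" for c A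
      unfolding R_def by measurable
    have "(\<integral>\<^sup>+y. (\<integral>\<^sup>+z. (\<Sum>A\<in>Pow I. R (\<lambda>t. v t + c * h t y) A z) \<partial>(\<Pi>\<^sub>M i\<in>I. M)) \<partial>M)
      + (\<integral>\<^sup>+y. (\<integral>\<^sup>+z. (\<Sum>A\<in>Pow I. R (\<lambda>t. v t + d * h t y) A z) \<partial>(\<Pi>\<^sub>M i\<in>I. M)) \<partial>M)
      = (\<integral>\<^sup>+y. (\<integral>\<^sup>+z. (\<Sum>A\<in>Pow I. R (\<lambda>t. v t + c * h t y) A z + R (\<lambda>t. v t + d * h t y) A z)
          \<partial>(\<Pi>\<^sub>M i\<in>I. M)) \<partial>M)" for c d
      by (simp add: sum.distrib nn_integral_add)
    then show ?thesis .
  qed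
  also have "\<dots> = (\<integral>\<^sup>+z. (\<Sum>A\<in>Pow (insert j I). SUP t\<in>T.
        ennreal (exp (v t + 2 * (\<Sum>i\<in>insert j I. rademacher A i * h t (z i))))) \<partial>(\<Pi>\<^sub>M i\<in>insert j I. M))"
  proof (subst P.product_nn_integral_insert_rev[OF insert.hyps], measurable, intro nn_integral_cong)
    fix y z
    show "(\<Sum>A\<in>Pow I. R (\<lambda>t. v t + (- 2) * h t y) A z + R (\<lambda>t. v t + 2 * h t y) A z)
      = (\<Sum>A\<in>Pow (insert j I). SUP t\<in>T.
        ennreal (exp (v t + 2 * (\<Sum>i\<in>insert j I. rademacher A i * h t ((z(j := y)) i)))))"
      unfolding sum_Pow_insert[OF insert.hyps]
    proof (intro sum.cong refl arg_cong2[where f = "(+)"])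
      fix A assume A: "A \<in> Pow I"
      then have j: "rademacher A j = - 1" "rademacher (insert j A) j = 1"
        using insert.hyps by (auto simp: rademacher_def)
      show "R (\<lambda>t. v t + (- 2) * h t y) A z = (SUP t\<in>T.
          ennreal (exp (v t + 2 * (\<Sum>i\<in>insert j I. rademacher A i * h t ((z(j := y)) i)))))"
        unfolding R_def upd[of "\<lambda>i x. rademacher A i * h _ x"] by (simp add: j algebra_simps)
      have "(\<Sum>i\<in>I. rademacher (insert j A) i * h t (z i)) = (\<Sum>i\<in>I. rademacher A i * h t (z i))" for t
        using insert.hyps by (intro sum.cong) (auto simp: rademacher_insert)
      then show "R (\<lambda>t. v t + 2 * h t y) A z = (SUP t\<in>T.
          ennreal (exp (v t + 2 * (\<Sum>i\<in>insert j I. rademacher (insert j A) i * h t ((z(j := y)) i)))))"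
        unfolding R_def upd[of "\<lambda>i x. rademacher (insert j A) i * h _ x"] by (simp add: j algebra_simps)
    qed
  qed
  finally show ?case
    unfolding peel card_insert_disjoint[OF insert.hyps] power_Suc2 mult.assoc .
qed

lemma borel_measurable_cosh [measurable (raw)]:
  fixes f :: "'a \<Rightarrow> real"
  assumes [measurable]: "f \<in> borel_measurable M"
  shows "(\<lambda>y. cosh (f y)) \<in> borel_measurable M"
  unfolding cosh_field_def by measurable

text \<open>
  After symmetrization the supremum over thresholds concerns signed sums of the fixed numbers
  \<open>2 c w (z i)\<close>, which the maximal inequality bounds by their full sum; independence then
  factorizes the mean of the product.
\<close>

lemma (in prob_space) mgf_weighted_empirical_process:
  fixes w s :: "'a \<Rightarrow> real"
  assumes T: "countable T" "T \<noteq> {}" and I: "finite I"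
    and [measurable]: "w \<in> borel_measurable M" "s \<in> borel_measurable M"
    and w: "\<And>y. y \<in> space M \<Longrightarrow> 0 \<le> w y \<and> w y \<le> b"
  shows "(\<integral>\<^sup>+z. (SUP t\<in>T. ennreal (exp (c * (\<Sum>i\<in>I. w (z i) * of_bool (s (z i) \<le> t)
            - expectation (\<lambda>y. w y * of_bool (s y \<le> t)))))) \<partial>(\<Pi>\<^sub>M i\<in>I. M))
    \<le> 4 * ennreal (expectation (\<lambda>y. cosh (2 * c * w y)) ^ card I)"
    (is "?E \<le> _")
proof -
  interpret P: product_prob_space "\<lambda>_. M" by standard
  define h where "h t y = c * (w y * of_bool (s y \<le> t))" for t y
  have [measurable]: "h t \<in> borel_measurable M" for t unfolding h_def by measurable
  have "0 \<le> b" using w subprob_not_empty by fastforce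
  then have bd: "\<bar>h t y\<bar> \<le> \<bar>c\<bar> * b" if "y \<in> space M" for t y
    using w[OF that] by (auto simp: h_def abs_mult intro!: mult_left_mono)
  have E_h: "expectation (h t) = c * expectation (\<lambda>y. w y * of_bool (s y \<le> t))" for t
    unfolding h_def by simp
  have "2 ^ card I * ?E = 2 ^ card I * (\<integral>\<^sup>+z. (SUP t\<in>T. ennreal (exp (0
      + (\<Sum>i\<in>I. h t (z i) - expectation (h t))))) \<partial>(\<Pi>\<^sub>M i\<in>I. M))"
    by (simp add: E_h sum_distrib_left right_diff_distrib) (simp add: h_def)
  also have "\<dots> \<le> (\<integral>\<^sup>+z. (\<Sum>A\<in>Pow I. SUP t\<in>T.
      ennreal (exp (0 + 2 * (\<Sum>i\<in>I. rademacher A i * h t (z i))))) \<partial>(\<Pi>\<^sub>M i\<in>I. M))"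
    by (rule symmetrization[OF T(1) _ bd I]) auto
  also have "\<dots> = (\<integral>\<^sup>+z. (\<Sum>A\<in>Pow I. SUP t\<in>T. ennreal (exp (\<Sum>i\<in>I. rademacher A i *
      ((2 * c * w (z i)) * of_bool (s (z i) \<le> t))))) \<partial>(\<Pi>\<^sub>M i\<in>I. M))"
    by (simp add: h_def sum_distrib_left mult_ac)
  also have "\<dots> \<le> (\<integral>\<^sup>+z. 2 ^ card I * ennreal (4 * (\<Prod>i\<in>I. cosh (2 * c * w (z i)))) \<partial>(\<Pi>\<^sub>M i\<in>I. M))"
    by (intro nn_integral_mono maximal_rademacher_exp I T)
  also have "\<dots> = 2 ^ card I * (4 * (\<integral>\<^sup>+z. (\<Prod>i\<in>I. ennreal (cosh (2 * c * w (z i)))) \<partial>(\<Pi>\<^sub>M i\<in>I. M)))"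
    by (simp add: nn_integral_cmult ennreal_mult' prod_ennreal prod_nonneg)
  also have "(\<integral>\<^sup>+z. (\<Prod>i\<in>I. ennreal (cosh (2 * c * w (z i)))) \<partial>(\<Pi>\<^sub>M i\<in>I. M))
      = (\<Prod>i\<in>I. \<integral>\<^sup>+y. ennreal (cosh (2 * c * w y)) \<partial>M)"
    by (intro P.product_nn_integral_prod I) measurable
  also have "(\<integral>\<^sup>+y. ennreal (cosh (2 * c * w y)) \<partial>M) = ennreal (expectation (\<lambda>y. cosh (2 * c * w y)))"
  proof (rule nn_integral_eq_integral)
    show "integrable M (\<lambda>y. cosh (2 * c * w y))"
    proof (rule integrable_const_bound[where B = "cosh (2 * \<bar>c\<bar> * b)"])
      show "AE y in M. norm (cosh (2 * c * w y)) \<le> cosh (2 * \<bar>c\<bar> * b)"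
      proof (rule AE_I2)
        fix y assume "y \<in> space M"
        then have "\<bar>2 * c * w y\<bar> \<le> 2 * \<bar>c\<bar> * b"
          using w[of y] by (auto simp: abs_mult intro!: mult_left_mono)
        then have "cosh \<bar>2 * c * w y\<bar> \<le> cosh (2 * \<bar>c\<bar> * b)"
          using \<open>0 \<le> b\<close> by (subst cosh_real_nonneg_le_iff) auto
        then show "norm (cosh (2 * c * w y)) \<le> cosh (2 * \<bar>c\<bar> * b)"
          by (metis abs_of_nonneg cosh_real_abs cosh_real_nonneg real_norm_def)
      qed
    qed measurable
  qed auto
  finally have "2 ^ card I * ?E \<le> 2 ^ card I * (4 * ennreal (expectation (\<lambda>y. cosh (2 * c * w y)) ^ card I))"
    by (simp add: ennreal_power)
  then show ?thesis by (subst (asm) ennreal_mult_le_mult_iff) (auto simp: power_eq_top_ennreal)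
qed

text \<open>
  Since \<open>cosh z - 1 = 2 sinh\<^sup>2 (z / 2)\<close>, this is the convexity of \<open>sinh\<close> on the positive half line.
\<close>

lemma cosh_mult_le:
  fixes y x :: real
  assumes y: "0 \<le> y" "y \<le> 1" and x: "0 \<le> x"
  shows "cosh (y * x) - 1 \<le> y\<^sup>2 * (cosh x - 1)"
proof -
  have "convex_on {0..} (sinh :: real \<Rightarrow> real)"
    by (rule f''_ge0_imp_convex[where f' = cosh and f'' = sinh])
       (auto intro!: derivative_eq_intros)
  from convex_onD[OF this, of y 0 "x / 2"] have "sinh (y * (x / 2)) \<le> y * sinh (x / 2)"
    using y x by simp
  moreover have "0 \<le> sinh (y * (x / 2))" using y x by simp
  ultimately have "(sinh (y * (x / 2)))\<^sup>2 \<le> (y * sinh (x / 2))\<^sup>2" by (intro power_mono)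
  moreover have "cosh z - 1 = 2 * (sinh (z / 2))\<^sup>2" for z :: real
    using cosh_add[of "z / 2" "z / 2"] cosh_square_eq[of "z / 2"] by (simp add: power2_eq_square)
  ultimately show ?thesis by (simp add: power_mult_distrib)
qed

text \<open>
  This is where the second moment of \<open>w\<close> enters: on \<open>[0, u]\<close> the function \<open>cosh\<close> minus 1 lies below
  the parabola with vertex at the origin that agrees with it at \<open>u\<close>.
\<close>

lemma (in prob_space) expectation_cosh_le:
  fixes w :: "'a \<Rightarrow> real"
  assumes [measurable]: "w \<in> borel_measurable M"
    and w: "\<And>y. y \<in> space M \<Longrightarrow> 0 \<le> w y \<and> w y \<le> b" and b: "0 < b" and u: "0 \<le> u"
  shows "expectation (\<lambda>y. cosh (u / b * w y)) \<le> exp (expectation (\<lambda>y. (w y)\<^sup>2) / b\<^sup>2 * (cosh u - 1))"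
proof -
  let ?f = "\<lambda>y. 1 + (w y)\<^sup>2 / b\<^sup>2 * (cosh u - 1)"
  have int: "integrable M (\<lambda>y. (w y)\<^sup>2)"
    using w by (intro integrable_const_bound[where B = "b\<^sup>2"]) (auto intro!: AE_I2 power_mono)
  have "expectation (\<lambda>y. cosh (u / b * w y)) \<le> expectation ?f"
  proof (rule integral_mono)
    have le: "cosh (u / b * w y) \<le> ?f y" if "y \<in> space M" for y
      using cosh_mult_le[of "w y / b" u] w[OF that] b u by (simp add: power_divide mult.commute)
    then show "\<And>y. y \<in> space M \<Longrightarrow> cosh (u / b * w y) \<le> ?f y" .
    show *: "integrable M ?f" using int by simp
    show "integrable M (\<lambda>y. cosh (u / b * w y))"
    proof (rule Bochner_Integration.integrable_bound[OF *])
      show "(\<lambda>y. cosh (u / b * w y)) \<in> borel_measurable M" by measurable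
      show "AE y in M. norm (cosh (u / b * w y)) \<le> norm (?f y)"
        by (intro AE_I2) (metis abs_ge_self abs_of_nonneg cosh_real_nonneg le order_trans real_norm_def)
    qed
  qed
  also have "\<dots> = 1 + expectation (\<lambda>y. (w y)\<^sup>2) / b\<^sup>2 * (cosh u - 1)"
    using int by (simp add: prob_space)
  also have "\<dots> \<le> exp (expectation (\<lambda>y. (w y)\<^sup>2) / b\<^sup>2 * (cosh u - 1))"
    by (rule exp_ge_add_one_self)
  finally show ?thesis .
qed

text \<open>
  The optimization of the Chernoff bound.  Here \<open>A\<close> is the total variance in units of the squared
  bound on the summands, and the deviation in units of that bound is \<open>9 \<surd>(A L) + 4/3 L\<close>.  If the variance is
  small, \<open>u = 3\<close> makes the linear term alone worth \<open>2 L\<close>, and \<open>cosh 3 - 1 \<le> 27/2\<close> pays for the variance;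
  otherwise \<open>u = \<surd>(L / A)\<close> balances the two variance terms.
\<close>

lemma bernstein_exponent:
  fixes A L :: real
  assumes A: "0 \<le> A" and L: "0 < L"
  obtains u where "0 < u" "2 * L \<le> u / 2 * (9 * sqrt (A * L) + 4 / 3 * L) - A * (cosh u - 1)"
proof (cases "A \<le> L")
  case True
  have "A = sqrt (A * A)" using A by simp
  also have "\<dots> \<le> sqrt (A * L)" using A True by (intro real_sqrt_le_mono mult_left_mono)
  finally have "A \<le> sqrt (A * L)" .
  moreover have "cosh (3::real) \<le> 14"
  proof -
    have "exp (3::real) = exp 1 ^ 3" by (simp flip: exp_of_nat_mult)
    also have "\<dots> \<le> 3 ^ 3" using exp_le by (intro power_mono) auto
    finally have "exp (3::real) \<le> 27" by simp
    moreover have "exp (- 3 :: real) \<le> 1" by (rule exp_le_one_iff[THEN iffD2]) simp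
    moreover have "a \<le> 27 \<Longrightarrow> b \<le> 1 \<Longrightarrow> (a + b) / 2 \<le> 14" for a b :: real by simp
    ultimately show ?thesis unfolding cosh_field_def by blast
  qed
  then have "A * (cosh 3 - 1) \<le> A * (27 / 2)" using A by (intro mult_left_mono) auto
  moreover have "2 * L \<le> 3 / 2 * (9 * g + 4 / 3 * L) - k" if "A \<le> g" "k \<le> A * (27 / 2)" for g k
    using that by argo
  ultimately show ?thesis by (intro that[of 3]) auto
next
  case False
  define u where "u = sqrt (L / A)"
  have u: "0 < u" "u \<le> 1" "u\<^sup>2 = L / A" using False L A by (auto simp: u_def)
  have "u * sqrt (A * L) = sqrt (L * L)"
    using False L A by (simp add: u_def flip: real_sqrt_mult)
  then have uL: "u * sqrt (A * L) = L" using L by simp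
  have "exp (- 1 :: real) \<le> 1" by simp
  then have "cosh (1::real) \<le> 2" using exp_le unfolding cosh_field_def by argo
  then have "u\<^sup>2 * (cosh 1 - 1) \<le> u\<^sup>2 * 1" by (intro mult_left_mono) auto
  with cosh_mult_le[of u 1] u have "cosh u - 1 \<le> L / A" by simp
  then have "A * (cosh u - 1) \<le> A * (L / A)" using A by (intro mult_left_mono)
  then have "A * (cosh u - 1) \<le> L" using False L by simp
  moreover have "u / 2 * (9 * sqrt (A * L) + 4 / 3 * L) = 9 / 2 * L + u * (2 / 3 * L)"
    using uL by (simp add: algebra_simps)
  moreover have "0 \<le> u * (2 / 3 * L)" using u L by simp
  ultimately have "2 * L \<le> u / 2 * (9 * sqrt (A * L) + 4 / 3 * L) - A * (cosh u - 1)"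
    using L by argo
  then show ?thesis using that[of u] u by blast
qed

text \<open>
  Chernoff's bound for each of the two signs of the deviation, with the parameter of
  \<open>bernstein_exponent\<close> in units of \<open>1 / (2 b)\<close>: the factor 2 was introduced by symmetrization.
\<close>

lemma (in prob_space) weighted_empirical_process_tail:
  fixes w s :: "'a \<Rightarrow> real"
  assumes T: "countable T" "T \<noteq> {}" and I: "finite I"
    and [measurable]: "w \<in> borel_measurable M" "s \<in> borel_measurable M"
    and w: "\<And>y. y \<in> space M \<Longrightarrow> 0 \<le> w y \<and> w y \<le> b" and b: "0 < b" and L: "0 < L"
  defines "D \<equiv> \<lambda>t z. \<Sum>i\<in>I. w (z i) * of_bool (s (z i) \<le> t) - expectation (\<lambda>y. w y * of_bool (s y \<le> t))"
    and "x \<equiv> 9 * sqrt (real (card I) * expectation (\<lambda>y. (w y)\<^sup>2) * L) + 4 / 3 * b * L"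
  shows "emeasure (\<Pi>\<^sub>M i\<in>I. M) {z \<in> space (\<Pi>\<^sub>M i\<in>I. M). \<exists>t\<in>T. x < \<bar>D t z\<bar>} \<le> ennreal (8 * exp (- 2 * L))"
proof -
  let ?P = "\<Pi>\<^sub>M i\<in>I. M"
  define V where "V = expectation (\<lambda>y. (w y)\<^sup>2)"
  define A where "A = real (card I) * V / b\<^sup>2"
  have [measurable]: "D t \<in> borel_measurable ?P" for t unfolding D_def by measurable
  have "0 \<le> V" unfolding V_def by simp
  then have "0 \<le> A" unfolding A_def by simp
  then obtain u where u: "0 < u" "2 * L \<le> u / 2 * (9 * sqrt (A * L) + 4 / 3 * L) - A * (cosh u - 1)"
    using L bernstein_exponent by blast
  have "sqrt (A * L) = sqrt (real (card I) * V * L) / b"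
    using b by (simp add: A_def real_sqrt_divide)
  then have x_eq: "u / (2 * b) * x = u / 2 * (9 * sqrt (A * L) + 4 / 3 * L)"
    using b by (simp add: x_def V_def field_simps)
  have ux: "2 * L \<le> u / (2 * b) * x - A * (cosh u - 1)"
    using u(2) unfolding x_eq .
  have one_side: "emeasure ?P {z \<in> space ?P. \<exists>t\<in>T. x < \<sigma> * D t z} \<le> ennreal (4 * exp (- 2 * L))"
    if \<sigma>: "\<sigma> = 1 \<or> \<sigma> = - 1" for \<sigma> :: real
  proof -
    define c where "c = \<sigma> * (u / (2 * b))"
    define S where "S = {z \<in> space ?P. \<exists>t\<in>T. x < \<sigma> * D t z}"
    have [measurable]: "S \<in> sets ?P" unfolding S_def using T by measurable
    have S_le: "ennreal (exp (u / (2 * b) * x)) * indicator S z \<le> (SUP t\<in>T. ennreal (exp (c * D t z)))" for z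
    proof (cases "z \<in> S")
      case True
      then obtain t where t: "t \<in> T" "x < \<sigma> * D t z" unfolding S_def by auto
      have "u / (2 * b) * x \<le> u / (2 * b) * (\<sigma> * D t z)"
        using t u b by (intro mult_left_mono) auto
      then have "ennreal (exp (u / (2 * b) * x)) \<le> ennreal (exp (c * D t z))"
        by (intro ennreal_leI) (simp add: c_def mult_ac)
      then show ?thesis using True t by (auto intro: SUP_upper2)
    qed auto
    have "ennreal (exp (u / (2 * b) * x)) * emeasure ?P S
        = (\<integral>\<^sup>+z. ennreal (exp (u / (2 * b) * x)) * indicator S z \<partial>?P)"
      by (simp add: nn_integral_cmult)
    also have "\<dots> \<le> (\<integral>\<^sup>+z. (SUP t\<in>T. ennreal (exp (c * D t z))) \<partial>?P)"
      by (intro nn_integral_mono S_le)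
    also have "\<dots> \<le> 4 * ennreal (expectation (\<lambda>y. cosh (2 * c * w y)) ^ card I)"
      unfolding D_def by (rule mgf_weighted_empirical_process[where b = b]) (use T I w in auto)
    also have "\<dots> \<le> 4 * ennreal (exp (A * (cosh u - 1)))"
    proof (intro mult_left_mono ennreal_leI)
      have "(\<lambda>y. cosh (2 * c * w y)) = (\<lambda>y. cosh (u / b * w y))"
        using \<sigma> by (auto simp: c_def)
      then have "expectation (\<lambda>y. cosh (2 * c * w y)) ^ card I \<le> exp (V / b\<^sup>2 * (cosh u - 1)) ^ card I"
        unfolding V_def using u by (simp only:) (intro power_mono expectation_cosh_le w b, auto)
      also have "\<dots> = exp (A * (cosh u - 1))"
        by (simp add: A_def flip: exp_of_nat_mult)
      finally show "expectation (\<lambda>y. cosh (2 * c * w y)) ^ card I \<le> exp (A * (cosh u - 1))" .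
    qed simp
    also have "\<dots> \<le> ennreal (exp (u / (2 * b) * x)) * ennreal (4 * exp (- 2 * L))"
      using ux by (simp add: ennreal_mult'[symmetric] ennreal_numeral[symmetric] mult_exp_exp
          del: ennreal_numeral)
    finally show ?thesis
      unfolding S_def[symmetric] by (subst (asm) ennreal_mult_le_mult_iff) auto
  qed
  have "{z \<in> space ?P. \<exists>t\<in>T. x < \<bar>D t z\<bar>}
      \<subseteq> {z \<in> space ?P. \<exists>t\<in>T. x < 1 * D t z} \<union> {z \<in> space ?P. \<exists>t\<in>T. x < (- 1) * D t z}"
    by (auto simp: abs_if)
  then have "emeasure ?P {z \<in> space ?P. \<exists>t\<in>T. x < \<bar>D t z\<bar>}
      \<le> emeasure ?P ({z \<in> space ?P. \<exists>t\<in>T. x < 1 * D t z} \<union> {z \<in> space ?P. \<exists>t\<in>T. x < (- 1) * D t z})"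
    using T by (intro emeasure_mono) measurable
  also have "\<dots> \<le> emeasure ?P {z \<in> space ?P. \<exists>t\<in>T. x < 1 * D t z}
      + emeasure ?P {z \<in> space ?P. \<exists>t\<in>T. x < (- 1) * D t z}"
    using T by (intro emeasure_subadditive) measurable
  also have "\<dots> \<le> ennreal (4 * exp (- 2 * L)) + ennreal (4 * exp (- 2 * L))"
    by (intro add_mono one_side) auto
  also have "\<dots> = ennreal (8 * exp (- 2 * L))" by (simp flip: ennreal_plus)
  finally show ?thesis .
qed


section \<open>Distribution functions with bounded interval mass\<close>

context real_distribution
begin

context
  fixes \<mu> :: real
  assumes dens: "\<And>u v. u \<le> v \<Longrightarrow> prob {u..v} \<le> \<mu> * (v - u)"
begin

lemma prob_Icc_eq_cdf_diff:
  assumes "u \<le> v"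
  shows "prob {u..v} = cdf M v - cdf M u"
proof -
  have "prob {u} = 0"
    using dens[of u u] measure_nonneg[of M "{u}"] by simp
  moreover have "prob {u..v} = prob {u} + prob {u<..v}"
    using assms by (subst finite_measure_Union[symmetric]) (auto intro: arg_cong[where f = prob])
  ultimately show ?thesis
    using assms cdf_diff_eq[of u v] by (cases "u = v") auto
qed

lemma cdf_lipschitz: "\<bar>cdf M u - cdf M v\<bar> \<le> \<mu> * \<bar>u - v\<bar>"
proof -
  have "\<bar>cdf M u - cdf M v\<bar> \<le> \<mu> * \<bar>u - v\<bar>" if "u \<le> v" for u v
    using that dens[of u v] prob_Icc_eq_cdf_diff[of u v] cdf_nondecreasing[of u v] by simp
  from this[of u v] this[of v u] show ?thesis by (cases "u \<le> v") (auto simp: abs_minus_commute)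
qed

lemma prob_Icc_eq_max: "prob {u..v} = max 0 (cdf M v - cdf M u)"
  using prob_Icc_eq_cdf_diff[of u v] cdf_nondecreasing[of u v] cdf_nondecreasing[of v u]
  by (cases "u \<le> v") auto

text \<open>
  Also valid when an interval is empty, because an empty interval has the mass \<open>max 0\<close> of a
  nonpositive difference.  This matters for fitted intervals shrunk beyond their midpoint.
\<close>

lemma prob_Icc_lipschitz:
  "\<bar>prob {u..v} - prob {u'..v'}\<bar> \<le> \<mu> * (\<bar>u - u'\<bar> + \<bar>v - v'\<bar>)"
proof -
  have "\<bar>prob {u..v} - prob {u'..v'}\<bar> \<le> \<bar>cdf M u - cdf M u'\<bar> + \<bar>cdf M v - cdf M v'\<bar>"
    unfolding prob_Icc_eq_max by (auto simp: max_def)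
  then show ?thesis
    using cdf_lipschitz[of u u'] cdf_lipschitz[of v v'] by (simp add: distrib_left)
qed

text \<open>
  A bound on interval masses makes the distribution function continuous, so that it takes the value
  \<open>\<tau>\<close> exactly at the \<open>\<tau>\<close>-quantile.
\<close>

lemma cdf_at_quantile:
  assumes \<tau>: "0 < \<tau>" "\<tau> < 1" and \<mu>: "0 < \<mu>"
  shows "cdf M (Inf {t. \<tau> \<le> cdf M t}) = \<tau>"
proof -
  let ?S = "{t. \<tau> \<le> cdf M t}"
  have ne: "?S \<noteq> {}"
    using order_tendstoD(1)[OF cdf_lim_at_top_prob \<tau>(2)]
    by (auto dest!: eventually_happens' [rotated] intro: less_imp_le)
  have "eventually (\<lambda>t. cdf M t < \<tau>) at_bot"
    by (rule order_tendstoD(2)[OF cdf_lim_at_bot \<tau>(1)])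
  then obtain l where l: "\<And>t. t \<le> l \<Longrightarrow> cdf M t < \<tau>"
    by (auto simp: eventually_at_bot_linorder)
  have bdd: "bdd_below ?S"
    using l by (intro bdd_belowI[of _ l]) (metis linorder_not_le mem_Collect_eq nle_le)
  have cont: "continuous_on UNIV (cdf M)"
    using \<mu> cdf_lipschitz
    by (intro lipschitz_on_continuous_on[where L = \<mu>] lipschitz_onI) (auto simp: dist_real_def)
  have "closed ?S"
    using continuous_on_closed_Collect_le[OF continuous_on_const cont closed_UNIV, of \<tau>] by simp
  then have "\<tau> \<le> cdf M (Inf ?S)"
    using closed_contains_Inf[OF ne bdd] by simp
  moreover have "cdf M (Inf ?S) \<le> \<tau>"
  proof (rule field_le_epsilon)
    fix e :: real assume e: "0 < e"
    have "Inf ?S - e / \<mu> \<notin> ?S"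
      using cInf_lower[OF _ bdd, of "Inf ?S - e / \<mu>"] e \<mu> by (auto simp: field_simps)
    moreover have "\<bar>cdf M (Inf ?S) - cdf M (Inf ?S - e / \<mu>)\<bar> \<le> e"
      using cdf_lipschitz[of "Inf ?S" "Inf ?S - e / \<mu>"] e \<mu> by simp
    ultimately show "cdf M (Inf ?S) \<le> \<tau> + e" by simp
  qed
  ultimately show ?thesis by simp
qed

end
end


lemma fstar_eq_Inf_cdf: "fstar K \<tau> x = Inf {t. \<tau> \<le> cdf (K x) t}"
  by (simp add: fstar_def cdf_def)

lemma kernel_real_distribution:
  assumes "K \<in> N \<rightarrow>\<^sub>M prob_algebra borel" "x \<in> space N"
  shows "real_distribution (K x)"
  using measurable_space[OF assms]
  by (auto simp: space_prob_algebra real_distribution_def real_distribution_axioms_def)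

text \<open>
  By right continuity, the quantile is at most \<open>t\<close> exactly if the distribution function at \<open>t\<close> has
  reached the level.
\<close>

lemma measurable_fstar:
  assumes K [measurable]: "K \<in> N \<rightarrow>\<^sub>M prob_algebra borel" and \<tau>: "0 < \<tau>" "\<tau> < 1"
  shows "fstar K \<tau> \<in> borel_measurable N"
proof (rule borel_measurableI_le)
  fix t
  have "fstar K \<tau> x \<le> t \<longleftrightarrow> \<tau> \<le> measure (K x) {..t}" if "x \<in> space N" for x
  proof
    interpret real_distribution "K x" using K that by (rule kernel_real_distribution)
    let ?S = "{t. \<tau> \<le> cdf (K x) t}"
    have "eventually (\<lambda>t. cdf (K x) t < \<tau>) at_bot"
      by (rule order_tendstoD(2)[OF cdf_lim_at_bot \<tau>(1)])
    then obtain l where l: "\<And>t. t \<le> l \<Longrightarrow> cdf (K x) t < \<tau>"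
      by (auto simp: eventually_at_bot_linorder)
    have bdd: "bdd_below ?S"
      using l by (intro bdd_belowI[of _ l]) (metis linorder_not_le mem_Collect_eq nle_le)
    show "fstar K \<tau> x \<le> t" if "\<tau> \<le> measure (K x) {..t}"
      using that bdd unfolding fstar_eq_Inf_cdf by (intro cInf_lower) (auto simp: cdf_def)
    have "eventually (\<lambda>t. \<tau> < cdf (K x) t) at_top"
      by (rule order_tendstoD(1)[OF cdf_lim_at_top_prob \<tau>(2)])
    then have ne: "?S \<noteq> {}"
      by (auto simp: eventually_at_top_linorder intro: less_imp_le)
    assume "fstar K \<tau> x \<le> t"
    then have le: "Inf ?S \<le> t" by (simp add: fstar_eq_Inf_cdf)
    have above: "\<tau> \<le> cdf (K x) s" if ts: "t < s" for s
    proof -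
      obtain r where "\<tau> \<le> cdf (K x) r" "r < s"
        using cInf_lessD[OF ne, of s] le ts by auto
      then show ?thesis using cdf_nondecreasing[of r s] by simp
    qed
    have "\<tau> \<le> cdf (K x) t"
    proof (rule tendsto_lowerbound)
      show "(cdf (K x) \<longlongrightarrow> cdf (K x) t) (at_right t)"
        using cdf_is_right_cont[of t] by (simp add: continuous_within)
      show "eventually (\<lambda>s. \<tau> \<le> cdf (K x) s) (at_right t)"
        unfolding eventually_at_right_field using above by (intro exI[of _ "t + 1"]) auto
    qed simp
    then show "\<tau> \<le> measure (K x) {..t}" by (simp add: cdf_def)
  qed
  then have "{x \<in> space N. fstar K \<tau> x \<le> t} = {x \<in> space N. \<tau> \<le> measure (K x) {..t}}" by auto
  also have "\<dots> \<in> sets N" by measurable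
  finally show "{x \<in> space N. fstar K \<tau> x \<le> t} \<in> sets N" .
qed


section \<open>Laws built from a covariate law and a kernel\<close>

context
  fixes N :: "'a measure" and K :: "'a \<Rightarrow> real measure"
  assumes N: "prob_space N" and K [measurable]: "K \<in> N \<rightarrow>\<^sub>M prob_algebra borel"
begin

lemma kernel_prod_kernel_measurable:
  "(\<lambda>x. distr (K x) (N \<Otimes>\<^sub>M borel) (Pair x)) \<in> N \<rightarrow>\<^sub>M prob_algebra (N \<Otimes>\<^sub>M borel)"
  by measurable

lemma sets_kernel_prod: "sets (kernel_prod N K) = sets (N \<Otimes>\<^sub>M borel)"
  unfolding kernel_prod_def using prob_space.not_empty[OF N] by (intro sets_bind) auto

lemma space_kernel_prod: "space (kernel_prod N K) = space N \<times> UNIV"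
  using sets_eq_imp_space_eq[OF sets_kernel_prod] by (simp add: space_pair_measure)

lemma prob_space_kernel_prod: "prob_space (kernel_prod N K)"
  unfolding kernel_prod_def
  using measurable_space[OF kernel_prod_kernel_measurable]
  by (intro prob_space.prob_space_bind[OF N _, where S = "N \<Otimes>\<^sub>M borel"] measurable_prob_algebraD[OF kernel_prod_kernel_measurable])
     (auto simp: space_prob_algebra intro!: AE_I2)

lemma nn_integral_kernel_prod:
  assumes f: "f \<in> borel_measurable (N \<Otimes>\<^sub>M borel)"
  shows "(\<integral>\<^sup>+z. f z \<partial>kernel_prod N K) = (\<integral>\<^sup>+x. \<integral>\<^sup>+y. f (x, y) \<partial>K x \<partial>N)"
  unfolding kernel_prod_def
proof (subst nn_integral_bind[OF f measurable_prob_algebraD[OF kernel_prod_kernel_measurable]],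
    intro nn_integral_cong)
  fix x assume x: "x \<in> space N"
  have "sets (K x) = sets borel"
    using measurable_space[OF K x] by (simp add: space_prob_algebra)
  then show "(\<integral>\<^sup>+y. f y \<partial>distr (K x) (N \<Otimes>\<^sub>M borel) (Pair x)) = (\<integral>\<^sup>+y. f (x, y) \<partial>K x)"
    using x f by (intro nn_integral_distr) (auto cong: measurable_cong_sets)
qed

lemma measure_kernel_prod:
  assumes A: "A \<in> sets (N \<Otimes>\<^sub>M borel)"
  shows "measure (kernel_prod N K) A = (\<integral>x. measure (K x) (Pair x -` A) \<partial>N)"
  unfolding kernel_prod_def
proof (subst subprob_space.measure_bind[OF prob_space_imp_subprob_space[OF N]
      measurable_prob_algebraD[OF kernel_prod_kernel_measurable] A], intro Bochner_Integration.integral_cong refl)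
  fix x assume x: "x \<in> space N"
  have K_borel: "sets (K x) = sets borel"
    using measurable_space[OF K x] by (simp add: space_prob_algebra)
  then have "space (K x) = UNIV" by (auto dest: sets_eq_imp_space_eq)
  then show "measure (distr (K x) (N \<Otimes>\<^sub>M borel) (Pair x)) A = measure (K x) (Pair x -` A)"
    using x A K_borel by (subst measure_distr) (auto cong: measurable_cong_sets)
qed

end


section \<open>The weighted conformal quantile\<close>

text \<open>
  The infimum over an up-closed set of reals is determined by its rationals; this makes the
  weighted quantile a countable infimum of measurable functions of \<open>x\<close>.
\<close>

lemma ereal_Inf_rational:
  assumes mono: "\<And>s t :: real. P s \<Longrightarrow> s \<le> t \<Longrightarrow> P t"
  shows "Inf {ereal t | t. P t} = (INF t\<in>\<rat>. if P t then ereal t else \<infinity>)"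
proof (rule antisym)
  show "Inf {ereal t | t. P t} \<le> (INF t\<in>\<rat>. if P t then ereal t else \<infinity>)"
    by (intro INF_greatest) (auto intro: Inf_lower)
  show "(INF t\<in>\<rat>. if P t then ereal t else \<infinity>) \<le> Inf {ereal t | t. P t}"
  proof (rule Inf_greatest, clarify)
    fix t assume "P t"
    show "(INF t\<in>\<rat>. if P t then ereal t else \<infinity>) \<le> ereal t"
    proof (rule dense_ge)
      fix y assume y: "ereal t < y"
      then obtain r where r: "ereal t < ereal r" "ereal r < y" using ereal_dense2 by blast
      then obtain q where q: "q \<in> \<rat>" "t < q" "q < r" using Rats_dense_in_real by auto
      then have "(INF t\<in>\<rat>. if P t then ereal t else \<infinity>) \<le> ereal q"
        using mono[OF \<open>P t\<close>, of q] by (intro INF_lower2[of q]) auto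
      also have "\<dots> \<le> y" using q r by (metis ereal_less_eq(3) less_imp_le order_trans)
      finally show "(INF t\<in>\<rat>. if P t then ereal t else \<infinity>) \<le> y" .
    qed
  qed
qed

context
  fixes \<alpha> :: real and w :: "'a \<Rightarrow> real" and g :: "real \<Rightarrow> 'a \<Rightarrow> real" and m :: nat and c :: "nat \<Rightarrow> 'a \<times> real"
  assumes wc: "\<And>j. j < m \<Longrightarrow> 0 \<le> w (fst (c j))" and m: "0 < m"
begin

lemma measure_weighted_score_law:
  assumes wx: "0 \<le> w x"
  shows "measure (weighted_score_law \<alpha> w g m c x) {..ereal t}
    = real m * weighted_ecdf \<alpha> w g m c t / ((\<Sum>i<m. w (fst (c i))) + w x)"
proof -
  define W where "W = (\<Sum>i<m. w (fst (c i))) + w x"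
  define S where "S j = cqr_score \<alpha> g (fst (c j)) (snd (c j))" for j
  define wt where "wt j = (if j < m then w (fst (c j)) else w x) / W" for j
  have "0 \<le> W" unfolding W_def using wc wx by (intro add_nonneg_nonneg sum_nonneg) auto
  then have wt: "0 \<le> wt j" for j unfolding wt_def using wc wx by auto
  have "measure (weighted_score_law \<alpha> w g m c x) {..ereal t}
      = measure (point_measure {..m} (\<lambda>j. ennreal (wt j))) {j \<in> {..m}. j < m \<and> S j \<le> t}"
    unfolding weighted_score_law_def W_def[symmetric] wt_def[symmetric] S_def[symmetric]
    by (subst measure_distr)
       (auto simp: space_point_measure sets_point_measure measurable_def
         intro!: arg_cong[where f = "measure _"] split: if_splits)
  also have "\<dots> = (\<Sum>j\<in>{j \<in> {..m}. j < m \<and> S j \<le> t}. wt j)"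
    using wt by (subst measure_def, subst emeasure_point_measure_finite) (auto simp: sum_nonneg)
  also have "{j \<in> {..m}. j < m \<and> S j \<le> t} = {j \<in> {..<m}. S j \<le> t}" by auto
  also have "(\<Sum>j\<in>{j \<in> {..<m}. S j \<le> t}. wt j) = (\<Sum>j<m. wt j * of_bool (S j \<le> t))"
    by (rule sum.mono_neutral_cong_left) auto
  also have "\<dots> = real m * weighted_ecdf \<alpha> w g m c t / W"
    using m by (simp add: weighted_ecdf_def S_def wt_def flip: sum_divide_distrib)
  finally show ?thesis unfolding W_def .
qed

lemma weighted_ecdf_mono: "s \<le> t \<Longrightarrow> weighted_ecdf \<alpha> w g m c s \<le> weighted_ecdf \<alpha> w g m c t"
  unfolding weighted_ecdf_def using wc
  by (intro mult_left_mono sum_mono) (auto simp: of_bool_def)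

lemma weighted_quantile_eq:
  assumes "0 \<le> w x"
  shows "weighted_quantile \<alpha> w g m c x
    = (INF t\<in>\<rat>. if 1 - \<alpha> \<le> real m * weighted_ecdf \<alpha> w g m c t / ((\<Sum>i<m. w (fst (c i))) + w x)
        then ereal t else \<infinity>)"
  unfolding weighted_quantile_def ereal_quantile_def measure_weighted_score_law[OF assms]
proof (rule ereal_Inf_rational, erule order_trans)
  fix s t :: real assume "s \<le> t"
  then show "real m * weighted_ecdf \<alpha> w g m c s / ((\<Sum>i<m. w (fst (c i))) + w x)
      \<le> real m * weighted_ecdf \<alpha> w g m c t / ((\<Sum>i<m. w (fst (c i))) + w x)"
    using wc assms by (intro divide_right_mono mult_left_mono weighted_ecdf_mono add_nonneg_nonneg sum_nonneg) auto
qed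

lemma weighted_quantile_measurable:
  assumes [measurable]: "w \<in> borel_measurable N" and w: "\<And>x. x \<in> space N \<Longrightarrow> 0 \<le> w x"
  shows "weighted_quantile \<alpha> w g m c \<in> borel_measurable N"
proof (subst measurable_cong[OF weighted_quantile_eq[OF w]])
  show "(\<lambda>x. INF t\<in>\<rat>. if 1 - \<alpha> \<le> real m * weighted_ecdf \<alpha> w g m c t / ((\<Sum>i<m. w (fst (c i))) + w x)
        then ereal t else \<infinity>) \<in> borel_measurable N"
    by (intro borel_measurable_INF countable_rat) measurable
qed

text \<open>
  The level condition in the normalization of the weighted empirical distribution function: the
  atom at infinity adds \<open>w x / m\<close> to the total weight and never helps to reach the level.
\<close>

lemma weighted_quantile_level_iff:
  assumes "0 < w x"
  shows "1 - \<alpha> \<le> measure (weighted_score_law \<alpha> w g m c x) {..ereal t}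
    \<longleftrightarrow> (1 - \<alpha>) * ((\<Sum>i<m. w (fst (c i))) / real m + w x / real m) \<le> weighted_ecdf \<alpha> w g m c t"
proof -
  have "0 < (\<Sum>i<m. w (fst (c i))) + w x"
    using wc assms by (intro add_nonneg_pos sum_nonneg) auto
  then show ?thesis
    using m assms by (simp add: measure_weighted_score_law field_simps)
qed

lemma weighted_quantile_le:
  assumes "0 < w x"
    and "(1 - \<alpha>) * ((\<Sum>i<m. w (fst (c i))) / real m + w x / real m) \<le> weighted_ecdf \<alpha> w g m c t"
  shows "weighted_quantile \<alpha> w g m c x \<le> ereal t"
  unfolding weighted_quantile_def ereal_quantile_def weighted_quantile_level_iff[OF assms(1)]
  using assms by (intro Inf_lower) auto

lemma le_weighted_quantile:
  assumes "0 < w x"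
    and "\<And>t. (1 - \<alpha>) * ((\<Sum>i<m. w (fst (c i))) / real m + w x / real m) \<le> weighted_ecdf \<alpha> w g m c t \<Longrightarrow> l \<le> t"
  shows "ereal l \<le> weighted_quantile \<alpha> w g m c x"
  unfolding weighted_quantile_def ereal_quantile_def weighted_quantile_level_iff[OF assms(1)]
  using assms by (intro Inf_greatest) auto

end


section \<open>Coverage at a single covariate\<close>

lemma cqr_score_le_iff:
  "cqr_score \<alpha> g x y \<le> t \<longleftrightarrow> y \<in> {sorted_lo \<alpha> g x - t .. sorted_hi \<alpha> g x + t}"
  by (auto simp: cqr_score_def)

text \<open>
  Sorting two numbers does not increase their \<open>l\<^sup>1\<close> distance to a sorted pair.
\<close>

lemma sorted_endpoints_l1:
  assumes "a' \<le> b'"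
  shows "\<bar>min a b - a'\<bar> + \<bar>max a b - b'\<bar> \<le> \<bar>a - a'\<bar> + \<bar>b - b' :: real\<bar>"
  using assms by (auto simp: min_def max_def abs_if)

lemma cqr_score_measurable:
  assumes [measurable]: "g (\<alpha> / 2) \<in> borel_measurable N" "g (1 - \<alpha> / 2) \<in> borel_measurable N"
  shows "(\<lambda>z. cqr_score \<alpha> g (fst z) (snd z)) \<in> borel_measurable (N \<Otimes>\<^sub>M borel)"
  unfolding cqr_score_def sorted_lo_def sorted_hi_def by measurable

lemma weighted_cqr_coverage_measurable:
  assumes K: "K \<in> N \<rightarrow>\<^sub>M prob_algebra borel"
    and g: "g (\<alpha> / 2) \<in> borel_measurable N" "g (1 - \<alpha> / 2) \<in> borel_measurable N"
    and w [measurable]: "w \<in> borel_measurable N" and w0: "\<And>x. x \<in> space N \<Longrightarrow> 0 \<le> w x"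
    and c: "\<And>j. j < m \<Longrightarrow> fst (c j) \<in> space N" and m: "0 < m"
  shows "cov_profile K (weighted_cqr_set \<alpha> w g m c) \<in> borel_measurable N"
proof -
  have [measurable]: "weighted_quantile \<alpha> w g m c \<in> borel_measurable N"
    using c w0 m by (intro weighted_quantile_measurable) auto
  note [measurable] = cqr_score_measurable[OF g]
  have "Sigma (space N) (weighted_cqr_set \<alpha> w g m c)
      = {z \<in> space (N \<Otimes>\<^sub>M borel). ereal (cqr_score \<alpha> g (fst z) (snd z)) \<le> weighted_quantile \<alpha> w g m c (fst z)}"
    by (auto simp: weighted_cqr_set_def space_pair_measure)
  also have "\<dots> \<in> sets (N \<Otimes>\<^sub>M borel)" by measurable
  finally show ?thesis
    unfolding cov_profile_def by (rule measure_measurable_prob_algebra2[OF _ K])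
qed


text \<open>
  The pointwise part of mass regularity, as a predicate of a single covariate that can be carried by
  an almost-everywhere quantifier.
\<close>

definition regular_at :: "('a \<Rightarrow> real measure) \<Rightarrow> real \<Rightarrow> real \<Rightarrow> real \<Rightarrow> real \<Rightarrow> 'a \<Rightarrow> bool" where
  "regular_at K \<alpha> \<mu>low \<mu>up r0 x \<longleftrightarrow>
     (\<forall>u v. u \<le> v \<longrightarrow> measure (K x) {u..v} \<le> \<mu>up * (v - u)) \<and>
     (\<forall>\<tau>\<in>{\<alpha>/2, 1 - \<alpha>/2}. \<forall>h. 0 \<le> h \<and> h \<le> r0 \<longrightarrow>
        measure (K x) {fstar K \<tau> x - h .. fstar K \<tau> x} \<ge> \<mu>low * h \<and>
        measure (K x) {fstar K \<tau> x .. fstar K \<tau> x + h} \<ge> \<mu>low * h)"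

context
  fixes K :: "'a \<Rightarrow> real measure" and \<alpha> \<mu>low \<mu>up r0 :: real and x :: 'a
  assumes dist: "real_distribution (K x)" and reg: "regular_at K \<alpha> \<mu>low \<mu>up r0 x"
    and \<alpha>: "0 < \<alpha>" "\<alpha> < 1" and \<mu>up: "0 < \<mu>up"
begin

interpretation real_distribution "K x" by (rule dist)

lemma interval_prob_le: "u \<le> v \<Longrightarrow> prob {u..v} \<le> \<mu>up * (v - u)"
  using reg unfolding regular_at_def by blast

lemma cdf_endpoints:
  "cdf (K x) (fstar K (\<alpha>/2) x) = \<alpha>/2" "cdf (K x) (fstar K (1 - \<alpha>/2) x) = 1 - \<alpha>/2"
  unfolding fstar_eq_Inf_cdf using \<alpha> by (intro cdf_at_quantile[OF interval_prob_le] \<mu>up; simp)+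

lemma endpoints_le: "fstar K (\<alpha>/2) x \<le> fstar K (1 - \<alpha>/2) x"
  using cdf_endpoints cdf_nondecreasing[of "fstar K (1 - \<alpha>/2) x" "fstar K (\<alpha>/2) x"] \<alpha>
  by (cases "fstar K (\<alpha>/2) x \<le> fstar K (1 - \<alpha>/2) x") auto

lemma oracle_coverage: "prob {fstar K (\<alpha>/2) x .. fstar K (1 - \<alpha>/2) x} = 1 - \<alpha>"
  using prob_Icc_eq_cdf_diff[OF interval_prob_le endpoints_le] cdf_endpoints by simp

lemma endpoints_gap: "1 - \<alpha> \<le> \<mu>up * (fstar K (1 - \<alpha>/2) x - fstar K (\<alpha>/2) x)"
  using interval_prob_le[OF endpoints_le] oracle_coverage by simp

lemma cdf_growth:
  assumes "\<tau> \<in> {\<alpha>/2, 1 - \<alpha>/2}" "0 \<le> h" "h \<le> r0"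
  shows "\<mu>low * h \<le> cdf (K x) (fstar K \<tau> x) - cdf (K x) (fstar K \<tau> x - h)"
    and "\<mu>low * h \<le> cdf (K x) (fstar K \<tau> x + h) - cdf (K x) (fstar K \<tau> x)"
proof -
  have "\<mu>low * h \<le> prob {fstar K \<tau> x - h .. fstar K \<tau> x}"
    and "\<mu>low * h \<le> prob {fstar K \<tau> x .. fstar K \<tau> x + h}"
    using reg assms unfolding regular_at_def by blast+
  then show "\<mu>low * h \<le> cdf (K x) (fstar K \<tau> x) - cdf (K x) (fstar K \<tau> x - h)"
    and "\<mu>low * h \<le> cdf (K x) (fstar K \<tau> x + h) - cdf (K x) (fstar K \<tau> x)"
    using assms prob_Icc_eq_cdf_diff[OF interval_prob_le] by auto
qed

text \<open>
  Each of the two end pieces that are added contributes at least \<open>\<mu>low t\<close>.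
\<close>

lemma oracle_coverage_enlarged:
  assumes "0 \<le> t" "t \<le> r0"
  shows "1 - \<alpha> + 2 * \<mu>low * t \<le> prob {fstar K (\<alpha>/2) x - t .. fstar K (1 - \<alpha>/2) x + t}"
  using cdf_growth(1)[of "\<alpha>/2" t] cdf_growth(2)[of "1 - \<alpha>/2" t] assms cdf_endpoints endpoints_le
  by (subst prob_Icc_eq_cdf_diff[OF interval_prob_le]) auto

text \<open>
  The radius \<open>r_minus\<close> is chosen such that the two pieces that are removed do not overlap: as the mass
  between the endpoints is \<open>1 - \<alpha>\<close>, their distance is at least \<open>(1 - \<alpha>) / \<mu>up \<ge> 2 r_minus\<close>.
\<close>

lemma oracle_coverage_shrunk:
  assumes "0 \<le> t" "t \<le> r_minus \<alpha> \<mu>up r0"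
  shows "prob {fstar K (\<alpha>/2) x + t .. fstar K (1 - \<alpha>/2) x - t} \<le> 1 - \<alpha> - 2 * \<mu>low * t"
proof -
  have t: "t \<le> r0" "2 * (\<mu>up * t) \<le> 1 - \<alpha>"
    using assms(2) \<mu>up by (auto simp: r_minus_def field_simps)
  have "\<mu>up * (2 * t) \<le> \<mu>up * (fstar K (1 - \<alpha>/2) x - fstar K (\<alpha>/2) x)"
    using t endpoints_gap by simp
  then have "2 * t \<le> fstar K (1 - \<alpha>/2) x - fstar K (\<alpha>/2) x"
    using \<mu>up by (simp only: mult_le_cancel_left_pos)
  then show ?thesis
    using cdf_growth(2)[of "\<alpha>/2" t] cdf_growth(1)[of "1 - \<alpha>/2" t] assms t cdf_endpoints
    by (subst prob_Icc_eq_cdf_diff[OF interval_prob_le]) auto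
qed

lemma fitted_vs_oracle_coverage:
  "\<bar>prob {sorted_lo \<alpha> g x - t .. sorted_hi \<alpha> g x + t}
      - prob {fstar K (\<alpha>/2) x - s .. fstar K (1 - \<alpha>/2) x + s}\<bar>
    \<le> \<mu>up * (\<bar>g (\<alpha>/2) x - fstar K (\<alpha>/2) x\<bar> + \<bar>g (1 - \<alpha>/2) x - fstar K (1 - \<alpha>/2) x\<bar> + 2 * \<bar>t - s\<bar>)"
proof -
  have "\<bar>prob {sorted_lo \<alpha> g x - t .. sorted_hi \<alpha> g x + t}
      - prob {fstar K (\<alpha>/2) x - s .. fstar K (1 - \<alpha>/2) x + s}\<bar>
    \<le> \<mu>up * (\<bar>sorted_lo \<alpha> g x - t - (fstar K (\<alpha>/2) x - s)\<bar>
        + \<bar>sorted_hi \<alpha> g x + t - (fstar K (1 - \<alpha>/2) x + s)\<bar>)"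
    by (rule prob_Icc_lipschitz[OF interval_prob_le])
  also have "\<dots> \<le> \<mu>up * (\<bar>g (\<alpha>/2) x - fstar K (\<alpha>/2) x\<bar> + \<bar>g (1 - \<alpha>/2) x - fstar K (1 - \<alpha>/2) x\<bar> + 2 * \<bar>t - s\<bar>)"
  proof (rule mult_left_mono)
    define lo hi lo' hi' where "lo = sorted_lo \<alpha> g x" and "hi = sorted_hi \<alpha> g x"
      and "lo' = fstar K (\<alpha>/2) x" and "hi' = fstar K (1 - \<alpha>/2) x"
    have "\<bar>lo - t - (lo' - s)\<bar> \<le> \<bar>lo - lo'\<bar> + \<bar>t - s\<bar>"
      using abs_triangle_ineq4[of "lo - lo'" "t - s"] by (simp add: algebra_simps)
    moreover have "\<bar>hi + t - (hi' + s)\<bar> \<le> \<bar>hi - hi'\<bar> + \<bar>t - s\<bar>"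
      using abs_triangle_ineq[of "hi - hi'" "t - s"] by (simp add: algebra_simps)
    ultimately have "\<bar>lo - t - (lo' - s)\<bar> + \<bar>hi + t - (hi' + s)\<bar>
        \<le> (\<bar>lo - lo'\<bar> + \<bar>t - s\<bar>) + (\<bar>hi - hi'\<bar> + \<bar>t - s\<bar>)"
      by (rule add_mono)
    also have "\<dots> = (\<bar>lo - lo'\<bar> + \<bar>hi - hi'\<bar>) + 2 * \<bar>t - s\<bar>" by simp
    also have "\<bar>lo - lo'\<bar> + \<bar>hi - hi'\<bar> \<le> \<bar>g (\<alpha>/2) x - lo'\<bar> + \<bar>g (1 - \<alpha>/2) x - hi'\<bar>"
      unfolding lo_def hi_def lo'_def hi'_def sorted_lo_def sorted_hi_def
      by (rule sorted_endpoints_l1[OF endpoints_le])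
    finally show "\<bar>sorted_lo \<alpha> g x - t - (fstar K (\<alpha>/2) x - s)\<bar>
        + \<bar>sorted_hi \<alpha> g x + t - (fstar K (1 - \<alpha>/2) x + s)\<bar>
      \<le> \<bar>g (\<alpha>/2) x - fstar K (\<alpha>/2) x\<bar> + \<bar>g (1 - \<alpha>/2) x - fstar K (1 - \<alpha>/2) x\<bar> + 2 * \<bar>t - s\<bar>"
      unfolding lo_def hi_def lo'_def hi'_def by simp
  qed (use \<mu>up in simp)
  finally show ?thesis .
qed

end


section \<open>Covariate shift and the target distribution function of the score\<close>

locale shifted_cqr =
  fixes PX QX :: "'a measure" and K :: "'a \<Rightarrow> real measure" and w :: "'a \<Rightarrow> real"
    and \<alpha> \<mu>low \<mu>up r0 wmax :: real and p :: ennreal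
  assumes alpha: "0 < \<alpha>" "\<alpha> < 1"
    and p: "1 \<le> p"
    and PX: "prob_space PX"
    and K: "K \<in> PX \<rightarrow>\<^sub>M prob_algebra borel"
    and mass: "mass_regularity PX K \<alpha> \<mu>low \<mu>up r0"
    and shift: "known_covariate_shift PX QX w wmax"
begin

sublocale P: prob_space PX by (rule PX)
sublocale Q: prob_space QX using shift unfolding known_covariate_shift_def by blast

lemma sets_QX [measurable_cong]: "sets QX = sets PX"
  using shift unfolding known_covariate_shift_def by blast

lemma space_QX: "space QX = space PX"
  by (rule sets_eq_imp_space_eq[OF sets_QX])

lemma K_QX: "K \<in> QX \<rightarrow>\<^sub>M prob_algebra borel"
  using K unfolding measurable_cong_sets[OF sets_QX refl] .

lemma w_measurable [measurable]: "w \<in> borel_measurable PX"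
  using shift unfolding known_covariate_shift_def by blast

lemma w_bounds: "x \<in> space PX \<Longrightarrow> 0 \<le> w x \<and> w x \<le> wmax"
  using shift unfolding known_covariate_shift_def by blast

lemma QX_density: "QX = density PX (\<lambda>x. ennreal (w x))"
  using shift unfolding known_covariate_shift_def by blast

lemma constants: "0 < \<mu>low" "\<mu>low \<le> \<mu>up" "0 < \<mu>up" "0 < r0"
  using mass by (auto simp: mass_regularity_def)

lemma integrable_w: "integrable PX w"
  using w_bounds by (intro P.integrable_const_bound[where B = wmax]) (auto intro!: AE_I2)

lemma expectation_w: "P.expectation w = 1"
proof -
  have "ennreal (P.expectation w) = (\<integral>\<^sup>+x. ennreal (w x) \<partial>PX)"
    using w_bounds integrable_w by (intro nn_integral_eq_integral[symmetric]) (auto intro!: AE_I2)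
  also have "\<dots> = emeasure QX (space PX)"
    unfolding QX_density by (subst emeasure_density) (auto intro!: nn_integral_cong)
  also have "\<dots> = 1" using Q.emeasure_space_1 by (simp add: space_QX)
  finally show ?thesis by simp
qed

lemma wmax_ge_1: "1 \<le> wmax"
  using P.integral_le_const[OF integrable_w, of wmax] w_bounds by (simp add: expectation_w AE_I2)

lemma AE_QX: "AE x in PX. R x \<Longrightarrow> AE x in QX. R x"
  unfolding QX_density by (subst AE_density) auto

lemma AE_w_pos: "AE x in QX. 0 < w x"
  unfolding QX_density by (subst AE_density) auto

lemma AE_regular: "AE x in QX. regular_at K \<alpha> \<mu>low \<mu>up r0 x"
proof (rule AE_QX)
  obtain X0 where X0: "X0 \<in> sets PX" "measure PX X0 = 1"
    "\<forall>x\<in>X0. regular_at K \<alpha> \<mu>low \<mu>up r0 x"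
    using mass unfolding mass_regularity_def regular_at_def[symmetric] by blast
  have "AE x in PX. x \<in> X0" using X0 by (subst P.prob_eq_1[symmetric]) auto
  then show "AE x in PX. regular_at K \<alpha> \<mu>low \<mu>up r0 x"
    using X0(3) by (auto elim!: eventually_mono)
qed

definition endpoint_error :: "(real \<Rightarrow> 'a \<Rightarrow> real) \<Rightarrow> 'a \<Rightarrow> real" where
  "endpoint_error g x = \<bar>g (\<alpha>/2) x - fstar K (\<alpha>/2) x\<bar> + \<bar>g (1 - \<alpha>/2) x - fstar K (1 - \<alpha>/2) x\<bar>"

lemma fstar_measurable [measurable]:
  "fstar K (\<alpha>/2) \<in> borel_measurable PX" "fstar K (1 - \<alpha>/2) \<in> borel_measurable PX"
  using alpha by (auto intro!: measurable_fstar[OF K])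


context
  fixes g :: "real \<Rightarrow> 'a \<Rightarrow> real"
  assumes g [measurable]: "g (\<alpha>/2) \<in> borel_measurable PX" "g (1 - \<alpha>/2) \<in> borel_measurable PX"
begin

lemma score_set: "{z \<in> space (kernel_prod QX K). cqr_score \<alpha> g (fst z) (snd z) \<le> t} \<in> sets (QX \<Otimes>\<^sub>M borel)"
proof -
  have "(\<lambda>z. cqr_score \<alpha> g (fst z) (snd z)) \<in> borel_measurable (QX \<Otimes>\<^sub>M borel)"
    by (rule cqr_score_measurable) measurable
  then show ?thesis
    unfolding space_kernel_prod[OF Q.prob_space_axioms K_QX] by (simp add: space_pair_measure[symmetric, of _ borel, simplified])
qed

lemma target_cdf_eq_cdf:
  "target_cdf QX K \<alpha> g = cdf (distr (kernel_prod QX K) borel (\<lambda>z. cqr_score \<alpha> g (fst z) (snd z)))"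
proof
  fix t
  have "(\<lambda>z. cqr_score \<alpha> g (fst z) (snd z)) \<in> borel_measurable (kernel_prod QX K)"
    using cqr_score_measurable[of g \<alpha> QX]
    by (simp add: measurable_cong_sets[OF sets_kernel_prod[OF Q.prob_space_axioms K_QX]])
  then show "target_cdf QX K \<alpha> g t = cdf (distr (kernel_prod QX K) borel (\<lambda>z. cqr_score \<alpha> g (fst z) (snd z))) t"
    unfolding target_cdf_def cdf_def
    by (subst measure_distr) (auto intro!: arg_cong[where f = "measure _"])
qed

lemma real_distribution_score:
  "real_distribution (distr (kernel_prod QX K) borel (\<lambda>z. cqr_score \<alpha> g (fst z) (snd z)))"
  using cqr_score_measurable[of g \<alpha> QX]
  by (intro prob_space.real_distribution_distr[OF prob_space_kernel_prod[OF Q.prob_space_axioms K_QX]])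
     (simp add: measurable_cong_sets[OF sets_kernel_prod[OF Q.prob_space_axioms K_QX]])

lemma target_cdf_mono: "s \<le> t \<Longrightarrow> target_cdf QX K \<alpha> g s \<le> target_cdf QX K \<alpha> g t"
  unfolding target_cdf_eq_cdf
  by (intro finite_borel_measure.cdf_nondecreasing real_distribution.finite_borel_measure_M real_distribution_score)

lemma target_cdf_at_top: "(target_cdf QX K \<alpha> g \<longlongrightarrow> 1) at_top"
  unfolding target_cdf_eq_cdf
  by (rule real_distribution.cdf_lim_at_top_prob[OF real_distribution_score])

lemma target_cdf_right_continuous: "(target_cdf QX K \<alpha> g \<longlongrightarrow> target_cdf QX K \<alpha> g t) (at_right t)"
  using finite_borel_measure.cdf_is_right_cont[OF real_distribution.finite_borel_measure_M[OF real_distribution_score], of t]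
  unfolding target_cdf_eq_cdf by (simp add: continuous_within)

lemma target_cdf_eq_integral:
  "target_cdf QX K \<alpha> g t = (\<integral>x. measure (K x) {sorted_lo \<alpha> g x - t .. sorted_hi \<alpha> g x + t} \<partial>QX)"
  unfolding target_cdf_def measure_kernel_prod[OF Q.prob_space_axioms K_QX score_set]
proof (intro Bochner_Integration.integral_cong refl arg_cong2[where f = measure])
  fix x assume "x \<in> space QX"
  then show "Pair x -` {z \<in> space (kernel_prod QX K). cqr_score \<alpha> g (fst z) (snd z) \<le> t}
      = {sorted_lo \<alpha> g x - t .. sorted_hi \<alpha> g x + t}"
    by (auto simp: space_kernel_prod[OF Q.prob_space_axioms K_QX] cqr_score_le_iff)
qed

lemma integrable_fitted_coverage:
  "integrable QX (\<lambda>x. measure (K x) {sorted_lo \<alpha> g x - t .. sorted_hi \<alpha> g x + t})"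
proof (rule Q.integrable_const_bound[where B = 1])
  have "Sigma (space QX) (\<lambda>x. {sorted_lo \<alpha> g x - t .. sorted_hi \<alpha> g x + t})
      = {z \<in> space (kernel_prod QX K). cqr_score \<alpha> g (fst z) (snd z) \<le> t}"
    by (auto simp: space_kernel_prod[OF Q.prob_space_axioms K_QX] cqr_score_le_iff)
  then show "(\<lambda>x. measure (K x) {sorted_lo \<alpha> g x - t .. sorted_hi \<alpha> g x + t}) \<in> borel_measurable QX"
    using score_set by (intro measure_measurable_prob_algebra2[OF _ K_QX]) simp
  show "AE x in QX. norm (measure (K x) {sorted_lo \<alpha> g x - t .. sorted_hi \<alpha> g x + t}) \<le> 1"
  proof (rule AE_I2)
    fix x assume "x \<in> space QX"
    then interpret real_distribution "K x" by (rule kernel_real_distribution[OF K_QX])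
    show "norm (measure (K x) {sorted_lo \<alpha> g x - t .. sorted_hi \<alpha> g x + t}) \<le> 1" by simp
  qed
qed

lemma AE_coverage_comparison:
  "AE x in QX. \<forall>s t. \<bar>measure (K x) {sorted_lo \<alpha> g x - t .. sorted_hi \<alpha> g x + t}
      - measure (K x) {fstar K (\<alpha>/2) x - s .. fstar K (1 - \<alpha>/2) x + s}\<bar>
    \<le> \<mu>up * (endpoint_error g x + 2 * \<bar>t - s\<bar>)"
  using AE_regular AE_space
proof eventually_elim
  case (elim x)
  show ?case
    unfolding endpoint_error_def using elim alpha constants kernel_real_distribution[OF K_QX]
    by (auto intro!: fitted_vs_oracle_coverage)
qed

context
  fixes D :: real
  assumes D: "(\<integral>\<^sup>+x. ennreal (endpoint_error g x) \<partial>QX) \<le> ennreal D" "0 \<le> D"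
begin

lemma endpoint_error_integrable: "integrable QX (endpoint_error g)"
  and endpoint_error_integral: "(\<integral>x. endpoint_error g x \<partial>QX) \<le> D"
proof -
  have nonneg: "0 \<le> endpoint_error g x" for x by (simp add: endpoint_error_def)
  have [measurable]: "endpoint_error g \<in> borel_measurable QX" unfolding endpoint_error_def by measurable
  show int: "integrable QX (endpoint_error g)"
    using D nonneg by (intro integrableI_nonneg) (auto intro: le_less_trans)
  have "ennreal (\<integral>x. endpoint_error g x \<partial>QX) \<le> ennreal D"
    using D nonneg by (subst nn_integral_eq_integral[OF int, symmetric]) auto
  then show "(\<integral>x. endpoint_error g x \<partial>QX) \<le> D" using D by simp
qed

text \<open>
  Linear growth of the target distribution function of the score to the right of 0, up to the mean
  endpoint error; together with the next lemma this localizes its quantile.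
\<close>

lemma target_cdf_lower:
  assumes t: "0 \<le> t" "t \<le> r0"
  shows "1 - \<alpha> + 2 * \<mu>low * t - \<mu>up * D \<le> target_cdf QX K \<alpha> g t"
proof -
  have "1 - \<alpha> + 2 * \<mu>low * t - \<mu>up * D
      \<le> 1 - \<alpha> + 2 * \<mu>low * t - \<mu>up * (\<integral>x. endpoint_error g x \<partial>QX)"
    using endpoint_error_integral constants by simp
  also have "\<dots> = (\<integral>x. 1 - \<alpha> + 2 * \<mu>low * t - \<mu>up * endpoint_error g x \<partial>QX)"
    using endpoint_error_integrable by (simp add: Q.prob_space)
  also have "\<dots> \<le> target_cdf QX K \<alpha> g t"
    unfolding target_cdf_eq_integral
  proof (rule integral_mono_AE[OF _ integrable_fitted_coverage])
    show "integrable QX (\<lambda>x. 1 - \<alpha> + 2 * \<mu>low * t - \<mu>up * endpoint_error g x)"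
      using endpoint_error_integrable by simp
    show "AE x in QX. 1 - \<alpha> + 2 * \<mu>low * t - \<mu>up * endpoint_error g x
        \<le> measure (K x) {sorted_lo \<alpha> g x - t .. sorted_hi \<alpha> g x + t}"
      using AE_coverage_comparison AE_regular AE_space
    proof eventually_elim
      case (elim x)
      have "1 - \<alpha> + 2 * \<mu>low * t \<le> measure (K x) {fstar K (\<alpha>/2) x - t .. fstar K (1 - \<alpha>/2) x + t}"
        using elim alpha constants t kernel_real_distribution[OF K_QX]
        by (intro oracle_coverage_enlarged[where \<mu>up = \<mu>up and ?r0.0 = r0]) auto
      with elim(1)[THEN spec, THEN spec, of t t] show ?case by simp
    qed
  qed
  finally show ?thesis .
qed

lemma target_cdf_upper:
  assumes t: "0 \<le> t" "t \<le> r_minus \<alpha> \<mu>up r0"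
  shows "target_cdf QX K \<alpha> g (- t) \<le> 1 - \<alpha> - 2 * \<mu>low * t + \<mu>up * D"
proof -
  have "target_cdf QX K \<alpha> g (- t) \<le> (\<integral>x. 1 - \<alpha> - 2 * \<mu>low * t + \<mu>up * endpoint_error g x \<partial>QX)"
    unfolding target_cdf_eq_integral
  proof (rule integral_mono_AE[OF integrable_fitted_coverage])
    show "integrable QX (\<lambda>x. 1 - \<alpha> - 2 * \<mu>low * t + \<mu>up * endpoint_error g x)"
      using endpoint_error_integrable by simp
    show "AE x in QX. measure (K x) {sorted_lo \<alpha> g x - - t .. sorted_hi \<alpha> g x + - t}
        \<le> 1 - \<alpha> - 2 * \<mu>low * t + \<mu>up * endpoint_error g x"
      using AE_coverage_comparison AE_regular AE_space
    proof eventually_elim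
      case (elim x)
      have "measure (K x) {fstar K (\<alpha>/2) x + t .. fstar K (1 - \<alpha>/2) x - t} \<le> 1 - \<alpha> - 2 * \<mu>low * t"
        using elim alpha constants t kernel_real_distribution[OF K_QX]
        by (intro oracle_coverage_shrunk[where \<mu>up = \<mu>up and ?r0.0 = r0]) auto
      with elim(1)[THEN spec, THEN spec, of "- t" "- t"] show ?case by simp
    qed
  qed
  also have "\<dots> = 1 - \<alpha> - 2 * \<mu>low * t + \<mu>up * (\<integral>x. endpoint_error g x \<partial>QX)"
    using endpoint_error_integrable by (simp add: Q.prob_space)
  also have "\<dots> \<le> 1 - \<alpha> - 2 * \<mu>low * t + \<mu>up * D"
    using endpoint_error_integral constants by simp
  finally show ?thesis .
qed

end
end
end


section \<open>Coverage for fixed data\<close>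

context shifted_cqr
begin

context
  fixes g :: "real \<Rightarrow> 'a \<Rightarrow> real" and m :: nat and c :: "nat \<Rightarrow> 'a \<times> real" and \<eta> \<epsilon> :: real
  assumes g [measurable]: "g (\<alpha>/2) \<in> borel_measurable PX" "g (1 - \<alpha>/2) \<in> borel_measurable PX"
    and m: "0 < m" and c: "\<And>j. j < m \<Longrightarrow> fst (c j) \<in> space PX"
    and \<epsilon>: "0 \<le> \<epsilon>"
    and accurate: "\<And>\<tau>. \<tau> \<in> {\<alpha>/2, 1 - \<alpha>/2} \<Longrightarrow> Lp_norm p PX (\<lambda>x. g \<tau> x - fstar K \<tau> x) \<le> ennreal \<epsilon>"
    and \<eta>: "0 \<le> \<eta>"
    and unif: "\<And>t. \<bar>weighted_ecdf \<alpha> w g m c t - target_cdf QX K \<alpha> g t\<bar> \<le> \<eta>"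
    and small_minus: "2 * \<mu>up * exponent_root p wmax * \<epsilon> + (2 - \<alpha>) * \<eta> < 2 * \<mu>low * r_minus \<alpha> \<mu>up r0"
    and small_plus: "2 * \<mu>up * exponent_root p wmax * \<epsilon> + (2 - \<alpha>) * \<eta> + (1 - \<alpha>) * wmax / real m \<le> 2 * \<mu>low * r0"
begin

text \<open>
  The bound on the endpoint errors in \<open>L\<^sup>p(QX)\<close>.
\<close>

definition "bias = exponent_root p wmax * \<epsilon>"
definition "total_weight = (\<Sum>i<m. w (fst (c i))) / real m"

lemma bias_nonneg: "0 \<le> bias"
  using \<epsilon> wmax_ge_1 by (simp add: bias_def exponent_root_def)

lemma endpoint_difference_measurable:
  assumes "\<tau> \<in> {\<alpha>/2, 1 - \<alpha>/2}"
  shows "(\<lambda>x. g \<tau> x - fstar K \<tau> x) \<in> borel_measurable PX"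
proof -
  have "\<tau> = \<alpha>/2 \<or> \<tau> = 1 - \<alpha>/2" using assms by blast
  then show ?thesis by (elim disjE; hypsubst; measurable)
qed

lemma endpoint_Lp_QX:
  assumes "\<tau> \<in> {\<alpha>/2, 1 - \<alpha>/2}"
  shows "Lp_norm p QX (\<lambda>x. g \<tau> x - fstar K \<tau> x) \<le> ennreal bias"
  unfolding QX_density bias_def
  by (rule Lp_norm_density_le[OF p endpoint_difference_measurable[OF assms] w_measurable w_bounds _ accurate[OF assms] \<epsilon>])
     (use wmax_ge_1 in auto)

lemma endpoint_error_L1: "(\<integral>\<^sup>+x. ennreal (endpoint_error g x) \<partial>QX) \<le> ennreal (2 * bias)"
proof -
  have L1: "(\<integral>\<^sup>+x. ennreal \<bar>g \<tau> x - fstar K \<tau> x\<bar> \<partial>QX) \<le> ennreal bias" if "\<tau> \<in> {\<alpha>/2, 1 - \<alpha>/2}" for \<tau>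
    using endpoint_difference_measurable[OF that] unfolding measurable_cong_sets[OF sets_QX refl, symmetric]
    by (rule Q.nn_integral_le_Lp_norm[OF p _ endpoint_Lp_QX[OF that] bias_nonneg])
  have "(\<integral>\<^sup>+x. ennreal (endpoint_error g x) \<partial>QX)
      = (\<integral>\<^sup>+x. ennreal \<bar>g (\<alpha>/2) x - fstar K (\<alpha>/2) x\<bar> \<partial>QX)
        + (\<integral>\<^sup>+x. ennreal \<bar>g (1 - \<alpha>/2) x - fstar K (1 - \<alpha>/2) x\<bar> \<partial>QX)"
    unfolding endpoint_error_def by (subst nn_integral_add[symmetric]) auto
  also have "\<dots> \<le> ennreal bias + ennreal bias"
    by (intro add_mono L1) auto
  also have "\<dots> = ennreal (2 * bias)"
    using bias_nonneg by (simp flip: ennreal_plus)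
  finally show ?thesis .
qed

text \<open>
  The limit of the uniform deviation bound as the threshold tends to infinity.
\<close>

lemma total_weight_close: "\<bar>total_weight - 1\<bar> \<le> \<eta>"
proof (rule tendsto_upperbound)
  show "((\<lambda>t. \<bar>total_weight - target_cdf QX K \<alpha> g t\<bar>) \<longlongrightarrow> \<bar>total_weight - 1\<bar>) at_top"
    by (intro tendsto_intros target_cdf_at_top g)
  define T where "T = Max ((\<lambda>j. cqr_score \<alpha> g (fst (c j)) (snd (c j))) ` {..<m})"
  show "eventually (\<lambda>t. \<bar>total_weight - target_cdf QX K \<alpha> g t\<bar> \<le> \<eta>) at_top"
    using eventually_ge_at_top[of T]
  proof eventually_elim
    case (elim t)
    have "cqr_score \<alpha> g (fst (c j)) (snd (c j)) \<le> t" if "j < m" for j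
    proof -
      have "cqr_score \<alpha> g (fst (c j)) (snd (c j)) \<le> T"
        unfolding T_def using that by (intro Max_ge) auto
      then show ?thesis using elim by simp
    qed
    then have "weighted_ecdf \<alpha> w g m c t = total_weight"
      unfolding weighted_ecdf_def total_weight_def by simp
    then show ?case using unif[of t] by simp
  qed
qed simp

text \<open>
  The bound on the absolute value of the weighted quantile at \<open>x\<close>: the level error of the weighted
  empirical distribution function divided by the growth rate \<open>2 \<mu>low\<close>.
\<close>

definition "radius x = (2 * \<mu>up * bias + (2 - \<alpha>) * \<eta> + (1 - \<alpha>) * w x / real m) / (2 * \<mu>low)"

text \<open>
  At the threshold \<open>radius x\<close>, which by the second smallness condition is at most \<open>r0\<close>, the target
  distribution function has grown far enough to compensate the deviation \<open>\<eta>\<close> and the weight of the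
  atom at infinity.
\<close>

lemma weighted_quantile_upper:
  assumes x: "x \<in> space PX" "0 < w x"
  shows "weighted_quantile \<alpha> w g m c x \<le> ereal (radius x)"
proof (rule weighted_quantile_le[where m = m])
  have "0 \<le> 2 * \<mu>up * bias" "0 \<le> (2 - \<alpha>) * \<eta>" "0 \<le> (1 - \<alpha>) * w x / real m"
    using bias_nonneg constants \<eta> alpha x by auto
  then have r0: "0 \<le> radius x" unfolding radius_def using constants by (intro divide_nonneg_pos) auto
  have "(1 - \<alpha>) * w x / real m \<le> (1 - \<alpha>) * wmax / real m"
    using w_bounds[OF x(1)] alpha by (intro divide_right_mono mult_left_mono) auto
  then have "2 * \<mu>up * bias + (2 - \<alpha>) * \<eta> + (1 - \<alpha>) * w x / real m \<le> 2 * \<mu>low * r0"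
    using small_plus unfolding bias_def by (simp add: mult.assoc)
  then have "radius x \<le> r0" unfolding radius_def using constants by (simp add: field_simps)
  have rad: "2 * \<mu>low * radius x = 2 * \<mu>up * bias + (2 - \<alpha>) * \<eta> + (1 - \<alpha>) * w x / real m"
    unfolding radius_def using constants by simp
  have "1 - \<alpha> + 2 * \<mu>low * radius x - \<mu>up * (2 * bias) \<le> target_cdf QX K \<alpha> g (radius x)"
    using r0 \<open>radius x \<le> r0\<close> bias_nonneg by (intro target_cdf_lower g endpoint_error_L1) auto
  then have lower: "1 - \<alpha> + (2 - \<alpha>) * \<eta> + (1 - \<alpha>) * w x / real m \<le> target_cdf QX K \<alpha> g (radius x)"
    using rad by simp
  have "(1 - \<alpha>) * total_weight \<le> (1 - \<alpha>) * (1 + \<eta>)"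
    using total_weight_close alpha by (intro mult_left_mono) auto
  also have "\<dots> = 1 - \<alpha> + (2 - \<alpha>) * \<eta> - \<eta>" by (simp add: algebra_simps)
  finally have "(1 - \<alpha>) * total_weight + (1 - \<alpha>) * w x / real m + \<eta> \<le> target_cdf QX K \<alpha> g (radius x)"
    using lower by linarith
  then show "(1 - \<alpha>) * ((\<Sum>i<m. w (fst (c i))) / real m + w x / real m) \<le> weighted_ecdf \<alpha> w g m c (radius x)"
    unfolding total_weight_def[symmetric] distrib_left using unif[of "radius x"] by simp
qed (use x c m w_bounds in auto)

text \<open>
  A threshold below \<open>- s\<^sub>0\<close> cannot reach the level, because there the target distribution function has
  fallen too low.  The growth is known only up to \<open>r_minus\<close>, and by monotonicity it suffices to look at
  the negative of a number above \<open>s\<^sub>0\<close> and at most \<open>r_minus\<close>; such numbers exist by the first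
  smallness condition.
\<close>

lemma weighted_quantile_lower:
  assumes x: "x \<in> space PX" "0 < w x"
  shows "ereal (- radius x) \<le> weighted_quantile \<alpha> w g m c x"
proof (rule le_weighted_quantile[where m = m])
  fix t
  assume t: "(1 - \<alpha>) * ((\<Sum>i<m. w (fst (c i))) / real m + w x / real m) \<le> weighted_ecdf \<alpha> w g m c t"
  define s\<^sub>0 where "s\<^sub>0 = (2 * \<mu>up * bias + (2 - \<alpha>) * \<eta>) / (2 * \<mu>low)"
  have "0 \<le> 2 * \<mu>up * bias" "0 \<le> (2 - \<alpha>) * \<eta>"
    using bias_nonneg constants \<eta> alpha by auto
  then have s0: "0 \<le> s\<^sub>0" unfolding s\<^sub>0_def using constants by (intro divide_nonneg_pos) auto
  have s0_less: "s\<^sub>0 < r_minus \<alpha> \<mu>up r0"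
    using small_minus constants unfolding s\<^sub>0_def bias_def by (simp add: field_simps)
  have s0_eq: "2 * \<mu>low * s\<^sub>0 = 2 * \<mu>up * bias + (2 - \<alpha>) * \<eta>"
    unfolding s\<^sub>0_def using constants by simp
  have s0_radius: "s\<^sub>0 \<le> radius x"
    unfolding s\<^sub>0_def radius_def using x alpha constants by (intro divide_right_mono) auto
  have "- s\<^sub>0 \<le> t"
  proof (rule ccontr)
    assume "\<not> - s\<^sub>0 \<le> t"
    then have t_less: "s\<^sub>0 < - t" by simp
    define s where "s = min (- t) (r_minus \<alpha> \<mu>up r0)"
    have s: "s\<^sub>0 < s" "t \<le> - s" "s \<le> r_minus \<alpha> \<mu>up r0"
      using t_less s0_less by (auto simp: s_def)
    have "target_cdf QX K \<alpha> g t \<le> target_cdf QX K \<alpha> g (- s)"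
      using s by (intro target_cdf_mono g)
    also have "\<dots> \<le> 1 - \<alpha> - 2 * \<mu>low * s + \<mu>up * (2 * bias)"
      using s s0 bias_nonneg by (intro target_cdf_upper g endpoint_error_L1) auto
    finally have "weighted_ecdf \<alpha> w g m c t \<le> 1 - \<alpha> - 2 * \<mu>low * s + 2 * \<mu>up * bias + \<eta>"
      using unif[of t] by simp
    moreover have "(1 - \<alpha>) * (1 - \<eta>) \<le> (1 - \<alpha>) * total_weight"
      using total_weight_close alpha by (intro mult_left_mono) auto
    then have "1 - \<alpha> - (2 - \<alpha>) * \<eta> + \<eta> \<le> (1 - \<alpha>) * total_weight"
      by (simp add: algebra_simps)
    moreover have "0 \<le> (1 - \<alpha>) * (w x / real m)" using x alpha by simp
    ultimately have "2 * \<mu>low * s \<le> 2 * \<mu>low * s\<^sub>0"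
      using t unfolding s0_eq total_weight_def[symmetric] distrib_left by linarith
    then show False using s constants by simp
  qed
  then show "- radius x \<le> t" using s0_radius by simp
qed (use x c m w_bounds in auto)

lemma coverage_error_pointwise:
  "AE x in QX. \<bar>cov_profile K (weighted_cqr_set \<alpha> w g m c) x - (1 - \<alpha>)\<bar>
    \<le> \<mu>up * endpoint_error g x + \<mu>up * (2 * radius x)"
  using AE_coverage_comparison[OF g] AE_regular AE_w_pos AE_space
proof eventually_elim
  case (elim x)
  have x: "x \<in> space PX" using elim by (simp add: space_QX)
  obtain q where q: "weighted_quantile \<alpha> w g m c x = ereal q" "- radius x \<le> q" "q \<le> radius x"
    using weighted_quantile_upper[OF x elim(3)] weighted_quantile_lower[OF x elim(3)]
    by (cases "weighted_quantile \<alpha> w g m c x") auto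
  have "weighted_cqr_set \<alpha> w g m c x = {sorted_lo \<alpha> g x - q .. sorted_hi \<alpha> g x + q}"
    unfolding weighted_cqr_set_def q(1) by (auto simp: cqr_score_le_iff)
  moreover have "measure (K x) {fstar K (\<alpha>/2) x .. fstar K (1 - \<alpha>/2) x} = 1 - \<alpha>"
    using alpha constants elim kernel_real_distribution[OF K_QX]
    by (intro oracle_coverage[where \<mu>up = \<mu>up and ?r0.0 = r0 and \<mu>low = \<mu>low]) auto
  ultimately have "\<bar>cov_profile K (weighted_cqr_set \<alpha> w g m c) x - (1 - \<alpha>)\<bar>
      \<le> \<mu>up * (endpoint_error g x + 2 * \<bar>q\<bar>)"
    using elim(1)[THEN spec, THEN spec, of q 0] by (simp add: cov_profile_def)
  also have "\<dots> \<le> \<mu>up * (endpoint_error g x + 2 * radius x)"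
    using constants q by (intro mult_left_mono) auto
  finally show ?case by (simp add: distrib_left)
qed

lemma coverage_error_Lp:
  "Lp_norm p QX (\<lambda>x. cov_profile K (weighted_cqr_set \<alpha> w g m c) x - (1 - \<alpha>))
    \<le> ennreal (2 * \<mu>up * (1 + \<mu>up / \<mu>low) * exponent_root p wmax * \<epsilon>)
      + ennreal (\<mu>up / \<mu>low) * (ennreal ((2 - \<alpha>) * \<eta>) + ennreal ((1 - \<alpha>) / real m) * Lp_norm p QX w)"
proof -
  have [measurable]: "cov_profile K (weighted_cqr_set \<alpha> w g m c) \<in> borel_measurable PX"
    using c m w_bounds by (intro weighted_cqr_coverage_measurable K g w_measurable) auto
  have "Lp_norm p QX w \<le> ennreal wmax"
  proof (rule Lp_norm_mono_AE[where g = "\<lambda>_. wmax"])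
    show "AE x in QX. \<bar>w x\<bar> \<le> \<bar>wmax\<bar>"
      using w_bounds by (intro AE_I2) (force simp: space_QX)
  qed (use p wmax_ge_1 in \<open>auto intro: Q.Lp_norm_const_le\<close>)
  then obtain W where W: "Lp_norm p QX w = ennreal W" "0 \<le> W"
    by (cases "Lp_norm p QX w") (auto simp: top_unique)
  define C where "C = \<mu>up / \<mu>low * (2 * \<mu>up * bias + (2 - \<alpha>) * \<eta>)"
  define k where "k = \<mu>up / \<mu>low * ((1 - \<alpha>) / real m)"
  have C: "0 \<le> C" and k: "0 \<le> k"
    unfolding C_def k_def using constants alpha \<eta> bias_nonneg by auto
  have radius: "\<mu>up * (2 * radius x) = C + k * w x" for x
    unfolding radius_def C_def k_def using constants m by (simp add: field_simps)
  define h where "h x = (\<mu>up * \<bar>g (\<alpha>/2) x - fstar K (\<alpha>/2) x\<bar> + \<mu>up * \<bar>g (1 - \<alpha>/2) x - fstar K (1 - \<alpha>/2) x\<bar>)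
      + (C + k * w x)" for x
  have [measurable]: "h \<in> borel_measurable QX" unfolding h_def by measurable
  have end_Lp: "Lp_norm p QX (\<lambda>x. \<mu>up * \<bar>g \<tau> x - fstar K \<tau> x\<bar>) \<le> ennreal (\<mu>up * bias)"
    if \<tau>: "\<tau> \<in> {\<alpha>/2, 1 - \<alpha>/2}" for \<tau>
  proof (rule Lp_norm_cmult[OF p])
    have [measurable]: "(\<lambda>x. g \<tau> x - fstar K \<tau> x) \<in> borel_measurable QX"
      using endpoint_difference_measurable[OF \<tau>] unfolding measurable_cong_sets[OF sets_QX refl] .
    show "(\<lambda>x. \<bar>g \<tau> x - fstar K \<tau> x\<bar>) \<in> borel_measurable QX" by measurable
    show "Lp_norm p QX (\<lambda>x. \<bar>g \<tau> x - fstar K \<tau> x\<bar>) \<le> ennreal bias"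
      by (rule Lp_norm_mono_AE[OF p _ _ _ endpoint_Lp_QX[OF \<tau>] bias_nonneg]) simp_all
  qed (use bias_nonneg constants in auto)
  have "Lp_norm p QX h \<le> ennreal ((\<mu>up * bias + \<mu>up * bias) + (C + k * W))"
    unfolding h_def
    by (intro Lp_norm_add p end_Lp Q.Lp_norm_const_le Lp_norm_cmult)
       (use W C k bias_nonneg constants in auto)
  then have "Lp_norm p QX (\<lambda>x. cov_profile K (weighted_cqr_set \<alpha> w g m c) x - (1 - \<alpha>))
      \<le> ennreal ((\<mu>up * bias + \<mu>up * bias) + (C + k * W))"
  proof (rule Lp_norm_mono_AE[OF p, rotated 3])
    show "AE x in QX. \<bar>cov_profile K (weighted_cqr_set \<alpha> w g m c) x - (1 - \<alpha>)\<bar> \<le> \<bar>h x\<bar>"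
      using coverage_error_pointwise
    proof eventually_elim
      case (elim x)
      then have "\<bar>cov_profile K (weighted_cqr_set \<alpha> w g m c) x - (1 - \<alpha>)\<bar> \<le> h x"
        unfolding radius h_def endpoint_error_def by (simp add: distrib_left)
      then show ?case by simp
    qed
  qed (use C k W bias_nonneg constants in auto)
  also have "(\<mu>up * bias + \<mu>up * bias) + (C + k * W)
      = 2 * \<mu>up * (1 + \<mu>up / \<mu>low) * bias + \<mu>up / \<mu>low * ((2 - \<alpha>) * \<eta> + (1 - \<alpha>) / real m * W)"
  proof -
    have "(\<mu>up * bias + \<mu>up * bias) + (r * (2 * \<mu>up * bias + (2 - \<alpha>) * \<eta>) + r * v * W)
        = 2 * \<mu>up * (1 + r) * bias + r * ((2 - \<alpha>) * \<eta> + v * W)" for r v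
      by (simp add: algebra_simps)
    then show ?thesis unfolding C_def k_def .
  qed
  also have "ennreal \<dots> = ennreal (2 * \<mu>up * (1 + \<mu>up / \<mu>low) * bias)
      + ennreal (\<mu>up / \<mu>low) * (ennreal ((2 - \<alpha>) * \<eta>) + ennreal ((1 - \<alpha>) / real m) * ennreal W)"
    by (intro ennreal_combine[symmetric]) (use bias_nonneg constants W alpha \<eta> in auto)
  finally show ?thesis unfolding W bias_def by (simp add: mult.assoc)
qed

end
end


section \<open>Deviation of the weighted distribution function of the scores\<close>

text \<open>
  For the essential supremum, that the exceedance set is null is expressed by the vanishing of an
  integral, which depends measurably on the parameter.
\<close>

lemma measurable_Lp_norm_le:
  fixes f :: "'b \<Rightarrow> 'a \<Rightarrow> real"
  assumes M: "sigma_finite_measure M" and p: "1 \<le> p" and a: "0 \<le> a"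
    and f [measurable]: "(\<lambda>(d, x). f d x) \<in> borel_measurable (S \<Otimes>\<^sub>M M)"
  shows "{d \<in> space S. Lp_norm p M (f d) \<le> ennreal a} \<in> sets S"
proof -
  interpret sigma_finite_measure M by (rule M)
  show ?thesis
  proof (cases "p = top")
    case True
    have "Lp_norm p M (f d) \<le> ennreal a \<longleftrightarrow> (\<integral>\<^sup>+x. (if \<bar>f d x\<bar> \<le> a then 0 else 1) \<partial>M) = 0"
      if d: "d \<in> space S" for d
    proof -
      have [measurable]: "f d \<in> borel_measurable M"
        using measurable_Pair2[OF f d] by simp
      have "Lp_norm p M (f d) \<le> ennreal a \<longleftrightarrow> (AE x in M. \<bar>f d x\<bar> \<le> a)"
        unfolding True by (rule Lp_norm_top_le_iff) (use a in auto)
      also have "\<dots> \<longleftrightarrow> (\<integral>\<^sup>+x. (if \<bar>f d x\<bar> \<le> a then 0 else 1) \<partial>M) = 0"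
        by (subst nn_integral_0_iff_AE) (auto intro!: AE_cong)
      finally show ?thesis .
    qed
    then have "{d \<in> space S. Lp_norm p M (f d) \<le> ennreal a}
        = {d \<in> space S. (\<integral>\<^sup>+x. (if \<bar>f d x\<bar> \<le> a then 0 else 1) \<partial>M) = 0}" by auto
    also have "\<dots> \<in> sets S" by measurable
    finally show ?thesis .
  next
    case False
    then show ?thesis using p a by (simp add: Lp_norm_le_iff)
  qed
qed

text \<open>
  Both functions being right continuous, a deviation above \<open>\<eta>\<close> persists on an interval to the right,
  which contains a rational.  This makes the uniform deviation event measurable.
\<close>

lemma SUP_ereal_le_iff_rational:
  fixes e F :: "real \<Rightarrow> real"
  assumes e: "\<And>t. (e \<longlongrightarrow> e t) (at_right t)" and F: "\<And>t. (F \<longlongrightarrow> F t) (at_right t)"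
  shows "(SUP t::real. ereal \<bar>e t - F t\<bar>) \<le> ereal \<eta> \<longleftrightarrow> (\<forall>t\<in>\<rat>. \<bar>e t - F t\<bar> \<le> \<eta>)"
proof
  assume "(SUP t::real. ereal \<bar>e t - F t\<bar>) \<le> ereal \<eta>"
  then show "\<forall>t\<in>\<rat>. \<bar>e t - F t\<bar> \<le> \<eta>" by (auto simp: SUP_le_iff)
next
  assume rat: "\<forall>t\<in>\<rat>. \<bar>e t - F t\<bar> \<le> \<eta>"
  have "\<bar>e t - F t\<bar> \<le> \<eta>" for t
  proof (rule ccontr)
    assume "\<not> \<bar>e t - F t\<bar> \<le> \<eta>"
    moreover have "((\<lambda>s. \<bar>e s - F s\<bar>) \<longlongrightarrow> \<bar>e t - F t\<bar>) (at_right t)"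
      by (intro tendsto_intros e F)
    ultimately have "eventually (\<lambda>s. \<eta> < \<bar>e s - F s\<bar>) (at_right t)"
      by (intro order_tendstoD(1)) auto
    then obtain b where b: "t < b" "\<And>s. t < s \<Longrightarrow> s < b \<Longrightarrow> \<eta> < \<bar>e s - F s\<bar>"
      unfolding eventually_at_right_field by auto
    obtain s where "s \<in> \<rat>" "t < s" "s < b" using Rats_dense_in_real[OF b(1)] by auto
    then show False using b(2)[of s] rat by force
  qed
  then show "(SUP t::real. ereal \<bar>e t - F t\<bar>) \<le> ereal \<eta>" by (auto intro: SUP_least)
qed

lemma weighted_ecdf_right_continuous:
  "(weighted_ecdf \<alpha> w g m c \<longlongrightarrow> weighted_ecdf \<alpha> w g m c t) (at_right t)"
proof -
  have "((\<lambda>s. of_bool (x \<le> s)) \<longlongrightarrow> (of_bool (x \<le> t) :: real)) (at_right t)" for x :: real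
  proof (rule tendsto_eventually, cases "x \<le> t")
    case True
    then show "eventually (\<lambda>s. of_bool (x \<le> s) = (of_bool (x \<le> t) :: real)) (at_right t)"
      unfolding eventually_at_right_field by (intro exI[of _ "t + 1"]) auto
  next
    case False
    then show "eventually (\<lambda>s. of_bool (x \<le> s) = (of_bool (x \<le> t) :: real)) (at_right t)"
      unfolding eventually_at_right_field by (intro exI[of _ x]) auto
  qed
  then show ?thesis unfolding weighted_ecdf_def by (intro tendsto_intros)
qed


context shifted_cqr
begin

lemmas source_law_sets = sets_kernel_prod[OF PX K]
lemmas source_law_prob = prob_space_kernel_prod[OF PX K]

text \<open>
  The target law of covariate and response has the density \<open>w\<close> with respect to the source law, since both
  use the same kernel.
\<close>

lemma nn_integral_kernel_prod_QX:
  assumes f [measurable]: "f \<in> borel_measurable (PX \<Otimes>\<^sub>M borel)"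
  shows "(\<integral>\<^sup>+z. f z \<partial>kernel_prod QX K) = (\<integral>\<^sup>+z. ennreal (w (fst z)) * f z \<partial>kernel_prod PX K)"
proof -
  have f_QX: "f \<in> borel_measurable (QX \<Otimes>\<^sub>M borel)"
    using f by (simp cong: measurable_cong_sets add: sets_pair_measure_cong[OF sets_QX refl])
  have inner: "(\<lambda>x. \<integral>\<^sup>+y. f (x, y) \<partial>K x) \<in> borel_measurable PX"
    by (rule nn_integral_measurable_subprob_algebra2[OF _ measurable_prob_algebraD[OF K]]) simp
  have "(\<integral>\<^sup>+z. f z \<partial>kernel_prod QX K) = (\<integral>\<^sup>+x. \<integral>\<^sup>+y. f (x, y) \<partial>K x \<partial>QX)"
    by (rule nn_integral_kernel_prod[OF Q.prob_space_axioms K_QX f_QX])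
  also have "\<dots> = (\<integral>\<^sup>+x. ennreal (w x) * (\<integral>\<^sup>+y. f (x, y) \<partial>K x) \<partial>PX)"
    unfolding QX_density by (rule nn_integral_density[OF _ inner]) measurable
  also have "\<dots> = (\<integral>\<^sup>+x. \<integral>\<^sup>+y. ennreal (w x) * f (x, y) \<partial>K x \<partial>PX)"
  proof (rule nn_integral_cong)
    fix x assume x: "x \<in> space PX"
    have "sets (K x) = sets borel"
      using measurable_space[OF K x] by (simp add: space_prob_algebra)
    then have "(\<lambda>y. f (x, y)) \<in> borel_measurable (K x)"
      using measurable_Pair2[OF f x] by (simp cong: measurable_cong_sets)
    then show "ennreal (w x) * (\<integral>\<^sup>+y. f (x, y) \<partial>K x) = (\<integral>\<^sup>+y. ennreal (w x) * f (x, y) \<partial>K x)"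
      by (rule nn_integral_cmult[symmetric])
  qed
  also have "\<dots> = (\<integral>\<^sup>+z. ennreal (w (fst z)) * f z \<partial>kernel_prod PX K)"
    by (subst nn_integral_kernel_prod[OF PX K]) auto
  finally show ?thesis .
qed

lemma w_fst_measurable: "(\<lambda>z. w (fst z)) \<in> borel_measurable (kernel_prod PX K)"
  by (simp add: measurable_cong_sets[OF source_law_sets refl])

lemma expectation_w_squared:
  "(\<integral>z. (w (fst z))\<^sup>2 \<partial>kernel_prod PX K) = 1 + chi_square PX w"
proof -
  have int2: "integrable PX (\<lambda>x. (w x)\<^sup>2)"
    using w_bounds by (intro P.integrable_const_bound[where B = "wmax\<^sup>2"]) (auto intro!: AE_I2 power_mono)
  have "(\<integral>\<^sup>+z. ennreal ((w (fst z))\<^sup>2) \<partial>kernel_prod PX K) = (\<integral>\<^sup>+x. \<integral>\<^sup>+y. ennreal ((w x)\<^sup>2) \<partial>K x \<partial>PX)"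
    by (subst nn_integral_kernel_prod[OF PX K]) auto
  also have "\<dots> = (\<integral>\<^sup>+x. ennreal ((w x)\<^sup>2) \<partial>PX)"
  proof (rule nn_integral_cong)
    fix x assume "x \<in> space PX"
    then interpret real_distribution "K x" by (rule kernel_real_distribution[OF K])
    show "(\<integral>\<^sup>+y. ennreal ((w x)\<^sup>2) \<partial>K x) = ennreal ((w x)\<^sup>2)"
      using emeasure_space_1 by simp
  qed
  finally have "(\<integral>z. (w (fst z))\<^sup>2 \<partial>kernel_prod PX K) = (\<integral>x. (w x)\<^sup>2 \<partial>PX)"
    using w_fst_measurable by (subst (1 2) integral_eq_nn_integral) auto
  moreover have "chi_square PX w = (\<integral>x. (w x)\<^sup>2 - 2 * w x + 1 \<partial>PX)"
    unfolding chi_square_def by (simp add: power2_diff algebra_simps)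
  then have "chi_square PX w = (\<integral>x. (w x)\<^sup>2 \<partial>PX) - 1"
    using int2 integrable_w by (simp add: expectation_w P.prob_space)
  ultimately show ?thesis by simp
qed

lemma chi_square_nonneg: "0 \<le> chi_square PX w"
  unfolding chi_square_def by simp

lemma eta_nonneg:
  assumes "0 < \<delta>" "\<delta> < 1"
  shows "0 \<le> eta_w PX w wmax m \<delta>"
  unfolding eta_w_def using assms chi_square_nonneg wmax_ge_1
  by (intro add_nonneg_nonneg mult_nonneg_nonneg divide_nonneg_nonneg real_sqrt_ge_zero) (auto simp: ln_ge_zero_iff)

lemma target_cdf_eq_expectation:
  assumes g [measurable]: "g (\<alpha>/2) \<in> borel_measurable PX" "g (1 - \<alpha>/2) \<in> borel_measurable PX"
  shows "(\<integral>z. w (fst z) * of_bool (cqr_score \<alpha> g (fst z) (snd z) \<le> t) \<partial>kernel_prod PX K) = target_cdf QX K \<alpha> g t"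
proof -
  note [measurable] = cqr_score_measurable[OF g] w_fst_measurable
  have score [measurable]: "(\<lambda>z. cqr_score \<alpha> g (fst z) (snd z)) \<in> borel_measurable (kernel_prod PX K)"
    using cqr_score_measurable[OF g] by (simp add: measurable_cong_sets[OF source_law_sets refl])
  let ?A = "{z \<in> space (kernel_prod QX K). cqr_score \<alpha> g (fst z) (snd z) \<le> t}"
  have A: "?A \<in> sets (kernel_prod QX K)"
    using score_set[OF g] unfolding sets_kernel_prod[OF Q.prob_space_axioms K_QX] .
  have spaces: "space (kernel_prod QX K) = space (kernel_prod PX K)"
    by (simp add: space_kernel_prod[OF PX K] space_kernel_prod[OF Q.prob_space_axioms K_QX] space_QX)
  have "(\<integral>z. w (fst z) * of_bool (cqr_score \<alpha> g (fst z) (snd z) \<le> t) \<partial>kernel_prod PX K)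
      = enn2real (\<integral>\<^sup>+z. ennreal (w (fst z) * of_bool (cqr_score \<alpha> g (fst z) (snd z) \<le> t)) \<partial>kernel_prod PX K)"
    using w_bounds by (intro integral_eq_nn_integral AE_I2) (auto simp: space_kernel_prod[OF PX K])
  also have "(\<integral>\<^sup>+z. ennreal (w (fst z) * of_bool (cqr_score \<alpha> g (fst z) (snd z) \<le> t)) \<partial>kernel_prod PX K)
      = (\<integral>\<^sup>+z. ennreal (w (fst z)) * of_bool (cqr_score \<alpha> g (fst z) (snd z) \<le> t) \<partial>kernel_prod PX K)"
    by (intro nn_integral_cong) auto
  also have "\<dots> = (\<integral>\<^sup>+z. of_bool (cqr_score \<alpha> g (fst z) (snd z) \<le> t) \<partial>kernel_prod QX K)"
    by (rule nn_integral_kernel_prod_QX[symmetric]) measurable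
  also have "\<dots> = (\<integral>\<^sup>+z. indicator ?A z \<partial>kernel_prod QX K)"
    by (intro nn_integral_cong) (auto simp: indicator_def)
  also have "\<dots> = emeasure (kernel_prod QX K) ?A"
    using A by (rule nn_integral_indicator)
  finally show ?thesis unfolding target_cdf_def measure_def .
qed

text \<open>
  With \<open>L = ln (4 / \<delta>)\<close> and second moment \<open>1 + \<chi>\<^sup>2\<close> of the weights, the threshold of the general tail bound
  is \<open>m\<close> times \<open>eta_w\<close>, and the tail is \<open>8 (\<delta> / 4)\<^sup>2 = \<delta>\<^sup>2 / 2\<close>.
\<close>

lemma weighted_ecdf_uniform_tail:
  assumes g [measurable]: "g (\<alpha>/2) \<in> borel_measurable PX" "g (1 - \<alpha>/2) \<in> borel_measurable PX"
    and m: "0 < m" and \<delta>: "0 < \<delta>" "\<delta> < 1"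
  shows "emeasure (sample_law PX K m) {c \<in> space (sample_law PX K m).
      \<exists>t\<in>\<rat>. eta_w PX w wmax m \<delta> < \<bar>weighted_ecdf \<alpha> w g m c t - target_cdf QX K \<alpha> g t\<bar>} \<le> ennreal (\<delta> / 2)"
proof -
  interpret R: prob_space "kernel_prod PX K" by (rule source_law_prob)
  define L where "L = ln (4 / \<delta>)"
  have L: "0 < L" unfolding L_def using \<delta> by simp
  let ?D = "\<lambda>t c. \<Sum>i<m. w (fst (c i)) * of_bool (cqr_score \<alpha> g (fst (c i)) (snd (c i)) \<le> t)
      - R.expectation (\<lambda>z. w (fst z) * of_bool (cqr_score \<alpha> g (fst z) (snd z) \<le> t))"
  let ?x = "9 * sqrt (real (card {..<m}) * R.expectation (\<lambda>z. (w (fst z))\<^sup>2) * L) + 4 / 3 * wmax * L"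
  have score: "(\<lambda>z. cqr_score \<alpha> g (fst z) (snd z)) \<in> borel_measurable (kernel_prod PX K)"
    using cqr_score_measurable[OF g] by (simp add: measurable_cong_sets[OF source_law_sets refl])
  have tail: "emeasure (sample_law PX K m) {c \<in> space (sample_law PX K m). \<exists>t\<in>\<rat>. ?x < \<bar>?D t c\<bar>}
      \<le> ennreal (8 * exp (- 2 * L))"
    unfolding sample_law_def
    by (rule R.weighted_empirical_process_tail[OF countable_rat _ _ w_fst_measurable score])
       (use w_bounds wmax_ge_1 L in \<open>auto simp: space_kernel_prod[OF PX K] intro: Rats_0\<close>)
  have D: "?D t c = real m * (weighted_ecdf \<alpha> w g m c t - target_cdf QX K \<alpha> g t)" for t c
    using m by (simp add: target_cdf_eq_expectation[OF g] weighted_ecdf_def sum_subtractf right_diff_distrib)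
  have "sqrt (real m * (1 + chi_square PX w) * L) = real m * sqrt ((1 + chi_square PX w) * L / real m)"
  proof -
    have "real m * (1 + chi_square PX w) * L = (real m)\<^sup>2 * ((1 + chi_square PX w) * L / real m)"
      using m by (simp add: power2_eq_square)
    moreover have "sqrt ((real m)\<^sup>2 * y) = real m * sqrt y" for y
      by (simp add: real_sqrt_mult)
    ultimately show ?thesis by (simp only:)
  qed
  then have x: "?x = real m * eta_w PX w wmax m \<delta>"
    unfolding eta_w_def expectation_w_squared L_def[symmetric] using m by (simp add: field_simps)
  have "?x < \<bar>?D t c\<bar> \<longleftrightarrow> eta_w PX w wmax m \<delta> < \<bar>weighted_ecdf \<alpha> w g m c t - target_cdf QX K \<alpha> g t\<bar>" for t c
    unfolding x D abs_mult using m by simp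
  moreover have "8 * exp (- 2 * L) \<le> \<delta> / 2"
  proof -
    have "exp (- 2 * L) = inverse (exp L * exp L)"
      by (simp add: exp_minus flip: exp_add)
    also have "exp L = 4 / \<delta>" unfolding L_def using \<delta> by simp
    finally have "8 * exp (- 2 * L) = \<delta> / 2 * \<delta>" by simp
    also have "\<dots> \<le> \<delta> / 2 * 1" using \<delta> by (intro mult_left_mono) auto
    finally show ?thesis by simp
  qed
  ultimately show ?thesis
    using order_trans[OF tail ennreal_leI] by (simp only:)
qed

end


section \<open>Probability of the good event\<close>

locale shifted_cqr_learner = shifted_cqr +
  fixes ft :: "nat \<Rightarrow> (nat \<Rightarrow> 'a \<times> real) \<Rightarrow> real \<Rightarrow> 'a \<Rightarrow> real" and \<epsilon> :: "nat \<Rightarrow> real \<Rightarrow> real" and n m :: nat and \<delta> :: real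
  assumes raw: "measurable_raw_maps PX K \<alpha> ft"
    and accuracy: "endpoint_accuracy PX K \<alpha> p ft \<epsilon>"
    and delta: "0 < \<delta>" "\<delta> < 1"
    and sizes: "1 \<le> n" "1 \<le> m"
begin

lemma prob_space_sample_law: "prob_space (sample_law PX K k)"
  unfolding sample_law_def by (rule prob_space_PiM) (rule source_law_prob)

sublocale TR: prob_space "sample_law PX K n" by (rule prob_space_sample_law)
sublocale CAL: prob_space "sample_law PX K m" by (rule prob_space_sample_law)
sublocale DATA: pair_prob_space "sample_law PX K n" "sample_law PX K m" ..

lemma space_data_law: "space (data_law PX K n m) = space (sample_law PX K n) \<times> space (sample_law PX K m)"
  by (simp add: data_law_def space_pair_measure)

lemma sample_component_measurable:
  "j < k \<Longrightarrow> (\<lambda>c. c j) \<in> sample_law PX K k \<rightarrow>\<^sub>M PX \<Otimes>\<^sub>M borel"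
  unfolding sample_law_def measurable_cong_sets[OF refl source_law_sets, symmetric]
  by (rule measurable_component_singleton) simp

lemma raw_measurable:
  assumes "\<tau> \<in> {\<alpha>/2, 1 - \<alpha>/2}"
  shows "(\<lambda>(d, x). ft n d \<tau> x) \<in> borel_measurable (sample_law PX K n \<Otimes>\<^sub>M PX)"
  using raw sizes assms unfolding measurable_raw_maps_def by blast

lemma raw_section_measurable:
  assumes "\<tau> \<in> {\<alpha>/2, 1 - \<alpha>/2}" "d \<in> space (sample_law PX K n)"
  shows "ft n d \<tau> \<in> borel_measurable PX"
  using measurable_Pair2[OF raw_measurable[OF assms(1)] assms(2)] by simp

lemma score_joint_measurable:
  "(\<lambda>(d, z). cqr_score \<alpha> (ft n d) (fst z) (snd z)) \<in> borel_measurable (sample_law PX K n \<Otimes>\<^sub>M (PX \<Otimes>\<^sub>M borel))"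
proof -
  have end_meas: "(\<lambda>(d, z). ft n d \<tau> (fst z)) \<in> borel_measurable (sample_law PX K n \<Otimes>\<^sub>M (PX \<Otimes>\<^sub>M (borel :: real measure)))"
    if "\<tau> \<in> {\<alpha>/2, 1 - \<alpha>/2}" for \<tau>
  proof -
    have "(\<lambda>(d, z). (d, fst z)) \<in> sample_law PX K n \<Otimes>\<^sub>M (PX \<Otimes>\<^sub>M (borel :: real measure)) \<rightarrow>\<^sub>M sample_law PX K n \<Otimes>\<^sub>M PX"
      by measurable
    from measurable_compose[OF this raw_measurable[OF that]] show ?thesis
      by (simp add: case_prod_unfold)
  qed
  have [measurable]:
    "(\<lambda>(d, z). ft n d (\<alpha>/2) (fst z)) \<in> borel_measurable (sample_law PX K n \<Otimes>\<^sub>M (PX \<Otimes>\<^sub>M (borel :: real measure)))"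
    "(\<lambda>(d, z). ft n d (1 - \<alpha>/2) (fst z)) \<in> borel_measurable (sample_law PX K n \<Otimes>\<^sub>M (PX \<Otimes>\<^sub>M (borel :: real measure)))"
    by (rule end_meas; simp)+
  show ?thesis
    unfolding cqr_score_def sorted_lo_def sorted_hi_def by measurable
qed

definition tr_event :: "real \<Rightarrow> (nat \<Rightarrow> 'a \<times> real) set" where
  "tr_event \<tau> = {d \<in> space (sample_law PX K n).
     Lp_norm p PX (\<lambda>x. ft n d \<tau> x - fstar K \<tau> x) \<le> ennreal (\<epsilon> n (\<delta> / 4))}"

lemma eps_nonneg: "0 \<le> \<epsilon> n (\<delta> / 4)"
  using accuracy sizes delta unfolding endpoint_accuracy_def by auto

lemma tr_event_measurable:
  assumes \<tau>: "\<tau> \<in> {\<alpha>/2, 1 - \<alpha>/2}"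
  shows "tr_event \<tau> \<in> sets (sample_law PX K n)"
  unfolding tr_event_def
proof (rule measurable_Lp_norm_le[OF P.sigma_finite_measure_axioms p eps_nonneg])
  note [measurable] = raw_measurable[OF \<tau>]
  have [measurable]: "fstar K \<tau> \<in> borel_measurable PX"
    using \<tau> alpha by (intro measurable_fstar[OF K]) auto
  show "(\<lambda>(d, x). ft n d \<tau> x - fstar K \<tau> x) \<in> borel_measurable (sample_law PX K n \<Otimes>\<^sub>M PX)"
    by measurable
qed

lemma tr_event_prob:
  assumes \<tau>: "\<tau> \<in> {\<alpha>/2, 1 - \<alpha>/2}"
  shows "1 - \<delta> / 4 \<le> TR.prob (tr_event \<tau>)"
  unfolding tr_event_def
  using accuracy sizes delta \<tau> unfolding endpoint_accuracy_def
  by (meson divide_pos_pos less_divide_eq_1_pos order_less_trans zero_less_numeral divide_less_eq_1_pos one_less_numeral_iff semiring_norm(76))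

text \<open>
  A countable intersection that coincides with the uniform deviation event by right continuity, which
  shows that event to be measurable.
\<close>

definition unif_event :: "((nat \<Rightarrow> 'a \<times> real) \<times> (nat \<Rightarrow> 'a \<times> real)) set" where
  "unif_event = {x \<in> space (data_law PX K n m). \<forall>t\<in>\<rat>.
     \<bar>weighted_ecdf \<alpha> w (ft n (fst x)) m (snd x) t - target_cdf QX K \<alpha> (ft n (fst x)) t\<bar> \<le> eta_w PX w wmax m \<delta>}"

lemma event_unif_eq: "event_unif PX K QX w wmax \<alpha> ft n m \<delta> = unif_event"
proof -
  have "(SUP t::real. ereal \<bar>weighted_ecdf \<alpha> w (ft n d) m c t - target_cdf QX K \<alpha> (ft n d) t\<bar>)
        \<le> ereal (eta_w PX w wmax m \<delta>) \<longleftrightarrow>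
      (\<forall>t\<in>\<rat>. \<bar>weighted_ecdf \<alpha> w (ft n d) m c t - target_cdf QX K \<alpha> (ft n d) t\<bar> \<le> eta_w PX w wmax m \<delta>)"
    if "d \<in> space (sample_law PX K n)" for d c
    using that
    by (intro SUP_ereal_le_iff_rational weighted_ecdf_right_continuous target_cdf_right_continuous raw_section_measurable) auto
  then show ?thesis
    unfolding event_unif_def unif_event_def by (auto simp: space_data_law)
qed

lemma event_tr_eq:
  "event_tr PX K \<alpha> p ft \<epsilon> n m \<delta> = (tr_event (\<alpha>/2) \<inter> tr_event (1 - \<alpha>/2)) \<times> space (sample_law PX K m)"
  unfolding event_tr_def tr_event_def by (auto simp: space_data_law)

lemma weighted_ecdf_measurable:
  "(\<lambda>x. weighted_ecdf \<alpha> w (ft n (fst x)) m (snd x) t) \<in> borel_measurable (data_law PX K n m)"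
proof -
  have comp: "(\<lambda>x. snd x j) \<in> data_law PX K n m \<rightarrow>\<^sub>M PX \<Otimes>\<^sub>M borel" if "j < m" for j
    unfolding data_law_def using measurable_compose[OF measurable_snd sample_component_measurable[OF that]] .
  have "(\<lambda>x. w (fst (snd x j)) * of_bool (cqr_score \<alpha> (ft n (fst x)) (fst (snd x j)) (snd (snd x j)) \<le> t))
      \<in> borel_measurable (data_law PX K n m)" if j: "j < m" for j
  proof -
    have "(\<lambda>x. (fst x, snd x j)) \<in> data_law PX K n m \<rightarrow>\<^sub>M sample_law PX K n \<Otimes>\<^sub>M (PX \<Otimes>\<^sub>M borel)"
      by (rule measurable_Pair[OF _ comp[OF j]]) (simp add: data_law_def)
    from measurable_compose[OF this score_joint_measurable]
    have [measurable]: "(\<lambda>x. cqr_score \<alpha> (ft n (fst x)) (fst (snd x j)) (snd (snd x j))) \<in> borel_measurable (data_law PX K n m)"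
      by simp
    have [measurable]: "(\<lambda>x. w (fst (snd x j))) \<in> borel_measurable (data_law PX K n m)"
      using measurable_compose[OF measurable_compose[OF comp[OF j] measurable_fst] w_measurable] .
    show ?thesis by measurable
  qed
  then show ?thesis
    unfolding weighted_ecdf_def by (intro borel_measurable_times[OF borel_measurable_const borel_measurable_sum]) auto
qed

lemma target_cdf_measurable:
  "(\<lambda>d. target_cdf QX K \<alpha> (ft n d) t) \<in> borel_measurable (sample_law PX K n)"
proof -
  interpret RQ: prob_space "kernel_prod QX K" by (rule prob_space_kernel_prod[OF Q.prob_space_axioms K_QX])
  have sets_RQ: "sets (kernel_prod QX K) = sets (PX \<Otimes>\<^sub>M borel)"
    unfolding sets_kernel_prod[OF Q.prob_space_axioms K_QX] by (rule sets_pair_measure_cong[OF sets_QX refl])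
  define A where "A = {x \<in> space (sample_law PX K n \<Otimes>\<^sub>M kernel_prod QX K).
      cqr_score \<alpha> (ft n (fst x)) (fst (snd x)) (snd (snd x)) \<le> t}"
  have [measurable]: "(\<lambda>x. cqr_score \<alpha> (ft n (fst x)) (fst (snd x)) (snd (snd x)))
      \<in> borel_measurable (sample_law PX K n \<Otimes>\<^sub>M kernel_prod QX K)"
    using score_joint_measurable
    by (simp add: case_prod_unfold measurable_cong_sets[OF sets_pair_measure_cong[OF refl sets_RQ] refl])
  have "A \<in> sets (sample_law PX K n \<Otimes>\<^sub>M kernel_prod QX K)"
    unfolding A_def by measurable
  then have "(\<lambda>d. emeasure (kernel_prod QX K) (Pair d -` A)) \<in> borel_measurable (sample_law PX K n)"
    by (rule RQ.measurable_emeasure_Pair)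
  then have "(\<lambda>d. measure (kernel_prod QX K) (Pair d -` A)) \<in> borel_measurable (sample_law PX K n)"
    unfolding measure_def by measurable
  moreover have "target_cdf QX K \<alpha> (ft n d) t = measure (kernel_prod QX K) (Pair d -` A)"
    if "d \<in> space (sample_law PX K n)" for d
    unfolding target_cdf_def A_def using that
    by (intro arg_cong[where f = "measure _"]) (auto simp: space_pair_measure)
  ultimately show ?thesis by (simp cong: measurable_cong)
qed

lemma unif_event_measurable: "unif_event \<in> sets (data_law PX K n m)"
proof -
  note [measurable] = weighted_ecdf_measurable
  have [measurable]: "(\<lambda>x. target_cdf QX K \<alpha> (ft n (fst x)) t) \<in> borel_measurable (data_law PX K n m)" for t
    unfolding data_law_def by (rule measurable_compose[OF measurable_fst target_cdf_measurable])
  show ?thesis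
    unfolding unif_event_def using countable_rat by measurable
qed

text \<open>
  Conditionally on the training sample the fitted endpoints are fixed, so the tail bound applies to
  every section.
\<close>

lemma unif_event_prob: "1 - \<delta> / 2 \<le> measure (data_law PX K n m) unif_event"
proof -
  interpret DL: prob_space "data_law PX K n m" unfolding data_law_def by (rule DATA.prob_space_axioms)
  let ?C = "space (data_law PX K n m) - unif_event"
  have C: "?C \<in> sets (sample_law PX K n \<Otimes>\<^sub>M sample_law PX K m)"
    using unif_event_measurable by (simp add: data_law_def sets.compl_sets)
  have "emeasure (data_law PX K n m) ?C
      = (\<integral>\<^sup>+d. emeasure (sample_law PX K m) (Pair d -` ?C) \<partial>sample_law PX K n)"
    unfolding data_law_def by (rule CAL.emeasure_pair_measure_alt) (use C in \<open>simp add: data_law_def\<close>)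
  also have "\<dots> \<le> (\<integral>\<^sup>+d. ennreal (\<delta> / 2) \<partial>sample_law PX K n)"
  proof (rule nn_integral_mono)
    fix d assume d: "d \<in> space (sample_law PX K n)"
    have "Pair d -` ?C = {c \<in> space (sample_law PX K m). \<exists>t\<in>\<rat>.
        eta_w PX w wmax m \<delta> < \<bar>weighted_ecdf \<alpha> w (ft n d) m c t - target_cdf QX K \<alpha> (ft n d) t\<bar>}"
      using d unfolding unif_event_def by (auto simp: space_data_law not_le)
    also have "emeasure (sample_law PX K m) \<dots> \<le> ennreal (\<delta> / 2)"
      using d delta sizes by (intro weighted_ecdf_uniform_tail raw_section_measurable) auto
    finally show "emeasure (sample_law PX K m) (Pair d -` ?C) \<le> ennreal (\<delta> / 2)" .
  qed
  also have "\<dots> = ennreal (\<delta> / 2)" by (simp add: TR.emeasure_space_1)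
  finally have "DL.prob ?C \<le> \<delta> / 2"
    using delta by (simp add: DL.emeasure_eq_measure)
  then show ?thesis
    using DL.prob_compl[OF unif_event_measurable] by simp
qed

lemma good_event_prob:
  "1 - \<delta> \<le> measure (data_law PX K n m) (good_event PX K QX w wmax \<alpha> p ft \<epsilon> n m \<delta>)"
proof -
  interpret DL: prob_space "data_law PX K n m" unfolding data_law_def by (rule DATA.prob_space_axioms)
  define A where "A \<tau> = tr_event \<tau> \<times> space (sample_law PX K m)" for \<tau>
  have A: "A \<tau> \<in> sets (data_law PX K n m)" "1 - \<delta> / 4 \<le> DL.prob (A \<tau>)" if "\<tau> \<in> {\<alpha>/2, 1 - \<alpha>/2}" for \<tau>
  proof -
    show "A \<tau> \<in> sets (data_law PX K n m)"
      unfolding A_def data_law_def by (rule pair_measureI[OF tr_event_measurable[OF that] sets.top])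
    have "DL.prob (A \<tau>) = TR.prob (tr_event \<tau>)"
      unfolding A_def data_law_def measure_def
      using tr_event_measurable[OF that] by (simp add: CAL.emeasure_pair_measure_Times CAL.emeasure_space_1)
    then show "1 - \<delta> / 4 \<le> DL.prob (A \<tau>)" using tr_event_prob[OF that] by simp
  qed
  have good: "good_event PX K QX w wmax \<alpha> p ft \<epsilon> n m \<delta> = A (\<alpha>/2) \<inter> A (1 - \<alpha>/2) \<inter> unif_event"
    unfolding good_event_def event_unif_eq event_tr_eq A_def by auto
  let ?\<Omega> = "space (data_law PX K n m)"
  have sets: "A (\<alpha>/2) \<in> DL.events" "A (1 - \<alpha>/2) \<in> DL.events" "unif_event \<in> DL.events"
    using A(1) unif_event_measurable by auto
  have "DL.prob (?\<Omega> - (A (\<alpha>/2) \<inter> A (1 - \<alpha>/2) \<inter> unif_event))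
      = DL.prob ((?\<Omega> - A (\<alpha>/2)) \<union> (?\<Omega> - A (1 - \<alpha>/2)) \<union> (?\<Omega> - unif_event))"
    by (intro arg_cong[where f = DL.prob]) auto
  also have "\<dots> \<le> DL.prob ((?\<Omega> - A (\<alpha>/2)) \<union> (?\<Omega> - A (1 - \<alpha>/2))) + DL.prob (?\<Omega> - unif_event)"
    using sets by (intro measure_Un_le) auto
  also have "\<dots> \<le> DL.prob (?\<Omega> - A (\<alpha>/2)) + DL.prob (?\<Omega> - A (1 - \<alpha>/2)) + DL.prob (?\<Omega> - unif_event)"
    using sets by (intro add_right_mono measure_Un_le) auto
  also have "\<dots> \<le> \<delta> / 4 + \<delta> / 4 + \<delta> / 2"
    using sets A(2)[of "\<alpha>/2"] A(2)[of "1 - \<alpha>/2"] unif_event_prob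
    by (intro add_mono) (auto simp: DL.prob_compl)
  finally have "DL.prob (?\<Omega> - (A (\<alpha>/2) \<inter> A (1 - \<alpha>/2) \<inter> unif_event)) \<le> \<delta>" by simp
  then show ?thesis
    unfolding good using sets by (subst (asm) DL.prob_compl) auto
qed

lemma coverage_error_on_good_event:
  assumes dc: "(d, c) \<in> good_event PX K QX w wmax \<alpha> p ft \<epsilon> n m \<delta>"
    and small_minus: "2 * \<mu>up * exponent_root p wmax * \<epsilon> n (\<delta> / 4) + (2 - \<alpha>) * eta_w PX w wmax m \<delta>
         < 2 * \<mu>low * r_minus \<alpha> \<mu>up r0"
    and small_plus: "2 * \<mu>up * exponent_root p wmax * \<epsilon> n (\<delta> / 4) + (2 - \<alpha>) * eta_w PX w wmax m \<delta>
           + (1 - \<alpha>) * wmax / real m \<le> 2 * \<mu>low * r_plus r0"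
  shows "Lp_norm p QX (\<lambda>x. cov_profile K (weighted_cqr_set \<alpha> w (ft n d) m c) x - (1 - \<alpha>))
         \<le> ennreal (2 * \<mu>up * (1 + \<mu>up / \<mu>low) * exponent_root p wmax * \<epsilon> n (\<delta> / 4))
           + ennreal (\<mu>up / \<mu>low) *
               (ennreal ((2 - \<alpha>) * eta_w PX w wmax m \<delta>)
                + ennreal ((1 - \<alpha>) / real m) * Lp_norm p QX w)"
proof (rule coverage_error_Lp)
  have d: "d \<in> space (sample_law PX K n)" and c: "c \<in> space (sample_law PX K m)"
    using dc by (auto simp: good_event_def event_tr_eq tr_event_def)
  show "ft n d (\<alpha>/2) \<in> borel_measurable PX" "ft n d (1 - \<alpha>/2) \<in> borel_measurable PX"
    using d by (auto intro: raw_section_measurable)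
  show "fst (c j) \<in> space PX" if "j < m" for j
    using measurable_space[OF sample_component_measurable[OF that] c]
    by (auto simp: space_pair_measure)
  show "Lp_norm p PX (\<lambda>x. ft n d \<tau> x - fstar K \<tau> x) \<le> ennreal (\<epsilon> n (\<delta> / 4))" if "\<tau> \<in> {\<alpha>/2, 1 - \<alpha>/2}" for \<tau>
    using dc that by (auto simp: good_event_def event_tr_eq tr_event_def)
  show "\<bar>weighted_ecdf \<alpha> w (ft n d) m c t - target_cdf QX K \<alpha> (ft n d) t\<bar> \<le> eta_w PX w wmax m \<delta>" for t
    using dc by (auto simp: good_event_def event_unif_def SUP_le_iff)
qed (use sizes eps_nonneg eta_nonneg[OF delta] small_minus small_plus in \<open>auto simp: r_plus_def\<close>)

end


section \<open>The conditional coverage bound\<close>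

theorem theorem5:
  fixes PX QX :: "'a measure"
    and K :: "'a \<Rightarrow> real measure"
    and w :: "'a \<Rightarrow> real"
    and ft :: "nat \<Rightarrow> (nat \<Rightarrow> 'a \<times> real) \<Rightarrow> real \<Rightarrow> 'a \<Rightarrow> real"
    and \<epsilon> :: "nat \<Rightarrow> real \<Rightarrow> real"
    and p :: ennreal
    and \<alpha> \<mu>low \<mu>up r0 wmax \<delta> :: real
    and n m :: nat
  assumes alpha: "0 < \<alpha>" "\<alpha> < 1"
    and p: "1 \<le> p"
    and PX: "prob_space PX"
    and K: "K \<in> PX \<rightarrow>\<^sub>M prob_algebra borel"
    and mass: "mass_regularity PX K \<alpha> \<mu>low \<mu>up r0"
    and shift: "known_covariate_shift PX QX w wmax"
    and raw: "measurable_raw_maps PX K \<alpha> ft"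
    and accuracy: "endpoint_accuracy PX K \<alpha> p ft \<epsilon>"
    and delta: "0 < \<delta>" "\<delta> < 1"
    and sizes: "1 \<le> n" "1 \<le> m"
    and small_minus:
      "2 * \<mu>up * exponent_root p wmax * \<epsilon> n (\<delta> / 4) + (2 - \<alpha>) * eta_w PX w wmax m \<delta>
         < 2 * \<mu>low * r_minus \<alpha> \<mu>up r0"
    and small_plus:
      "2 * \<mu>up * exponent_root p wmax * \<epsilon> n (\<delta> / 4) + (2 - \<alpha>) * eta_w PX w wmax m \<delta>
           + (1 - \<alpha>) * wmax / real m
         \<le> 2 * \<mu>low * r_plus r0"
  shows "measure (data_law PX K n m) (good_event PX K QX w wmax \<alpha> p ft \<epsilon> n m \<delta>) \<ge> 1 - \<delta> \<and>
    (\<forall>(d, c) \<in> good_event PX K QX w wmax \<alpha> p ft \<epsilon> n m \<delta>.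
       Lp_norm p QX (\<lambda>x. cov_profile K (weighted_cqr_set \<alpha> w (ft n d) m c) x - (1 - \<alpha>))
         \<le> ennreal (2 * \<mu>up * (1 + \<mu>up / \<mu>low) * exponent_root p wmax * \<epsilon> n (\<delta> / 4))
           + ennreal (\<mu>up / \<mu>low) *
               (ennreal ((2 - \<alpha>) * eta_w PX w wmax m \<delta>)
                + ennreal ((1 - \<alpha>) / real m) * Lp_norm p QX w))"
proof -
  interpret shifted_cqr_learner PX QX K w \<alpha> \<mu>low \<mu>up r0 wmax p ft \<epsilon> n m \<delta>
    by (intro shifted_cqr_learner.intro shifted_cqr.intro shifted_cqr_learner_axioms.intro) fact+
  show ?thesis
    using good_event_prob coverage_error_on_good_event[OF _ small_minus small_plus] by blast
qed

end
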